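(* Let $S_{\boldsymbol{\lambda}}$ be a contractive weighted shift on the directed tree $\mathcal{T}=(V,E)$ such that $S_{\boldsymbol{\lambda}}\notin C_{0\cdot}(\ell^2(V))$. Then the isometric asymptote $U$ of $S_{\boldsymbol{\lambda}}$ acts on $\ell^2(V')$ and is the weighted shift $U=S_{\boldsymbol{\beta}}\in\mathcal{B}(\ell^2(V'))$ on the subtree $\mathcal{T}'=(V',E')$ with weights $$\boldsymbol{\beta}=\Big\{\beta_{v'}=\frac{\lambda_{v'}\sqrt{\alpha_{v'}}}{\sqrt{\alpha_{\mathrm{par}(v')}}}\colon v'\in(V')^\circ\Big\}.$$ Moreover, this isometry is unitarily equivalent to the following orthogonal sum: (i) $\sum_{j=1}^{\mathrm{Br}(\mathcal{T}')+1}\oplus S^+$, if $\mathcal{T}$ has a root; (ii) $\sum_{j=1}^{\mathrm{Br}(\mathcal{T}')}\oplus S^+$, if $\mathcal{T}$ has no root and $U$ is a c.n.u. isometry, i.e. when $\sum_{v'\in\mathrm{Gen}_{\mathcal{T}'}(u')}\prod_{j=0}^\infty\beta_{\mathrm{par}^j(v')}^2=0$ for some $u'\in V'$; (iii) $S\oplus\sum_{j=1}^{\mathrm{Br}(\mathcal{T}')}\oplus S^+$, if $\mathcal{T}$ has no root and $U$ is not a c.n.u. isometry.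
   Context: A directed tree $\mathcal{T}=(V,E)$ consists of a non-empty vertex set $V$ and an edge set $E\subseteq V\times V\setminus\{(v,v)\colon v\in V\}$ such that there are no directed circuits, the underlying undirected graph is connected, and each vertex $v$ has at most one parent, i.e. at most one $u$ with $(u,v)\in E$; this $u$ is denoted $\mathrm{par}(v)$. A vertex without a parent is a root; there is at most one. $V^\circ$ is $V$ minus the root if a root exists, and $V^\circ=V$ otherwise. $\mathrm{Chi}(u)=\mathrm{Chi}_{\mathcal{T}}(u)=\{v\colon(u,v)\in E\}$; $\mathrm{Chi}(W)=\bigcup_{v\in W}\mathrm{Chi}(v)$, $\mathrm{Chi}^0(W)=W$, $\mathrm{Chi}^{n+1}(W)=\mathrm{Chi}(\mathrm{Chi}^n(W))$, $\mathrm{Chi}^n(u)=\mathrm{Chi}^n(\{u\})$; $\mathrm{par}^k$ is the $k$-fold iterate of $\mathrm{par}$ where defined, $\mathrm{par}^0$ the identity. In a rootless tree, $\mathrm{Gen}_{\mathcal{T}}(u)=\bigcup_{n=0}^\infty\mathrm{Chi}^n(\mathrm{par}^n(u))$. The branching index is $\mathrm{Br}(\mathcal{T})=\sum_{u\colon|\mathrm{Chi}(u)|>1}(|\mathrm{Chi}(u)|-1)\in\mathbb{N}_0\cup\{\infty\}$, where $|C|=\infty$ for every infinite set $C$. $\ell^2(V)$ is the complex Hilbert space of square-summable functions on $V$ with orthonormal basis $\{e_u\}_{u\in V}$. Given weights $\boldsymbol{\lambda}=\{\lambda_v\colon v\in V^\circ\}\subseteq(0,\infty)$ with $\sup_{u\in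 V}\sum_{v\in\mathrm{Chi}(u)}\lambda_v^2<\infty$, the weighted shift $S_{\boldsymbol{\lambda}}$ on $\mathcal{T}$ is the bounded operator on $\ell^2(V)$ with $S_{\boldsymbol{\lambda}}e_u=\sum_{v\in\mathrm{Chi}(u)}\lambda_ve_v$ (all weights are assumed positive; hence $V$ is countable). It is contractive if $\|S_{\boldsymbol{\lambda}}\|\le1$. For a contraction $T\in\mathcal{B}(\mathcal{H})$, the asymptotic limit is $A=A_T=\lim_{n}T^{*n}T^n$ (strong operator topology); the stable subspace is $\mathcal{H}_0(T)=\ker A_T=\{h\colon\|T^nh\|\to0\}$; $T\in C_{0\cdot}(\mathcal{H})$ means $\mathcal{H}_0(T)=\mathcal{H}$. The isometric asymptote of $T$ is the unique isometry $U$ on the closure of $\mathrm{ran}(A_T)$ (which equals $\mathcal{H}_0(T)^\perp$) satisfying $A_T^{1/2}T=UA_T^{1/2}$. For the contractive $S_{\boldsymbol{\lambda}}$ the limits $\alpha_u=\lim_{n}\sum_{v\in\mathrm{Chi}^n(u)}\prod_{j=0}^{n-1}\lambda_{\mathrm{par}^j(v)}^2\in[0,1]$ exist and $Ae_u=\alpha_ue_u$. $V'=\{u\in V\colon\alpha_u>0\}$, so $\mathcal{H}_0(S_{\boldsymbol{\lambda}})^\perp=\ell^2(V')$, and $\mathcal{T}'=(V',E')$ with $E'=E\cap(V'\times V')$; when $V'\neq\emptyset$ this is a directed tree, which has a root if and only if $\mathcal{T}$ does (the same root), and parents in $\mathcal{T}'$ coincide with parents in $\mathcal{T}$. A contraction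 is completely non-unitary (c.n.u.) if the only reducing subspace on which it is unitary is $\{0\}$. $S$ is the bilateral shift $Se_n=e_{n+1}$ on $\ell^2(\mathbb{Z})$, and $S^+$ is the unilateral shift $S^+e_k=e_{k+1}$ on $\ell^2(\mathbb{N}_0)$. $\sum_{j=1}^{N}\oplus S^+$ is the orthogonal sum of $N$ copies of $S^+$: countably infinitely many if $N=\infty$, and absent if $N=0$. *)

theory Defs
  imports "HOL-Analysis.Analysis"
begin

section \<open>Directed trees\<close>

text \<open>A loop would be a circuit of length one, so \<open>acyclic\<close> covers loops as well.\<close>

definition directed_tree :: "'a set \<Rightarrow> ('a \<times> 'a) set \<Rightarrow> bool" where
  "directed_tree V E \<longleftrightarrow>
     V \<noteq> {} \<and> E \<subseteq> V \<times> V - {(v, v) | v. v \<in> V} \<and> acyclic E \<and>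
     (\<forall>u\<in>V. \<forall>v\<in>V. (u, v) \<in> (E \<union> E\<inverse>)\<^sup>*) \<and>
     (\<forall>v u w. (u, v) \<in> E \<and> (w, v) \<in> E \<longrightarrow> u = w)"

definition is_root :: "'a set \<Rightarrow> ('a \<times> 'a) set \<Rightarrow> 'a \<Rightarrow> bool" where
  "is_root V E r \<longleftrightarrow> r \<in> V \<and> (\<nexists>u. (u, r) \<in> E)"

definition has_root :: "'a set \<Rightarrow> ('a \<times> 'a) set \<Rightarrow> bool" where
  "has_root V E \<longleftrightarrow> (\<exists>r. is_root V E r)"

definition non_roots :: "'a set \<Rightarrow> ('a \<times> 'a) set \<Rightarrow> 'a set" where
  "non_roots V E = V - {r. is_root V E r}"

definition par :: "('a \<times> 'a) set \<Rightarrow> 'a \<Rightarrow> 'a" where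
  "par E v = (THE u. (u, v) \<in> E)"

definition Chi :: "('a \<times> 'a) set \<Rightarrow> 'a \<Rightarrow> 'a set" where
  "Chi E u = {v. (u, v) \<in> E}"

definition Chi_pow :: "('a \<times> 'a) set \<Rightarrow> nat \<Rightarrow> 'a \<Rightarrow> 'a set" where
  "Chi_pow E n u = ((\<lambda>W. \<Union>v\<in>W. Chi E v) ^^ n) {u}"

definition Gen :: "('a \<times> 'a) set \<Rightarrow> 'a \<Rightarrow> 'a set" where
  "Gen E u = (\<Union>n. Chi_pow E n ((par E ^^ n) u))"

definition ecard :: "'a set \<Rightarrow> enat" where
  "ecard A = (if finite A then enat (card A) else \<infinity>)"

definition Br :: "'a set \<Rightarrow> ('a \<times> 'a) set \<Rightarrow> enat" where
  "Br V E = (\<Sum>\<^sub>\<infinity>u\<in>{u \<in> V. 1 < ecard (Chi E u)}. ecard (Chi E u) - 1)"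


section \<open>The spaces \<open>\<ell>\<^sup>2(V)\<close> and operators between their subspaces\<close>

text \<open>Vectors of \<open>\<ell>\<^sup>2(V)\<close> are functions on the whole type that vanish outside \<open>V\<close>, so that
  \<open>\<ell>\<^sup>2(W)\<close> is a subset of \<open>\<ell>\<^sup>2(V)\<close> whenever \<open>W \<subseteq> V\<close>.\<close>

definition ell2 :: "'a set \<Rightarrow> ('a \<Rightarrow> complex) set" where
  "ell2 V = {f. (\<forall>x. x \<notin> V \<longrightarrow> f x = 0) \<and> (\<lambda>x. (cmod (f x))\<^sup>2) summable_on V}"

definition l2_inner :: "('a \<Rightarrow> complex) \<Rightarrow> ('a \<Rightarrow> complex) \<Rightarrow> complex" where
  "l2_inner f g = (\<Sum>\<^sub>\<infinity>x. f x * cnj (g x))"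

definition l2_norm :: "('a \<Rightarrow> complex) \<Rightarrow> real" where
  "l2_norm f = sqrt (\<Sum>\<^sub>\<infinity>x. (cmod (f x))\<^sup>2)"

definition l2_closure :: "('a \<Rightarrow> complex) set \<Rightarrow> ('a \<Rightarrow> complex) set" where
  "l2_closure X = {h \<in> ell2 UNIV. \<forall>\<epsilon>>0. \<exists>g\<in>X. l2_norm (\<lambda>x. h x - g x) < \<epsilon>}"

definition closed_subspace :: "('a \<Rightarrow> complex) set \<Rightarrow> bool" where
  "closed_subspace L \<longleftrightarrow>
     L \<subseteq> ell2 UNIV \<and> (\<lambda>_. 0) \<in> L \<and>
     (\<forall>f\<in>L. \<forall>g\<in>L. \<forall>c. (\<lambda>x. c * f x + g x) \<in> L) \<and>
     l2_closure L = L"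

definition ket :: "'a \<Rightarrow> 'a \<Rightarrow> complex" where
  "ket u = (\<lambda>x. if x = u then 1 else 0)"

definition linear_map_on ::
    "('a \<Rightarrow> complex) set \<Rightarrow> (('a \<Rightarrow> complex) \<Rightarrow> ('b \<Rightarrow> complex)) \<Rightarrow> bool" where
  "linear_map_on M T \<longleftrightarrow>
     (\<forall>f\<in>M. \<forall>g\<in>M. \<forall>c. T (\<lambda>x. c * f x + g x) = (\<lambda>y. c * T f y + T g y))"

text \<open>Operators are extensional functions on their domain, so that equality of operators
  is equality of functions and definite descriptions of operators make sense.\<close>

definition bounded_ops ::
    "('a \<Rightarrow> complex) set \<Rightarrow> ('b \<Rightarrow> complex) set \<Rightarrow> (('a \<Rightarrow> complex) \<Rightarrow> ('b \<Rightarrow> complex)) set" where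
  "bounded_ops M N = {T \<in> M \<rightarrow>\<^sub>E N. linear_map_on M T \<and>
     (\<exists>c. \<forall>f\<in>M. l2_norm (T f) \<le> c * l2_norm f)}"

definition op_norm ::
    "('a \<Rightarrow> complex) set \<Rightarrow> (('a \<Rightarrow> complex) \<Rightarrow> ('b \<Rightarrow> complex)) \<Rightarrow> real" where
  "op_norm M T = (SUP f\<in>{f \<in> M. l2_norm f \<le> 1}. l2_norm (T f))"

definition isometry_on ::
    "('a \<Rightarrow> complex) set \<Rightarrow> (('a \<Rightarrow> complex) \<Rightarrow> ('a \<Rightarrow> complex)) \<Rightarrow> bool" where
  "isometry_on M U \<longleftrightarrow>
     U \<in> M \<rightarrow>\<^sub>E M \<and> linear_map_on M U \<and> (\<forall>f\<in>M. l2_norm (U f) = l2_norm f)"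

text \<open>The bounded operator from \<open>\<ell>\<^sup>2(V)\<close> to \<open>\<ell>\<^sup>2(W)\<close> with prescribed values \<open>b u\<close> on the
  orthonormal basis.\<close>

definition op_of_basis ::
    "'a set \<Rightarrow> 'b set \<Rightarrow> ('a \<Rightarrow> ('b \<Rightarrow> complex)) \<Rightarrow> ('a \<Rightarrow> complex) \<Rightarrow> ('b \<Rightarrow> complex)" where
  "op_of_basis V W b =
     (THE T. T \<in> bounded_ops (ell2 V) (ell2 W) \<and> (\<forall>u\<in>V. T (ket u) = b u))"

definition unitarily_equivalent ::
    "('a \<Rightarrow> complex) set \<Rightarrow> (('a \<Rightarrow> complex) \<Rightarrow> ('a \<Rightarrow> complex)) \<Rightarrow>
     ('b \<Rightarrow> complex) set \<Rightarrow> (('b \<Rightarrow> complex) \<Rightarrow> ('b \<Rightarrow> complex)) \<Rightarrow> bool" where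
  "unitarily_equivalent M T N R \<longleftrightarrow>
     (\<exists>W. linear_map_on M W \<and> W ` M = N \<and> (\<forall>f\<in>M. l2_norm (W f) = l2_norm f) \<and>
          (\<forall>f\<in>M. W (T f) = R (W f)))"


section \<open>Asymptotics of contractions\<close>

definition l2_adjoint ::
    "('a \<Rightarrow> complex) set \<Rightarrow> (('a \<Rightarrow> complex) \<Rightarrow> ('a \<Rightarrow> complex)) \<Rightarrow>
     ('a \<Rightarrow> complex) \<Rightarrow> ('a \<Rightarrow> complex)" where
  "l2_adjoint H T =
     (\<lambda>g\<in>H. THE h. h \<in> H \<and> (\<forall>f\<in>H. l2_inner (T f) g = l2_inner f h))"

definition asymptotic_limit ::
    "('a \<Rightarrow> complex) set \<Rightarrow> (('a \<Rightarrow> complex) \<Rightarrow> ('a \<Rightarrow> complex)) \<Rightarrow>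
     ('a \<Rightarrow> complex) \<Rightarrow> ('a \<Rightarrow> complex)" where
  "asymptotic_limit H T =
     (\<lambda>f\<in>H. THE h. h \<in> H \<and>
        (\<lambda>n. l2_norm (\<lambda>x. (l2_adjoint H T ^^ n) ((T ^^ n) f) x - h x)) \<longlonglongrightarrow> 0)"

definition stable_subspace ::
    "('a \<Rightarrow> complex) set \<Rightarrow> (('a \<Rightarrow> complex) \<Rightarrow> ('a \<Rightarrow> complex)) \<Rightarrow> ('a \<Rightarrow> complex) set" where
  "stable_subspace H T = {h \<in> H. (\<lambda>n. l2_norm ((T ^^ n) h)) \<longlonglongrightarrow> 0}"

definition C0_dot ::
    "('a \<Rightarrow> complex) set \<Rightarrow> (('a \<Rightarrow> complex) \<Rightarrow> ('a \<Rightarrow> complex)) \<Rightarrow> bool" where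
  "C0_dot H T \<longleftrightarrow> stable_subspace H T = H"

definition pos_sqrt ::
    "('a \<Rightarrow> complex) set \<Rightarrow> (('a \<Rightarrow> complex) \<Rightarrow> ('a \<Rightarrow> complex)) \<Rightarrow>
     ('a \<Rightarrow> complex) \<Rightarrow> ('a \<Rightarrow> complex)" where
  "pos_sqrt H A =
     (THE R. R \<in> bounded_ops H H \<and>
        (\<forall>f\<in>H. l2_inner (R f) f \<in> \<real>\<^sub>\<ge>\<^sub>0) \<and> (\<forall>f\<in>H. R (R f) = A f))"

definition asymptote_space ::
    "('a \<Rightarrow> complex) set \<Rightarrow> (('a \<Rightarrow> complex) \<Rightarrow> ('a \<Rightarrow> complex)) \<Rightarrow> ('a \<Rightarrow> complex) set" where
  "asymptote_space H T = l2_closure (asymptotic_limit H T ` H)"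

definition isometric_asymptote ::
    "('a \<Rightarrow> complex) set \<Rightarrow> (('a \<Rightarrow> complex) \<Rightarrow> ('a \<Rightarrow> complex)) \<Rightarrow>
     ('a \<Rightarrow> complex) \<Rightarrow> ('a \<Rightarrow> complex)" where
  "isometric_asymptote H T =
     (THE U. isometry_on (asymptote_space H T) U \<and>
        (\<forall>h\<in>H. pos_sqrt H (asymptotic_limit H T) (T h) =
                U (pos_sqrt H (asymptotic_limit H T) h)))"

text \<open>A closed subspace \<open>L\<close> of \<open>H\<close> reduces \<open>T\<close> iff \<open>L\<close> and \<open>H \<ominus> L\<close> are both invariant.\<close>

definition reducing_subspace ::
    "('a \<Rightarrow> complex) set \<Rightarrow> (('a \<Rightarrow> complex) \<Rightarrow> ('a \<Rightarrow> complex)) \<Rightarrow> ('a \<Rightarrow> complex) set \<Rightarrow> bool" where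
  "reducing_subspace H T L \<longleftrightarrow>
     closed_subspace L \<and> L \<subseteq> H \<and> T ` L \<subseteq> L \<and>
     (\<forall>h\<in>H. (\<forall>g\<in>L. l2_inner h g = 0) \<longrightarrow> (\<forall>g\<in>L. l2_inner (T h) g = 0))"

definition completely_nonunitary ::
    "('a \<Rightarrow> complex) set \<Rightarrow> (('a \<Rightarrow> complex) \<Rightarrow> ('a \<Rightarrow> complex)) \<Rightarrow> bool" where
  "completely_nonunitary H T \<longleftrightarrow>
     (\<forall>L. reducing_subspace H T L \<and> T ` L = L \<and> (\<forall>f\<in>L. l2_norm (T f) = l2_norm f)
        \<longrightarrow> L = {\<lambda>_. 0})"


section \<open>Unweighted shifts and orthogonal sums\<close>

definition bilateral_shift :: "(int \<Rightarrow> complex) \<Rightarrow> (int \<Rightarrow> complex)" where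
  "bilateral_shift = op_of_basis UNIV UNIV (\<lambda>n. ket (n + 1))"

definition unilateral_shift :: "(nat \<Rightarrow> complex) \<Rightarrow> (nat \<Rightarrow> complex)" where
  "unilateral_shift = op_of_basis UNIV UNIV (\<lambda>k. ket (k + 1))"

text \<open>The Hilbert space sum of the spaces \<open>\<ell>\<^sup>2(X j)\<close>, \<open>j \<in> J\<close>, is realised as \<open>\<ell>\<^sup>2\<close> of the
  disjoint union: the \<open>j\<close>-th component of \<open>f\<close> is \<open>\<lambda>x. f (j, x)\<close>. Likewise for two summands
  with index sets of different types.\<close>

definition orth_sum ::
    "'j set \<Rightarrow> ('j \<Rightarrow> 'a set) \<Rightarrow> ('j \<Rightarrow> ('a \<Rightarrow> complex) \<Rightarrow> ('a \<Rightarrow> complex)) \<Rightarrow>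
     ('j \<times> 'a \<Rightarrow> complex) \<Rightarrow> ('j \<times> 'a \<Rightarrow> complex)" where
  "orth_sum J X T =
     (\<lambda>f\<in>ell2 (Sigma J X). \<lambda>(j, x). if j \<in> J then T j (\<lambda>y. f (j, y)) x else 0)"

definition orth_sum2 ::
    "'a set \<Rightarrow> (('a \<Rightarrow> complex) \<Rightarrow> ('a \<Rightarrow> complex)) \<Rightarrow>
     'b set \<Rightarrow> (('b \<Rightarrow> complex) \<Rightarrow> ('b \<Rightarrow> complex)) \<Rightarrow>
     ('a + 'b \<Rightarrow> complex) \<Rightarrow> ('a + 'b \<Rightarrow> complex)" where
  "orth_sum2 X T Y R =
     (\<lambda>f\<in>ell2 (X <+> Y). case_sum (T (\<lambda>x. f (Inl x))) (R (\<lambda>y. f (Inr y))))"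

definition copies :: "enat \<Rightarrow> nat set" where
  "copies N = {j. enat j < N}"

definition shift_sum :: "enat \<Rightarrow> (nat \<times> nat \<Rightarrow> complex) \<Rightarrow> (nat \<times> nat \<Rightarrow> complex)" where
  "shift_sum N = orth_sum (copies N) (\<lambda>_. UNIV) (\<lambda>_. unilateral_shift)"


section \<open>Weighted shifts on directed trees\<close>

definition admissible_weights :: "'a set \<Rightarrow> ('a \<times> 'a) set \<Rightarrow> ('a \<Rightarrow> real) \<Rightarrow> bool" where
  "admissible_weights V E lam \<longleftrightarrow>
     (\<forall>v\<in>non_roots V E. 0 < lam v) \<and>
     (\<exists>C. \<forall>u\<in>V. (\<lambda>v. (lam v)\<^sup>2) summable_on Chi E u \<and> (\<Sum>\<^sub>\<infinity>v\<in>Chi E u. (lam v)\<^sup>2) \<le> C)"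

text \<open>The series \<open>\<Sum>v. \<lambda>\<^sub>v e\<^sub>v\<close> over the children of \<open>u\<close> is evaluated pointwise.\<close>

definition weighted_shift ::
    "'a set \<Rightarrow> ('a \<times> 'a) set \<Rightarrow> ('a \<Rightarrow> real) \<Rightarrow> ('a \<Rightarrow> complex) \<Rightarrow> ('a \<Rightarrow> complex)" where
  "weighted_shift V E lam =
     op_of_basis V V (\<lambda>u w. \<Sum>\<^sub>\<infinity>v\<in>Chi E u. complex_of_real (lam v) * ket v w)"

definition alpha :: "('a \<times> 'a) set \<Rightarrow> ('a \<Rightarrow> real) \<Rightarrow> 'a \<Rightarrow> real" where
  "alpha E lam u =
     lim (\<lambda>n. \<Sum>\<^sub>\<infinity>v\<in>Chi_pow E n u. \<Prod>j<n. (lam ((par E ^^ j) v))\<^sup>2)"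

definition supp_V :: "'a set \<Rightarrow> ('a \<times> 'a) set \<Rightarrow> ('a \<Rightarrow> real) \<Rightarrow> 'a set" where
  "supp_V V E lam = {u \<in> V. 0 < alpha E lam u}"

definition supp_E :: "'a set \<Rightarrow> ('a \<times> 'a) set \<Rightarrow> ('a \<Rightarrow> real) \<Rightarrow> ('a \<times> 'a) set" where
  "supp_E V E lam = E \<inter> (supp_V V E lam \<times> supp_V V E lam)"

definition beta :: "('a \<times> 'a) set \<Rightarrow> ('a \<Rightarrow> real) \<Rightarrow> 'a \<Rightarrow> real" where
  "beta E lam v = lam v * sqrt (alpha E lam v) / sqrt (alpha E lam (par E v))"

text \<open>The infinite product is the limit of the partial products; \<open>prodinf\<close> is not usable since
  it does not regard a product tending to \<open>0\<close> as convergent. The values are taken in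
  \<open>[0, \<infinity>]\<close> so that the sum is meaningful without any summability side condition.\<close>

definition gen_sum :: "('a \<times> 'a) set \<Rightarrow> ('a \<Rightarrow> real) \<Rightarrow> 'a \<Rightarrow> ennreal" where
  "gen_sum E b u =
     (\<Sum>\<^sub>\<infinity>v\<in>Gen E u. ennreal (lim (\<lambda>n. \<Prod>j<n. (b ((par E ^^ j) v))\<^sup>2)))"

end

theory Submission
  imports Defs
begin

text \<open>
  In the basis \<open>e\<^sub>u\<close> the operators \<open>S\<^sup>*\<^sup>n S\<^sup>n\<close> are diagonal, hence so are \<open>A\<close> and its square root, and the
  intertwining relation determines the isometric asymptote \<open>U\<close>. The weights \<open>\<beta>\<close> satisfy
  \<open>\<Sum>\<^sub>v \<beta>\<^sub>v\<^sup>2 = 1\<close> over the children of every vertex, because \<open>\<alpha>\<^sub>u = \<Sum>\<^sub>v \<lambda>\<^sub>v\<^sup>2 \<alpha>\<^sub>v\<close>.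
  For such an isometric shift, the wandering subspace \<open>ker U\<^sup>*\<close> is the sum over all \<open>u\<close> of
  \<open>\<ell>\<^sup>2(Chi(u))\<close> without the vector \<open>U e\<^sub>u\<close>, plus \<open>e\<^sub>r\<close> for a root \<open>r\<close>; it has an explicit
  orthonormal basis indexed by the vertices that are not the first child of their parent.
  A vector \<open>f\<close> orthogonal to all shifted wandering vectors is of the form \<open>U\<^sup>n g\<^sub>n\<close> for
  every \<open>n\<close>. This forces \<open>f = 0\<close> if there is a root; otherwise \<open>f\<close> is on each
  generation proportional to \<open>h v = \<Prod>\<^sub>j \<beta>(par\<^sup>j v)\<close>, which vanishes either nowhere or everywhere.
  If \<open>h\<close> does not vanish, \<open>U\<close> maps its restriction to one generation to the restriction to
  the next one, and these vectors carry the bilateral shift.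
\<close>

section \<open>Operators between spaces \<open>\<ell>\<^sup>2(V)\<close>\<close>

text \<open>The obstacle is that a vertex may have infinitely many children, so that finite linear
  algebra does not provide a basis of ker U*. Ordering each set of children by an enumeration of V
  and orthogonalising every child against its finitely many predecessors yields finitely supported
  vectors, and their totality is an induction along the enumeration. Every unitary equivalence then
  follows from one criterion: a total orthonormal family which U moves in the way the model moves
  its standard basis. Leaving out one child per vertex turns the multiplicity into the cardinality
  of a set of vertices. The alternative for \<open>h\<close> holds because h v = \<beta>_v h(par v)
  with positive weights, and any two vertices have a common ancestor. The restriction of
  \<open>h\<close> to a generation is square-summable because on finitely many vertices of it
  \<open>h\<close> is dominated by U^n e_w for a common ancestor w. The sum in the criterion for
  complete non-unitarity is the squared norm of such a restriction, which is why it decides between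
  the two rootless cases.\<close>

lemma le_if_square_le_mult:
  fixes s C :: real
  assumes "s * s \<le> C * s" "0 \<le> s" "0 \<le> C"
  shows "s \<le> C"
  using assms mult_right_le_imp_le[of s s C] by (cases "s = 0") auto

text \<open>Norms and inner products are sums over the whole type, while \<open>ell2 V\<close> asks
  for summability on V. Membership splits into a support condition and summability on the whole
  type.\<close>

lemma ell2_iff: "f \<in> ell2 V \<longleftrightarrow> f \<in> ell2 UNIV \<and> (\<forall>x. x \<notin> V \<longrightarrow> f x = 0)"
proof -
  have "(\<lambda>x. (cmod (f x))\<^sup>2) summable_on V \<longleftrightarrow> (\<lambda>x. (cmod (f x))\<^sup>2) summable_on UNIV"
    if "\<forall>x. x \<notin> V \<longrightarrow> f x = 0"
    by (rule summable_on_cong_neutral) (use that in auto)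
  then show ?thesis by (auto simp: ell2_def)
qed

lemma ell2_zero_outside: "f \<in> ell2 V \<Longrightarrow> x \<notin> V \<Longrightarrow> f x = 0"
  by (simp add: ell2_def)

lemma ell2_mono: "V \<subseteq> W \<Longrightarrow> f \<in> ell2 V \<Longrightarrow> f \<in> ell2 W"
  using ell2_iff by blast

lemma ell2_UNIV_I: "f \<in> ell2 V \<Longrightarrow> f \<in> ell2 UNIV"
  using ell2_iff by blast

lemma ell2_summable: "f \<in> ell2 V \<Longrightarrow> (\<lambda>x. (cmod (f x))\<^sup>2) summable_on A"
  using ell2_iff[of f V] by (auto simp: ell2_def intro: summable_on_subset_banach)

lemma ell2_I_bound:
  assumes "\<And>x. x \<notin> V \<Longrightarrow> f x = 0"
    and "\<And>F. finite F \<Longrightarrow> F \<subseteq> V \<Longrightarrow> (\<Sum>x\<in>F. (cmod (f x))\<^sup>2) \<le> C"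
  shows "f \<in> ell2 V"
  unfolding ell2_def using assms
  by (auto intro!: nonneg_bdd_above_summable_on bdd_aboveI2)

lemma l2_norm_nonneg [simp]: "0 \<le> l2_norm f"
  by (simp add: l2_norm_def infsum_nonneg)

lemma l2_norm_sq: "(l2_norm f)\<^sup>2 = (\<Sum>\<^sub>\<infinity>x. (cmod (f x))\<^sup>2)"
  by (simp add: l2_norm_def infsum_nonneg)

lemma l2_norm_sq_on:
  assumes "f \<in> ell2 V"
  shows "(l2_norm f)\<^sup>2 = (\<Sum>\<^sub>\<infinity>x\<in>V. (cmod (f x))\<^sup>2)"
  unfolding l2_norm_sq by (rule infsum_cong_neutral) (use assms in \<open>auto simp: ell2_def\<close>)

lemma finite_sum_le_l2_norm:
  assumes "f \<in> ell2 V" "finite F"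
  shows "(\<Sum>x\<in>F. (cmod (f x))\<^sup>2) \<le> (l2_norm f)\<^sup>2"
  unfolding l2_norm_sq
  by (rule finite_sum_le_infsum) (use assms ell2_summable in auto)

lemma cmod_le_l2_norm: "f \<in> ell2 V \<Longrightarrow> cmod (f x) \<le> l2_norm f"
  using finite_sum_le_l2_norm[of f V "{x}"] by (simp add: power2_le_iff_abs_le)

lemma l2_norm_le:
  assumes "f \<in> ell2 V" "0 \<le> C"
    and "\<And>F. finite F \<Longrightarrow> F \<subseteq> V \<Longrightarrow> (\<Sum>x\<in>F. (cmod (f x))\<^sup>2) \<le> C\<^sup>2"
  shows "l2_norm f \<le> C"
proof -
  have "(l2_norm f)\<^sup>2 \<le> C\<^sup>2"
    unfolding l2_norm_sq_on[OF assms(1)]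
    by (rule infsum_le_finite_sums) (use assms ell2_summable in auto)
  then show ?thesis using assms(2) power2_le_imp_le by blast
qed

lemma l2_norm_eq_0:
  assumes "f \<in> ell2 V" "l2_norm f = 0"
  shows "f = (\<lambda>_. 0)"
proof
  fix x show "f x = 0" using cmod_le_l2_norm[OF assms(1), of x] assms(2) by simp
qed

lemma l2_norm_zero [simp]: "l2_norm (\<lambda>_. 0) = 0"
  by (simp add: l2_norm_def)

lemma zero_in_ell2 [simp]: "(\<lambda>_. 0) \<in> ell2 V"
  by (simp add: ell2_def)

lemma ell2_lincomb:
  assumes "f \<in> ell2 V" "g \<in> ell2 V"
  shows "(\<lambda>x. c * f x + g x) \<in> ell2 V"
proof -
  have "(\<lambda>x. (cmod (c * f x + g x))\<^sup>2) summable_on V"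
  proof (rule summable_on_comparison_test)
    show "(\<lambda>x. 2 * (cmod c)\<^sup>2 * (cmod (f x))\<^sup>2 + 2 * (cmod (g x))\<^sup>2) summable_on V"
      by (intro summable_on_add summable_on_cmult_right
          ell2_summable[OF assms(1)] ell2_summable[OF assms(2)])
    fix x
    have "(cmod (c * f x + g x))\<^sup>2 \<le> (cmod (c * f x) + cmod (g x))\<^sup>2"
      by (intro power_mono norm_triangle_ineq) auto
    also have "\<dots> \<le> 2 * (cmod (c * f x))\<^sup>2 + 2 * (cmod (g x))\<^sup>2"
      using sum_squares_bound[of "cmod (c * f x)" "cmod (g x)"] by (simp add: power2_sum)
    finally show "(cmod (c * f x + g x))\<^sup>2 \<le> 2 * (cmod c)\<^sup>2 * (cmod (f x))\<^sup>2 + 2 * (cmod (g x))\<^sup>2"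
      by (simp add: norm_mult power_mult_distrib)
  qed auto
  then show ?thesis using assms by (auto simp: ell2_def)
qed

lemma ell2_scale: "f \<in> ell2 V \<Longrightarrow> (\<lambda>x. c * f x) \<in> ell2 V"
  using ell2_lincomb[of f V "\<lambda>_. 0" c] by simp

lemma ell2_diff: "f \<in> ell2 V \<Longrightarrow> g \<in> ell2 V \<Longrightarrow> (\<lambda>x. f x - g x) \<in> ell2 V"
  using ell2_lincomb[of g V f "-1"] by simp

lemma ell2_sum:
  assumes "\<And>i. i \<in> F \<Longrightarrow> f i \<in> ell2 V"
  shows "(\<lambda>x. \<Sum>i\<in>F. c i * f i x) \<in> ell2 V"
  using assms by (induction F rule: infinite_finite_induct) (auto intro: ell2_lincomb)

lemma ell2_mult_bounded:
  assumes "f \<in> ell2 V" "\<And>x. x \<in> V \<Longrightarrow> cmod (m x) \<le> C"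
  shows "(\<lambda>x. m x * f x) \<in> ell2 V"
proof -
  have "(\<lambda>x. (cmod (m x * f x))\<^sup>2) summable_on V"
  proof (rule summable_on_comparison_test)
    show "(\<lambda>x. C\<^sup>2 * (cmod (f x))\<^sup>2) summable_on V"
      by (intro summable_on_cmult_right ell2_summable[OF assms(1)])
    fix x assume "x \<in> V"
    then show "(cmod (m x * f x))\<^sup>2 \<le> C\<^sup>2 * (cmod (f x))\<^sup>2"
      using assms(2)[of x] by (auto simp: norm_mult power_mult_distrib intro!: mult_right_mono power_mono)
  qed auto
  then show ?thesis using assms(1) by (auto simp: ell2_def)
qed

lemma l2_norm_scale: "l2_norm (\<lambda>x. c * f x) = cmod c * l2_norm f"
  by (simp add: l2_norm_def norm_mult power_mult_distrib infsum_cmult_right' real_sqrt_mult)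

lemma ket_in_ell2 [simp]: "u \<in> V \<Longrightarrow> ket u \<in> ell2 V"
  by (auto simp: ell2_def ket_def intro!: finite_nonzero_values_imp_summable_on
      intro: finite_subset[of _ "{u}"])

lemma ell2_finite_support:
  assumes "finite F" "F \<subseteq> V" "\<And>x. x \<notin> F \<Longrightarrow> f x = 0"
  shows "f \<in> ell2 V"
proof -
  have "f \<in> ell2 F" using assms by (auto simp: ell2_def)
  then show ?thesis using assms(2) ell2_mono by blast
qed

lemma cauchy_schwarz_sum:
  "(\<Sum>x\<in>F. cmod (f x) * cmod (g x)) \<le> sqrt (\<Sum>x\<in>F. (cmod (f x))\<^sup>2) * sqrt (\<Sum>x\<in>F. (cmod (g x))\<^sup>2)"
  using L2_set_mult_ineq[of "\<lambda>x. cmod (f x)" "\<lambda>x. cmod (g x)" F] by (simp add: L2_set_def)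

text \<open>The finite Cauchy-Schwarz inequality bounds all finite partial sums of |f g| by the
  product of the norms; absolute summability and the bound for the full sum both follow.\<close>

lemma
  assumes "f \<in> ell2 V" "g \<in> ell2 W"
  shows ell2_mult_summable: "(\<lambda>x. f x * cnj (g x)) summable_on A"
    and cauchy_schwarz: "cmod (l2_inner f g) \<le> l2_norm f * l2_norm g"
proof -
  have fin: "(\<Sum>x\<in>F. cmod (f x * cnj (g x))) \<le> l2_norm f * l2_norm g" if "finite F" for F
  proof -
    have "(\<Sum>x\<in>F. cmod (f x * cnj (g x))) \<le> sqrt (\<Sum>x\<in>F. (cmod (f x))\<^sup>2) * sqrt (\<Sum>x\<in>F. (cmod (g x))\<^sup>2)"
      using cauchy_schwarz_sum[of f g F] by (simp add: norm_mult)
    also have "\<dots> \<le> l2_norm f * l2_norm g"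
      by (intro mult_mono real_le_lsqrt finite_sum_le_l2_norm[OF assms(1) that]
          finite_sum_le_l2_norm[OF assms(2) that] sum_nonneg) (auto intro: sum_nonneg)
    finally show ?thesis .
  qed
  have s: "(\<lambda>x. cmod (f x * cnj (g x))) summable_on A" for A
    by (rule nonneg_bdd_above_summable_on) (use fin in \<open>auto intro!: bdd_aboveI2\<close>)
  then show "(\<lambda>x. f x * cnj (g x)) summable_on A"
    by (rule abs_summable_summable)
  have "cmod (l2_inner f g) \<le> (\<Sum>\<^sub>\<infinity>x. cmod (f x * cnj (g x)))"
    unfolding l2_inner_def by (rule norm_infsum_bound) (rule s)
  also have "\<dots> \<le> l2_norm f * l2_norm g"
    by (rule infsum_le_finite_sums[OF s]) (rule fin)
  finally show "cmod (l2_inner f g) \<le> l2_norm f * l2_norm g" .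
qed

lemma l2_inner_has_sum:
  assumes "f \<in> ell2 V" "g \<in> ell2 W"
  shows "((\<lambda>x. f x * cnj (g x)) has_sum l2_inner f g) UNIV"
  unfolding l2_inner_def using ell2_mult_summable[OF assms] by (rule has_sum_infsum)

lemma l2_inner_lincomb:
  assumes "f \<in> ell2 V" "g \<in> ell2 V" "k \<in> ell2 W"
  shows "l2_inner (\<lambda>x. c * f x + g x) k = c * l2_inner f k + l2_inner g k"
proof -
  have "((\<lambda>x. c * (f x * cnj (k x)) + g x * cnj (k x)) has_sum c * l2_inner f k + l2_inner g k) UNIV"
    by (intro has_sum_add has_sum_cmult_right l2_inner_has_sum[OF assms(1,3)]
        l2_inner_has_sum[OF assms(2,3)])
  then show ?thesis unfolding l2_inner_def[of "\<lambda>x. c * f x + g x"]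
    by (simp add: infsumI algebra_simps)
qed

lemma l2_inner_commute: "l2_inner g f = cnj (l2_inner f g)"
  unfolding l2_inner_def infsum_cnj[symmetric] by (simp add: mult.commute)

lemma l2_inner_zero [simp]: "l2_inner (\<lambda>_. 0) g = 0" "l2_inner g (\<lambda>_. 0) = 0"
  by (auto simp: l2_inner_def)

lemma l2_inner_scale_left: "l2_inner (\<lambda>x. c * f x) g = c * l2_inner f g"
  by (simp add: l2_inner_def mult.assoc infsum_cmult_right')

lemma l2_inner_scale_right: "l2_inner f (\<lambda>x. c * g x) = cnj c * l2_inner f g"
  using l2_inner_scale_left[of c g f] l2_inner_commute
  by (metis complex_cnj_mult)

lemma l2_inner_diff_left:
  "f \<in> ell2 V \<Longrightarrow> g \<in> ell2 V \<Longrightarrow> k \<in> ell2 W \<Longrightarrow>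
    l2_inner (\<lambda>x. f x - g x) k = l2_inner f k - l2_inner g k"
  using l2_inner_lincomb[of g V f k W "-1"] by simp

lemma l2_inner_lincomb_right:
  assumes "f \<in> ell2 V" "g \<in> ell2 V" "k \<in> ell2 W"
  shows "l2_inner k (\<lambda>x. c * f x + g x) = cnj c * l2_inner k f + l2_inner k g"
  using l2_inner_lincomb[OF assms, of c]
    l2_inner_commute[of k "\<lambda>x. c * f x + g x"] l2_inner_commute[of k f] l2_inner_commute[of k g]
  by simp

lemma l2_inner_sum_left:
  assumes "\<And>i. i \<in> F \<Longrightarrow> f i \<in> ell2 V" "k \<in> ell2 W"
  shows "l2_inner (\<lambda>x. \<Sum>i\<in>F. c i * f i x) k = (\<Sum>i\<in>F. c i * l2_inner (f i) k)"
  using assms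
proof (induction F rule: infinite_finite_induct)
  case (insert i F)
  then have "l2_inner (\<lambda>x. c i * f i x + (\<Sum>j\<in>F. c j * f j x)) k =
      c i * l2_inner (f i) k + l2_inner (\<lambda>x. \<Sum>j\<in>F. c j * f j x) k"
    by (intro l2_inner_lincomb[of _ V _ _ W] ell2_sum) auto
  with insert show ?case by auto
qed auto

text \<open>If the squares are not summable, both sides are 0 by the default value of
  \<open>infsum\<close>.\<close>

lemma l2_inner_same: "l2_inner f f = complex_of_real ((l2_norm f)\<^sup>2)"
proof -
  have "l2_inner f f = (\<Sum>\<^sub>\<infinity>x. complex_of_real ((cmod (f x))\<^sup>2))"
    unfolding l2_inner_def by (simp add: complex_norm_square del: of_real_power)
  also have "\<dots> = complex_of_real (\<Sum>\<^sub>\<infinity>x. (cmod (f x))\<^sup>2)"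
  proof (cases "(\<lambda>x. (cmod (f x))\<^sup>2) summable_on UNIV")
    case True
    then show ?thesis using has_sum_of_real[OF has_sum_infsum] infsumI by blast
  next
    case False
    then have "\<not> (\<lambda>x. complex_of_real ((cmod (f x))\<^sup>2)) summable_on UNIV"
      using summable_on_Re[of "\<lambda>x. complex_of_real ((cmod (f x))\<^sup>2)" UNIV] by auto
    with False show ?thesis by (simp add: infsum_not_exists)
  qed
  finally show ?thesis by (simp only: l2_norm_sq)
qed

lemma l2_norm_from_inner: "l2_norm f = sqrt (Re (l2_inner f f))"
  by (simp add: l2_inner_same)

lemma l2_inner_finite:
  assumes "finite F" "\<And>x. x \<notin> F \<Longrightarrow> f x = 0 \<or> g x = 0"
  shows "l2_inner f g = (\<Sum>x\<in>F. f x * cnj (g x))"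
proof -
  have "l2_inner f g = (\<Sum>\<^sub>\<infinity>x\<in>F. f x * cnj (g x))"
    unfolding l2_inner_def by (rule infsum_cong_neutral) (use assms in auto)
  then show ?thesis using assms by simp
qed

lemma l2_inner_ket_right [simp]: "l2_inner f (ket u) = f u"
  using l2_inner_finite[of "{u}" f "ket u"] by (auto simp: ket_def)

lemma l2_inner_ket_left [simp]: "l2_inner (ket u) f = cnj (f u)"
  using l2_inner_commute[of "ket u" f] by simp

lemma l2_norm_ket [simp]: "l2_norm (ket u) = 1"
  by (simp add: l2_norm_from_inner) (simp add: ket_def)

section \<open>Closures, truncations and bounded functionals\<close>

text \<open>Coordinates are bounded by the norm, so approximation in norm passes to each coordinate.
  Subspaces cut out by equations between coordinates are shown to be closed in this way.\<close>

lemma l2_closure_pointwise: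
  assumes "h \<in> l2_closure X" "X \<subseteq> ell2 UNIV"
  obtains g where "\<And>n. g n \<in> X" "\<And>x. (\<lambda>n::nat. g n x) \<longlonglongrightarrow> h x"
proof -
  have "\<exists>g\<in>X. l2_norm (\<lambda>x. h x - g x) < 1 / real (Suc n)" for n
    using assms(1) by (simp add: l2_closure_def)
  then obtain g where g: "\<And>n. g n \<in> X" "\<And>n. l2_norm (\<lambda>x. h x - g n x) < 1 / real (Suc n)"
    by metis
  show ?thesis
  proof (rule that[OF g(1)])
    fix x
    have "cmod (g n x - h x) \<le> 1 / real (Suc n)" for n
    proof -
      have "(\<lambda>x. h x - g n x) \<in> ell2 UNIV"
        using assms g(1) by (intro ell2_diff) (auto simp: l2_closure_def)
      from cmod_le_l2_norm[OF this, of x] g(2)[of n] show ?thesis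
        by (simp add: norm_minus_commute)
    qed
    then have "(\<lambda>n. g n x - h x) \<longlonglongrightarrow> 0"
      by (intro Lim_null_comparison[OF _ LIMSEQ_Suc[OF lim_1_over_n]]) auto
    then show "(\<lambda>n. g n x) \<longlonglongrightarrow> h x" by (simp add: LIM_zero_iff)
  qed
qed

lemma l2_closure_superset: "X \<subseteq> ell2 UNIV \<Longrightarrow> X \<subseteq> l2_closure X"
  unfolding l2_closure_def by (force intro!: bexI)

definition truncate :: "'a set \<Rightarrow> ('a \<Rightarrow> complex) \<Rightarrow> 'a \<Rightarrow> complex" where
  "truncate F f x = (if x \<in> F then f x else 0)"

lemma truncate_in_ell2: "f \<in> ell2 V \<Longrightarrow> truncate F f \<in> ell2 V"
  using ell2_mult_bounded[of f V "\<lambda>x. if x \<in> F then 1 else 0" 1]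
  by (simp add: truncate_def[abs_def] if_distrib[of "\<lambda>z. z * _"] cong: if_cong)

lemma truncate_eq_sum: "finite F \<Longrightarrow> truncate F f = (\<lambda>x. \<Sum>u\<in>F. f u * ket u x)"
  by (auto simp: truncate_def ket_def fun_eq_iff if_distrib sum.delta' cong: if_cong)

text \<open>The squared norm of the remainder is the full sum of squares minus its finite partial
  sum. The limit is taken along the net of finite subsets of V.\<close>

lemma truncate_tendsto:
  assumes "f \<in> ell2 V"
  shows "((\<lambda>F. l2_norm (\<lambda>x. f x - truncate F f x)) \<longlongrightarrow> 0) (finite_subsets_at_top V)"
proof -
  let ?q = "\<lambda>x. (cmod (f x))\<^sup>2"
  have lim: "((\<lambda>F. sqrt ((l2_norm f)\<^sup>2 - sum ?q F)) \<longlongrightarrow> sqrt ((l2_norm f)\<^sup>2 - (l2_norm f)\<^sup>2))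
      (finite_subsets_at_top V)"
    by (intro tendsto_intros tendsto_real_sqrt)
       (use has_sum_infsum[OF ell2_summable[OF assms, of V]] in
         \<open>simp add: has_sum_def l2_norm_sq_on[OF assms]\<close>)
  have eq: "l2_norm (\<lambda>x. f x - truncate F f x) = sqrt ((l2_norm f)\<^sup>2 - sum ?q F)"
    if "finite F" "F \<subseteq> V" for F
  proof -
    have "(l2_norm f)\<^sup>2 = (\<Sum>\<^sub>\<infinity>x\<in>(V-F) \<union> F. ?q x)"
      using that by (simp add: l2_norm_sq_on[OF assms] Un_absorb2)
    also have "\<dots> = (\<Sum>\<^sub>\<infinity>x\<in>V-F. ?q x) + sum ?q F"
      using that by (subst infsum_Un_disjoint) (auto intro: ell2_summable[OF assms])
    also have "(\<Sum>\<^sub>\<infinity>x\<in>V-F. ?q x) = (l2_norm (\<lambda>x. f x - truncate F f x))\<^sup>2"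
      unfolding l2_norm_sq by (rule infsum_cong_neutral)
        (use ell2_zero_outside[OF assms] in \<open>auto simp: truncate_def\<close>)
    finally show ?thesis by simp
  qed
  show ?thesis
    by (rule Lim_transform_eventually[where f="\<lambda>F. sqrt ((l2_norm f)\<^sup>2 - sum ?q F)"])
       (use lim eq in \<open>auto intro!: eventually_finite_subsets_at_top_weakI\<close>)
qed

text \<open>A coordinate of \<open>T f\<close> and the pairing of \<open>T f\<close> with a fixed
  vector are both of this kind, so the expansion along the basis is proved once and serves operators
  and adjoints alike.\<close>

definition bounded_functional :: "'a set \<Rightarrow> (('a \<Rightarrow> complex) \<Rightarrow> complex) \<Rightarrow> bool" where
  "bounded_functional V \<phi> \<longleftrightarrow>
     (\<forall>f\<in>ell2 V. \<forall>g\<in>ell2 V. \<forall>c. \<phi> (\<lambda>x. c * f x + g x) = c * \<phi> f + \<phi> g) \<and>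
     (\<exists>C. \<forall>f\<in>ell2 V. cmod (\<phi> f) \<le> C * l2_norm f)"

lemma bounded_functional_obtain:
  assumes "bounded_functional V \<phi>"
  obtains C where "\<And>f. f \<in> ell2 V \<Longrightarrow> cmod (\<phi> f) \<le> C * l2_norm f"
  using assms unfolding bounded_functional_def by meson

lemma bounded_functional_lincomb:
  assumes "bounded_functional V \<phi>" "f \<in> ell2 V" "g \<in> ell2 V"
  shows "\<phi> (\<lambda>x. c * f x + g x) = c * \<phi> f + \<phi> g"
  using assms by (simp add: bounded_functional_def)

lemma bounded_functional_sum:
  assumes "bounded_functional V \<phi>" "\<And>i. i \<in> F \<Longrightarrow> f i \<in> ell2 V"
  shows "\<phi> (\<lambda>x. \<Sum>i\<in>F. c i * f i x) = (\<Sum>i\<in>F. c i * \<phi> (f i))"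
proof -
  obtain C where C: "\<And>f. f \<in> ell2 V \<Longrightarrow> cmod (\<phi> f) \<le> C * l2_norm f"
    using bounded_functional_obtain[OF assms(1)] by metis
  have z: "\<phi> (\<lambda>_. 0) = 0" using C[of "\<lambda>_. 0"] by simp
  show ?thesis using assms(2)
  proof (induction F rule: infinite_finite_induct)
    case (insert i F)
    then have "\<phi> (\<lambda>x. c i * f i x + (\<Sum>j\<in>F. c j * f j x)) =
        c i * \<phi> (f i) + \<phi> (\<lambda>x. \<Sum>j\<in>F. c j * f j x)"
      by (intro bounded_functional_lincomb[OF assms(1)] ell2_sum) auto
    with insert show ?case by auto
  qed (auto simp: z)
qed

text \<open>The error of the partial sum over F is the value of the functional at the truncation
  remainder, which tends to 0 by boundedness.\<close>

lemma bounded_functional_has_sum: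
  assumes "bounded_functional V \<phi>" "f \<in> ell2 V"
  shows "((\<lambda>u. f u * \<phi> (ket u)) has_sum \<phi> f) V"
proof -
  obtain C where C: "\<And>f. f \<in> ell2 V \<Longrightarrow> cmod (\<phi> f) \<le> C * l2_norm f"
    using bounded_functional_obtain[OF assms(1)] by metis
  have eq: "(\<Sum>u\<in>F. f u * \<phi> (ket u)) - \<phi> f = - \<phi> (\<lambda>x. f x - truncate F f x)"
    if "finite F" "F \<subseteq> V" for F
  proof -
    have "\<phi> (\<lambda>x. (-1) * truncate F f x + f x) = (-1) * \<phi> (truncate F f) + \<phi> f"
      by (intro bounded_functional_lincomb[OF assms(1)] truncate_in_ell2 assms(2))
    moreover have "\<phi> (truncate F f) = (\<Sum>u\<in>F. f u * \<phi> (ket u))"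
      unfolding truncate_eq_sum[OF that(1)] by (rule bounded_functional_sum[OF assms(1)]) (use that in auto)
    ultimately show ?thesis by simp
  qed
  have "((\<lambda>F. (\<Sum>u\<in>F. f u * \<phi> (ket u)) - \<phi> f) \<longlongrightarrow> 0) (finite_subsets_at_top V)"
  proof (rule Lim_null_comparison)
    show "((\<lambda>F. C * l2_norm (\<lambda>x. f x - truncate F f x)) \<longlongrightarrow> 0) (finite_subsets_at_top V)"
      using tendsto_mult_right_zero[OF truncate_tendsto[OF assms(2)]] .
    show "\<forall>\<^sub>F F in finite_subsets_at_top V. cmod ((\<Sum>u\<in>F. f u * \<phi> (ket u)) - \<phi> f)
        \<le> C * l2_norm (\<lambda>x. f x - truncate F f x)"
      by (rule eventually_finite_subsets_at_top_weakI)
         (use eq C[OF ell2_diff[OF assms(2) truncate_in_ell2[OF assms(2)]]] in auto)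
  qed
  then show ?thesis unfolding has_sum_def using LIM_zero_iff by blast
qed

text \<open>The coordinates of \<open>g\<close> are forced by testing on basis vectors.
  Square-summability comes from testing the functional on the truncations g_F of \<open>g\<close>
  itself: its value ||g_F||^2 is at most C ||g_F||, hence ||g_F|| is at most |C|.\<close>

lemma riesz_representation:
  assumes "bounded_functional V \<phi>"
  defines "g \<equiv> \<lambda>u. if u \<in> V then cnj (\<phi> (ket u)) else 0"
  shows "g \<in> ell2 V" and "\<And>f. f \<in> ell2 V \<Longrightarrow> \<phi> f = l2_inner f g"
proof -
  obtain C where C: "\<And>f. f \<in> ell2 V \<Longrightarrow> cmod (\<phi> f) \<le> C * l2_norm f"
    using bounded_functional_obtain[OF assms(1)] by metis
  show g: "g \<in> ell2 V"
  proof (rule ell2_I_bound)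
    fix F assume F: "finite F" "F \<subseteq> V"
    let ?s = "\<Sum>x\<in>F. (cmod (g x))\<^sup>2"
    have t: "truncate F g \<in> ell2 V"
      by (rule ell2_finite_support[of F]) (use F in \<open>auto simp: truncate_def\<close>)
    have "\<phi> (truncate F g) = (\<Sum>u\<in>F. g u * \<phi> (ket u))"
      unfolding truncate_eq_sum[OF F(1)] by (rule bounded_functional_sum[OF assms(1)]) (use F in auto)
    also have "\<dots> = (\<Sum>u\<in>F. complex_of_real ((cmod (g u))\<^sup>2))"
      using F by (intro sum.cong) (auto simp: g_def complex_norm_square simp del: of_real_power)
    finally have "cmod (\<phi> (truncate F g)) = ?s"
      by (simp del: of_real_power of_real_sum add: of_real_sum[symmetric] sum_nonneg)
    moreover have "l2_norm (truncate F g) = sqrt ?s"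
    proof -
      have "l2_inner (truncate F g) (truncate F g) = (\<Sum>x\<in>F. truncate F g x * cnj (truncate F g x))"
        by (rule l2_inner_finite) (use F in \<open>auto simp: truncate_def\<close>)
      also have "\<dots> = complex_of_real ?s"
        by (auto simp: truncate_def complex_norm_square simp del: of_real_power intro!: sum.cong)
      finally show ?thesis by (simp add: l2_norm_from_inner)
    qed
    ultimately have "?s \<le> C * sqrt ?s" using C[OF t] by simp
    also have "C * sqrt ?s \<le> \<bar>C\<bar> * sqrt ?s"
      by (intro mult_right_mono) (auto simp: sum_nonneg)
    finally have "sqrt ?s * sqrt ?s \<le> \<bar>C\<bar> * sqrt ?s" by (simp add: sum_nonneg)
    then have "sqrt ?s \<le> \<bar>C\<bar>"
      by (rule le_if_square_le_mult) (auto simp: sum_nonneg)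
    then show "?s \<le> \<bar>C\<bar>\<^sup>2" by (rule sqrt_le_D)
  qed (simp add: g_def)
  show "\<phi> f = l2_inner f g" if f: "f \<in> ell2 V" for f
  proof -
    have "((\<lambda>u. f u * cnj (g u)) has_sum \<phi> f) V"
      using bounded_functional_has_sum[OF assms(1) f] by (rule has_sum_cong[THEN iffD1, rotated]) (simp add: g_def)
    then have "((\<lambda>u. f u * cnj (g u)) has_sum \<phi> f) UNIV"
      by (rule has_sum_cong_neutral[THEN iffD1, rotated 3]) (auto simp: g_def)
    then show ?thesis using l2_inner_has_sum[OF f g] has_sum_unique by blast
  qed
qed

section \<open>Bounded operators and their adjoints\<close>

text \<open>Membership in \<open>bounded_ops\<close> without extensionality, so that compositions,
  adjoints and explicit formulas can be handled without \<open>restrict\<close>.\<close>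

definition bounded_on ::
    "'a set \<Rightarrow> 'b set \<Rightarrow> (('a \<Rightarrow> complex) \<Rightarrow> ('b \<Rightarrow> complex)) \<Rightarrow> bool" where
  "bounded_on V W T \<longleftrightarrow> (\<forall>f\<in>ell2 V. T f \<in> ell2 W) \<and> linear_map_on (ell2 V) T \<and>
     (\<exists>c. \<forall>f\<in>ell2 V. l2_norm (T f) \<le> c * l2_norm f)"

lemma bounded_on_in: "bounded_on V W T \<Longrightarrow> f \<in> ell2 V \<Longrightarrow> T f \<in> ell2 W"
  by (simp add: bounded_on_def)

lemma bounded_on_lincomb:
  "bounded_on V W T \<Longrightarrow> f \<in> ell2 V \<Longrightarrow> g \<in> ell2 V \<Longrightarrow>
    T (\<lambda>x. c * f x + g x) = (\<lambda>y. c * T f y + T g y)"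
  by (simp add: bounded_on_def linear_map_on_def)

lemma bounded_on_bound:
  assumes "bounded_on V W T"
  obtains C where "0 \<le> C" "\<And>f. f \<in> ell2 V \<Longrightarrow> l2_norm (T f) \<le> C * l2_norm f"
proof -
  obtain c where c: "\<And>f. f \<in> ell2 V \<Longrightarrow> l2_norm (T f) \<le> c * l2_norm f"
    using assms unfolding bounded_on_def by meson
  show ?thesis
  proof (rule that[of "\<bar>c\<bar>"])
    fix f assume "f \<in> ell2 V"
    then have "l2_norm (T f) \<le> c * l2_norm f" by (rule c)
    also have "\<dots> \<le> \<bar>c\<bar> * l2_norm f" by (intro mult_right_mono) auto
    finally show "l2_norm (T f) \<le> \<bar>c\<bar> * l2_norm f" .
  qed simp
qed

lemma bounded_onI:
  assumes "\<And>f. f \<in> ell2 V \<Longrightarrow> T f \<in> ell2 W"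
    and "\<And>f g c. f \<in> ell2 V \<Longrightarrow> g \<in> ell2 V \<Longrightarrow> T (\<lambda>x. c * f x + g x) = (\<lambda>y. c * T f y + T g y)"
    and "\<And>f. f \<in> ell2 V \<Longrightarrow> l2_norm (T f) \<le> c * l2_norm f"
  shows "bounded_on V W T"
  using assms unfolding bounded_on_def linear_map_on_def by blast

lemma bounded_ops_iff:
  "T \<in> bounded_ops (ell2 V) (ell2 W) \<longleftrightarrow> T \<in> extensional (ell2 V) \<and> bounded_on V W T"
  by (auto simp: bounded_ops_def bounded_on_def PiE_def)

lemma bounded_on_restrict [simp]: "bounded_on V W (restrict T (ell2 V)) \<longleftrightarrow> bounded_on V W T"
  by (simp add: bounded_on_def linear_map_on_def ell2_lincomb cong: ball_cong)

lemma restrict_in_bounded_ops: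
  "bounded_on V W T \<Longrightarrow> restrict T (ell2 V) \<in> bounded_ops (ell2 V) (ell2 W)"
  by (simp add: bounded_ops_iff)

lemma bounded_on_compose:
  assumes "bounded_on V W T" "bounded_on W X R"
  shows "bounded_on V X (\<lambda>f. R (T f))"
proof -
  obtain C where C: "0 \<le> C" "\<And>f. f \<in> ell2 V \<Longrightarrow> l2_norm (T f) \<le> C * l2_norm f"
    using bounded_on_bound[OF assms(1)] by blast
  obtain D where D: "0 \<le> D" "\<And>f. f \<in> ell2 W \<Longrightarrow> l2_norm (R f) \<le> D * l2_norm f"
    using bounded_on_bound[OF assms(2)] by blast
  show ?thesis
  proof (rule bounded_onI[where c="D * C"])
    fix f assume f: "f \<in> ell2 V"
    have "l2_norm (R (T f)) \<le> D * l2_norm (T f)"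
      using D(2) bounded_on_in[OF assms(1) f] by blast
    also have "\<dots> \<le> D * (C * l2_norm f)" by (intro mult_left_mono C(2) f D(1))
    finally show "l2_norm (R (T f)) \<le> D * C * l2_norm f" by (simp add: mult.assoc)
  qed (simp_all add: bounded_on_in[OF assms(1)] bounded_on_in[OF assms(2)]
      bounded_on_lincomb[OF assms(1)] bounded_on_lincomb[OF assms(2)])
qed

lemma bounded_on_inner_functional:
  assumes "bounded_on V W T" "g \<in> ell2 X"
  shows "bounded_functional V (\<lambda>f. l2_inner (T f) g)"
proof -
  obtain C where C: "0 \<le> C" "\<And>f. f \<in> ell2 V \<Longrightarrow> l2_norm (T f) \<le> C * l2_norm f"
    using bounded_on_bound[OF assms(1)] by blast
  have "cmod (l2_inner (T f) g) \<le> (C * l2_norm g) * l2_norm f" if f: "f \<in> ell2 V" for f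
  proof -
    have "cmod (l2_inner (T f) g) \<le> l2_norm (T f) * l2_norm g"
      by (rule cauchy_schwarz[OF bounded_on_in[OF assms(1) f] assms(2)])
    also have "\<dots> \<le> C * l2_norm f * l2_norm g" by (intro mult_right_mono C(2) f) simp
    finally show ?thesis by (simp add: ac_simps)
  qed
  moreover have "l2_inner (T (\<lambda>x. c * f x + h x)) g = c * l2_inner (T f) g + l2_inner (T h) g"
    if "f \<in> ell2 V" "h \<in> ell2 V" for f h c
    using that by (simp add: bounded_on_lincomb[OF assms(1)] l2_inner_lincomb[OF _ _ assms(2), of _ W]
        bounded_on_in[OF assms(1)])
  ultimately show ?thesis unfolding bounded_functional_def by blast
qed

text \<open>A coordinate of \<open>T f\<close> is the inner product with a basis vector, a bounded
  functional of \<open>f\<close>. Hence a bounded operator is determined by its values on the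
  basis.\<close>

lemma bounded_on_has_sum:
  assumes "bounded_on V W T" "f \<in> ell2 V"
  shows "((\<lambda>u. f u * T (ket u) y) has_sum T f y) V"
  using bounded_functional_has_sum[OF bounded_on_inner_functional[OF assms(1) ket_in_ell2[of y UNIV]] assms(2)]
  by simp

lemma bounded_on_eqI:
  assumes "bounded_on V W T" "bounded_on V X R" "\<And>u. u \<in> V \<Longrightarrow> T (ket u) = R (ket u)"
    and "f \<in> ell2 V"
  shows "T f = R f"
proof
  fix y
  have "((\<lambda>u. f u * T (ket u) y) has_sum R f y) V"
    using bounded_on_has_sum[OF assms(2,4), of y]
    by (rule has_sum_cong[THEN iffD1, rotated]) (simp add: assms(3))
  then show "T f y = R f y"
    using bounded_on_has_sum[OF assms(1,4)] has_sum_unique by blast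
qed

lemma bounded_ops_eqI:
  assumes "T \<in> bounded_ops (ell2 V) (ell2 W)" "R \<in> bounded_ops (ell2 V) (ell2 X)"
    and "\<And>u. u \<in> V \<Longrightarrow> T (ket u) = R (ket u)"
  shows "T = R"
  by (rule extensionalityI[of _ "ell2 V"])
     (use assms bounded_on_eqI[of V W T X R] in \<open>auto simp: bounded_ops_iff\<close>)

lemma op_of_basis_eqI:
  assumes "T \<in> bounded_ops (ell2 V) (ell2 W)" "\<And>u. u \<in> V \<Longrightarrow> T (ket u) = b u"
  shows "op_of_basis V W b = T"
  unfolding op_of_basis_def
  by (rule the_equality) (use assms in \<open>auto intro: bounded_ops_eqI[of _ V W _ W]\<close>)

text \<open>The adjoint is given by its coordinates <g, T e_u> instead of a description; this makes
  it total and allows different source and target spaces.\<close>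

definition adj ::
    "'a set \<Rightarrow> (('a \<Rightarrow> complex) \<Rightarrow> ('b \<Rightarrow> complex)) \<Rightarrow> ('b \<Rightarrow> complex) \<Rightarrow> 'a \<Rightarrow> complex" where
  "adj V T g u = (if u \<in> V then l2_inner g (T (ket u)) else 0)"

lemma
  assumes "bounded_on V W T" "g \<in> ell2 X"
  shows adj_in: "adj V T g \<in> ell2 V"
    and adj_inner: "f \<in> ell2 V \<Longrightarrow> l2_inner (T f) g = l2_inner f (adj V T g)"
proof -
  have eq: "(\<lambda>u. if u \<in> V then cnj (l2_inner (T (ket u)) g) else 0) = adj V T g"
    by (auto simp: adj_def fun_eq_iff l2_inner_commute[of g])
  show "adj V T g \<in> ell2 V" "f \<in> ell2 V \<Longrightarrow> l2_inner (T f) g = l2_inner f (adj V T g)"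
    using riesz_representation[OF bounded_on_inner_functional[OF assms]] unfolding eq by auto
qed

text \<open>||T* g||^2 = <T T* g, g> is at most C ||T* g|| ||g||; then one factor is
  cancelled.\<close>

lemma adj_bounded_on:
  assumes T: "bounded_on V W T"
  shows "bounded_on W V (adj V T)"
proof -
  obtain C where C: "0 \<le> C" "\<And>f. f \<in> ell2 V \<Longrightarrow> l2_norm (T f) \<le> C * l2_norm f"
    using bounded_on_bound[OF assms(1)] by blast
  show ?thesis
  proof (rule bounded_onI[where c=C])
    fix g :: "'b \<Rightarrow> complex" assume g: "g \<in> ell2 W"
    show a: "adj V T g \<in> ell2 V" by (rule adj_in[OF T g])
    let ?n = "l2_norm (adj V T g)"
    have "complex_of_real (?n\<^sup>2) = l2_inner (T (adj V T g)) g"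
      by (simp only: adj_inner[OF T g a] l2_inner_same)
    then have "?n\<^sup>2 = cmod (l2_inner (T (adj V T g)) g)"
      by (metis norm_of_real abs_of_nonneg zero_le_power2)
    also have "\<dots> \<le> l2_norm (T (adj V T g)) * l2_norm g"
      by (rule cauchy_schwarz[OF bounded_on_in[OF T a] g])
    also have "\<dots> \<le> C * ?n * l2_norm g" by (intro mult_right_mono C(2) a) simp
    finally have "?n * ?n \<le> (C * l2_norm g) * ?n" by (simp add: power2_eq_square ac_simps)
    then show "?n \<le> C * l2_norm g"
      by (rule le_if_square_le_mult) (use C(1) in auto)
  next
    fix f g :: "'b \<Rightarrow> complex" and c assume fg: "f \<in> ell2 W" "g \<in> ell2 W"
    show "adj V T (\<lambda>x. c * f x + g x) = (\<lambda>y. c * adj V T f y + adj V T g y)"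
      using l2_inner_lincomb[OF fg bounded_on_in[OF T ket_in_ell2]]
      by (auto simp: adj_def fun_eq_iff)
  qed
qed

lemma l2_adjoint_eq:
  assumes T: "bounded_on V V T" and g: "g \<in> ell2 V"
  shows "l2_adjoint (ell2 V) T g = adj V T g"
proof -
  have "(THE h. h \<in> ell2 V \<and> (\<forall>f\<in>ell2 V. l2_inner (T f) g = l2_inner f h)) = adj V T g"
  proof (rule the_equality)
    fix h assume h: "h \<in> ell2 V \<and> (\<forall>f\<in>ell2 V. l2_inner (T f) g = l2_inner f h)"
    show "h = adj V T g"
    proof
      fix u
      have "cnj (h u) = cnj (adj V T g u)" if "u \<in> V"
        using h adj_inner[OF T g ket_in_ell2[OF that]] that
        by (metis ket_in_ell2 l2_inner_ket_left)
      then show "h u = adj V T g u" using h by (cases "u \<in> V") (auto simp: adj_def ell2_def)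
    qed
  qed (use adj_in[OF T g] adj_inner[OF T g] in auto)
  with g show ?thesis by (simp add: l2_adjoint_def)
qed

section \<open>Orthonormal systems and unitary equivalence\<close>

text \<open>For the projection p of f onto the span, <p, f> and <p, p> both equal the sum on the
  left, so Cauchy-Schwarz reads ||p||^2 \<le> ||p|| ||f||.\<close>

lemma bessel:
  assumes "\<And>i. i \<in> F \<Longrightarrow> x i \<in> ell2 V"
    and "\<And>i j. i \<in> F \<Longrightarrow> j \<in> F \<Longrightarrow> l2_inner (x i) (x j) = (if i = j then 1 else 0)"
    and "f \<in> ell2 V" "finite F"
  shows "(\<Sum>i\<in>F. (cmod (l2_inner f (x i)))\<^sup>2) \<le> (l2_norm f)\<^sup>2"
proof -
  let ?c = "\<lambda>i. l2_inner f (x i)"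
  let ?s = "\<Sum>i\<in>F. (cmod (?c i))\<^sup>2"
  define p where "p = (\<lambda>v. \<Sum>i\<in>F. ?c i * x i v)"
  have p: "p \<in> ell2 V" unfolding p_def by (rule ell2_sum) (rule assms(1))
  have px: "l2_inner p g = (\<Sum>i\<in>F. ?c i * l2_inner (x i) g)" if "g \<in> ell2 V" for g
    unfolding p_def by (rule l2_inner_sum_left[OF assms(1) that])
  have pf: "l2_inner p f = complex_of_real ?s"
    unfolding px[OF assms(3)]
    by (simp add: complex_norm_square l2_inner_commute[of f] mult.commute del: of_real_power)
  have "l2_inner p p = (\<Sum>i\<in>F. ?c i * l2_inner (x i) p)" by (rule px[OF p])
  also have "\<dots> = (\<Sum>i\<in>F. ?c i * cnj (?c i))"
  proof (rule sum.cong)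
    fix i assume i: "i \<in> F"
    have "l2_inner p (x i) = (\<Sum>j\<in>F. if j = i then ?c j else 0)"
      unfolding px[OF assms(1)[OF i]] by (intro sum.cong) (auto simp: assms(2) i)
    also have "\<dots> = ?c i" using i assms(4) by (simp add: sum.delta)
    finally show "?c i * l2_inner (x i) p = ?c i * cnj (?c i)"
      using l2_inner_commute[of "x i" p] by simp
  qed simp
  also have "\<dots> = complex_of_real ?s"
    by (simp add: complex_norm_square del: of_real_power)
  finally have pp: "(l2_norm p)\<^sup>2 = ?s"
    by (simp add: l2_inner_same del: of_real_power of_real_sum)
  have "?s \<le> l2_norm p * l2_norm f"
    using cauchy_schwarz[OF p assms(3)]
    by (simp add: pf sum_nonneg del: of_real_sum)
  then have "l2_norm p * l2_norm p \<le> l2_norm f * l2_norm p"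
    by (simp add: pp[symmetric] mult.commute) (simp add: power2_eq_square)
  then have "l2_norm p \<le> l2_norm f"
    by (rule le_if_square_le_mult) auto
  then show ?thesis unfolding pp[symmetric] by (intro power_mono) auto
qed

text \<open>The coefficient map \<open>W\<close> of the basis is a contraction by Bessel's inequality, so it has an
  adjoint \<open>Z\<close>; orthonormality gives \<open>W Z = 1\<close> and totality then gives \<open>Z W = 1\<close>.\<close>

lemma unitarily_equivalent_orthonormal_basis:
  fixes x :: "'i \<Rightarrow> 'a \<Rightarrow> complex"
  assumes x: "\<And>i. i \<in> I \<Longrightarrow> x i \<in> ell2 V"
    and orth: "\<And>i j. i \<in> I \<Longrightarrow> j \<in> I \<Longrightarrow> l2_inner (x i) (x j) = (if i = j then 1 else 0)"
    and total: "\<And>f. f \<in> ell2 V \<Longrightarrow> (\<And>i. i \<in> I \<Longrightarrow> l2_inner f (x i) = 0) \<Longrightarrow> f = (\<lambda>_. 0)"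
    and U: "bounded_on V V U" and R: "bounded_on I I R"
    and Ux: "\<And>i. i \<in> I \<Longrightarrow> U (x i) = x (s i)"
    and Rk: "\<And>i. i \<in> I \<Longrightarrow> R (ket i) = ket (s i)"
    and s: "\<And>i. i \<in> I \<Longrightarrow> s i \<in> I"
  shows "unitarily_equivalent (ell2 V) U (ell2 I) R"
proof -
  define W where "W = (\<lambda>f i. if i \<in> I then l2_inner f (x i) else 0)"
  have W: "bounded_on V I W"
  proof (rule bounded_onI[where c=1])
    fix f :: "'a \<Rightarrow> complex" assume f: "f \<in> ell2 V"
    have b: "(\<Sum>i\<in>F. (cmod (W f i))\<^sup>2) \<le> (l2_norm f)\<^sup>2" if F: "finite F" "F \<subseteq> I" for F
    proof -
      have "(\<Sum>i\<in>F. (cmod (W f i))\<^sup>2) = (\<Sum>i\<in>F. (cmod (l2_inner f (x i)))\<^sup>2)"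
        using F by (intro sum.cong) (auto simp: W_def)
      also have "\<dots> \<le> (l2_norm f)\<^sup>2"
        using F by (intro bessel[where V=V] x orth f) auto
      finally show ?thesis .
    qed
    show "W f \<in> ell2 I" by (rule ell2_I_bound) (use b in \<open>auto simp: W_def\<close>)
    then show "l2_norm (W f) \<le> 1 * l2_norm f"
      using l2_norm_le[of "W f" I "l2_norm f"] b by simp
  next
    fix f g :: "'a \<Rightarrow> complex" and c assume "f \<in> ell2 V" "g \<in> ell2 V"
    then show "W (\<lambda>x. c * f x + g x) = (\<lambda>y. c * W f y + W g y)"
      using l2_inner_lincomb[OF _ _ x] by (auto simp: W_def fun_eq_iff)
  qed
  define Z where "Z = adj V W"
  have Z: "bounded_on I V Z" unfolding Z_def by (rule adj_bounded_on[OF W])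
  have Wx: "W (x i) = ket i" if "i \<in> I" for i
    using that by (auto simp: W_def orth ket_def fun_eq_iff)
  have Zk: "Z (ket i) = x i" if "i \<in> I" for i
    using that ell2_zero_outside[OF x[OF that]]
    by (auto simp: Z_def adj_def W_def fun_eq_iff)
  have WZ: "W (Z c) = c" if c: "c \<in> ell2 I" for c
  proof
    fix i show "W (Z c) i = c i"
    proof (cases "i \<in> I")
      case True
      have "l2_inner (W (x i)) c = l2_inner (x i) (Z c)"
        unfolding Z_def by (rule adj_inner[OF W c x[OF True]])
      then have "l2_inner (x i) (Z c) = cnj (c i)" by (simp add: Wx[OF True])
      then show ?thesis using True l2_inner_commute[of "Z c" "x i"] by (simp add: W_def)
    qed (use ell2_zero_outside[OF c] in \<open>auto simp: W_def\<close>)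
  qed
  have ZW: "Z (W f) = f" if f: "f \<in> ell2 V" for f
  proof -
    have Wf: "W f \<in> ell2 I" by (rule bounded_on_in[OF W f])
    have ZWf: "Z (W f) \<in> ell2 V" by (rule bounded_on_in[OF Z Wf])
    have "(\<lambda>v. Z (W f) v - f v) = (\<lambda>_. 0)"
    proof (rule total)
      fix i assume i: "i \<in> I"
      have "W (Z (W f)) i = W f i" by (simp only: WZ[OF Wf])
      then have "l2_inner (Z (W f)) (x i) = l2_inner f (x i)" using i by (simp add: W_def)
      then show "l2_inner (\<lambda>v. Z (W f) v - f v) (x i) = 0"
        by (simp add: l2_inner_diff_left[OF ZWf f x[OF i]])
    qed (rule ell2_diff[OF ZWf f])
    then show ?thesis by (simp add: fun_eq_iff)
  qed
  have UZ: "U (Z c) = Z (R c)" if c: "c \<in> ell2 I" for c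
    by (rule bounded_on_eqI[OF bounded_on_compose[OF Z U] bounded_on_compose[OF R Z] _ c])
       (simp add: Zk Ux Rk s)
  show ?thesis
    unfolding unitarily_equivalent_def
  proof (intro exI[of _ W] conjI ballI)
    show "linear_map_on (ell2 V) W" using W by (simp add: bounded_on_def)
    show "W ` ell2 V = ell2 I"
    proof
      show "W ` ell2 V \<subseteq> ell2 I" using bounded_on_in[OF W] by blast
      show "ell2 I \<subseteq> W ` ell2 V"
        using WZ bounded_on_in[OF Z] by (metis image_eqI subsetI)
    qed
    fix f :: "'a \<Rightarrow> complex" assume f: "f \<in> ell2 V"
    have "l2_inner (W f) (W f) = l2_inner f f"
      using adj_inner[OF W bounded_on_in[OF W f] f] ZW[OF f] by (simp add: Z_def)
    then show "l2_norm (W f) = l2_norm f" by (simp add: l2_norm_from_inner)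
    have "U f = Z (R (W f))" using UZ[OF bounded_on_in[OF W f]] ZW[OF f] by simp
    then show "W (U f) = R (W f)"
      using WZ bounded_on_in[OF R bounded_on_in[OF W f]] by simp
  qed
qed

section \<open>Shifts as weighted pullbacks\<close>

text \<open>The common form of all shifts below, unweighted or weighted, on a line, on a tree or on
  an orthogonal sum: \<open>D\<close> is the set of points with a predecessor, \<open>p\<close> the
  predecessor map. Each value is a single term instead of a series.\<close>

definition wpull :: "'b set \<Rightarrow> ('b \<Rightarrow> 'a) \<Rightarrow> ('b \<Rightarrow> real) \<Rightarrow> ('a \<Rightarrow> complex) \<Rightarrow> 'b \<Rightarrow> complex" where
  "wpull D p l f v = (if v \<in> D then complex_of_real (l v) * f (p v) else 0)"

text \<open>Grouping the points by their predecessor u, the term |f u|^2 is multiplied by a sum of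
  squared weights over finitely many points of one fibre, which is at most C. The fibres themselves
  may be infinite.\<close>

lemma bounded_on_wpull:
  assumes D: "D \<subseteq> W" and p: "\<And>v. v \<in> D \<Longrightarrow> p v \<in> V"
    and C: "\<And>u F. u \<in> V \<Longrightarrow> finite F \<Longrightarrow> F \<subseteq> {v\<in>D. p v = u} \<Longrightarrow> (\<Sum>v\<in>F. (l v)\<^sup>2) \<le> C"
  shows "bounded_on V W (wpull D p l)"
proof -
  have b: "(\<Sum>v\<in>F. (cmod (wpull D p l f v))\<^sup>2) \<le> \<bar>C\<bar> * (l2_norm f)\<^sup>2"
    if f: "f \<in> ell2 V" and F: "finite F" for f F
  proof -
    let ?F = "F \<inter> D"
    have "(\<Sum>v\<in>F. (cmod (wpull D p l f v))\<^sup>2) = (\<Sum>v\<in>?F. (l v)\<^sup>2 * (cmod (f (p v)))\<^sup>2)"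
      using F by (intro sum.mono_neutral_cong_right)
        (auto simp: wpull_def norm_mult power_mult_distrib)
    also have "\<dots> = (\<Sum>u\<in>p ` ?F. \<Sum>v\<in>{v\<in>?F. p v = u}. (l v)\<^sup>2 * (cmod (f (p v)))\<^sup>2)"
      using F by (intro sum.image_gen) auto
    also have "\<dots> = (\<Sum>u\<in>p ` ?F. (\<Sum>v\<in>{v\<in>?F. p v = u}. (l v)\<^sup>2) * (cmod (f u))\<^sup>2)"
      by (intro sum.cong) (auto simp: sum_distrib_right)
    also have "\<dots> \<le> (\<Sum>u\<in>p ` ?F. \<bar>C\<bar> * (cmod (f u))\<^sup>2)"
    proof (intro sum_mono mult_right_mono)
      fix u assume "u \<in> p ` ?F"
      then have "(\<Sum>v\<in>{v\<in>?F. p v = u}. (l v)\<^sup>2) \<le> C"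
        using F p by (intro C[of u]) auto
      then show "(\<Sum>v\<in>{v\<in>?F. p v = u}. (l v)\<^sup>2) \<le> \<bar>C\<bar>" by simp
    qed simp
    also have "\<dots> \<le> \<bar>C\<bar> * (l2_norm f)\<^sup>2"
      unfolding sum_distrib_left[symmetric]
      using F by (intro mult_left_mono finite_sum_le_l2_norm[OF f]) auto
    finally show ?thesis .
  qed
  have in_ell2: "wpull D p l f \<in> ell2 W" if "f \<in> ell2 V" for f
    by (rule ell2_I_bound) (use b[OF that] D in \<open>auto simp: wpull_def\<close>)
  have nrm: "l2_norm (wpull D p l f) \<le> sqrt \<bar>C\<bar> * l2_norm f" if "f \<in> ell2 V" for f
    using b[OF that] by (intro l2_norm_le[OF in_ell2[OF that]]) (auto simp: power_mult_distrib)
  show "bounded_on V W (wpull D p l)"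
    by (rule bounded_onI[OF in_ell2 _ nrm]) (auto simp: wpull_def fun_eq_iff algebra_simps)
qed

lemma wpull_ket: "wpull D p l (ket u) = (\<lambda>v. if v \<in> D \<and> p v = u then complex_of_real (l v) else 0)"
  by (auto simp: wpull_def ket_def fun_eq_iff)

lemma ket_apply: "ket u x = (if x = u then 1 else 0)"
  by (simp add: ket_def)

lemma bounded_on_wpull_inj:
  assumes "D \<subseteq> W" "p ` D \<subseteq> V" "inj_on p D"
  shows "bounded_on V W (wpull D p (\<lambda>_. 1))"
proof (rule bounded_on_wpull[where C=1])
  fix u F assume F: "finite F" "F \<subseteq> {v \<in> D. p v = u}"
  then have "card F \<le> 1"
    using assms(3) by (auto simp: card_le_Suc0_iff_eq inj_on_def)
  then show "(\<Sum>v\<in>F. (1::real)\<^sup>2) \<le> 1" by simp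
qed (use assms in auto)

text \<open>The point 0 is left out of the domain of the pullback: on \<open>nat\<close> the
  difference 0 - 1 is 0 and would put \<open>f 0\<close> back at 0.\<close>

lemma unilateral_shift_eq:
  "unilateral_shift = restrict (wpull {0<..} (\<lambda>k. k - 1) (\<lambda>_. 1)) (ell2 UNIV)"
  unfolding unilateral_shift_def
  by (rule op_of_basis_eqI, rule restrict_in_bounded_ops, rule bounded_on_wpull_inj)
     (auto simp: inj_on_def wpull_def ket_apply fun_eq_iff)

lemma bilateral_shift_eq:
  "bilateral_shift = restrict (wpull UNIV (\<lambda>k. k - 1) (\<lambda>_. 1)) (ell2 UNIV)"
  unfolding bilateral_shift_def
  by (rule op_of_basis_eqI, rule restrict_in_bounded_ops, rule bounded_on_wpull_inj)
     (auto simp: inj_on_def wpull_def ket_apply fun_eq_iff)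

lemma ell2_reindex:
  assumes "f \<in> ell2 V" "inj p"
  shows "(\<lambda>x. f (p x)) \<in> ell2 UNIV"
proof (rule ell2_I_bound[where C="(l2_norm f)\<^sup>2"])
  fix F :: "'b set" assume F: "finite F"
  have "(\<Sum>x\<in>F. (cmod (f (p x)))\<^sup>2) = (\<Sum>y\<in>p ` F. (cmod (f y))\<^sup>2)"
    using assms(2) by (subst sum.reindex) (auto intro: inj_on_subset)
  also have "\<dots> \<le> (l2_norm f)\<^sup>2"
    by (rule finite_sum_le_l2_norm[OF assms(1)]) (simp add: F)
  finally show "(\<Sum>x\<in>F. (cmod (f (p x)))\<^sup>2) \<le> (l2_norm f)\<^sup>2" .
qed simp

lemma shift_sum_eq:
  "shift_sum N = restrict (wpull (copies N \<times> {0<..}) (\<lambda>(j, k). (j, k - 1)) (\<lambda>_. 1))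
     (ell2 (copies N \<times> UNIV))"
proof (rule ext)
  fix f :: "nat \<times> nat \<Rightarrow> complex"
  \<comment> \<open>\<open>unilateral_shift\<close> is extensional, so it acts as a pullback on a
    slice of \<open>f\<close> only once the slice is known to be in its domain.\<close>
  have "(\<lambda>y. f (j, y)) \<in> ell2 UNIV" if "f \<in> ell2 (copies N \<times> UNIV)" for j
    using that by (rule ell2_reindex) (simp add: inj_def)
  then show "shift_sum N f = restrict (wpull (copies N \<times> {0<..}) (\<lambda>(j, k). (j, k - 1)) (\<lambda>_. 1))
     (ell2 (copies N \<times> UNIV)) f"
    by (auto simp: shift_sum_def orth_sum_def unilateral_shift_eq wpull_def restrict_def fun_eq_iff)
qed

lemma
  shows bounded_on_shift_sum: "bounded_on (copies N \<times> UNIV) (copies N \<times> UNIV) (shift_sum N)"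
    and shift_sum_ket: "j \<in> copies N \<Longrightarrow> shift_sum N (ket (j, k)) = ket (j, k + 1)"
proof -
  show "bounded_on (copies N \<times> UNIV) (copies N \<times> UNIV) (shift_sum N)"
    unfolding shift_sum_eq bounded_on_restrict
    by (rule bounded_on_wpull_inj) (auto simp: inj_on_def)
  show "shift_sum N (ket (j, k)) = ket (j, k + 1)" if "j \<in> copies N"
    using that by (auto simp: shift_sum_eq wpull_def ket_apply fun_eq_iff)
qed

text \<open>The model for the rootless case in which U is not c.n.u.; the summand \<open>int\<close>
  of the index type carries the bilateral shift.\<close>

definition bilateral_sum :: "enat \<Rightarrow> (int + nat \<times> nat \<Rightarrow> complex) \<Rightarrow> (int + nat \<times> nat \<Rightarrow> complex)" where
  "bilateral_sum N = orth_sum2 UNIV bilateral_shift (copies N \<times> UNIV) (shift_sum N)"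

lemma bilateral_sum_eq:
  "bilateral_sum N = restrict (wpull (UNIV <+> copies N \<times> {0<..})
       (map_sum (\<lambda>k. k - 1) (\<lambda>(j, k). (j, k - 1))) (\<lambda>_. 1)) (ell2 (UNIV <+> copies N \<times> UNIV))"
proof (rule ext)
  fix f :: "int + nat \<times> nat \<Rightarrow> complex"
  have "(\<lambda>y. f (Inl y)) \<in> ell2 UNIV" "(\<lambda>y. f (Inr y)) \<in> ell2 (copies N \<times> UNIV)"
    if "f \<in> ell2 (UNIV <+> copies N \<times> UNIV)"
    using that ell2_reindex[OF that, of Inl] ell2_reindex[OF that, of Inr]
      ell2_iff[of "\<lambda>y. f (Inr y)" "copies N \<times> UNIV"] ell2_zero_outside[OF that] by auto
  then show "bilateral_sum N f = restrict (wpull (UNIV <+> copies N \<times> {0<..})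
       (map_sum (\<lambda>k. k - 1) (\<lambda>(j, k). (j, k - 1))) (\<lambda>_. 1)) (ell2 (UNIV <+> copies N \<times> UNIV)) f"
    by (auto simp: bilateral_sum_def orth_sum2_def bilateral_shift_eq shift_sum_eq wpull_def
        restrict_def fun_eq_iff split: sum.splits)
qed

lemma
  defines "I \<equiv> \<lambda>N. (UNIV :: int set) <+> copies N \<times> (UNIV :: nat set)"
  shows bounded_on_bilateral_sum: "bounded_on (I N) (I N) (bilateral_sum N)"
    and bilateral_sum_ket_Inl: "bilateral_sum N (ket (Inl k)) = ket (Inl (k + 1))"
    and bilateral_sum_ket_Inr:
      "j \<in> copies N \<Longrightarrow> bilateral_sum N (ket (Inr (j, m))) = ket (Inr (j, m + 1))"
proof -
  show "bounded_on (I N) (I N) (bilateral_sum N)"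
    unfolding bilateral_sum_eq bounded_on_restrict I_def
    by (rule bounded_on_wpull_inj) (auto simp: inj_on_def)
  show "bilateral_sum N (ket (Inl k)) = ket (Inl (k + 1))"
    by (auto simp: bilateral_sum_eq wpull_def ket_apply InlI InrI fun_eq_iff split: sum.splits)
  show "bilateral_sum N (ket (Inr (j, m))) = ket (Inr (j, m + 1))" if "j \<in> copies N"
    using that by (auto simp: bilateral_sum_eq wpull_def ket_apply InlI InrI fun_eq_iff split: sum.splits)
qed

section \<open>Directed trees\<close>

lemma ecard_mono: "A \<subseteq> B \<Longrightarrow> ecard A \<le> ecard B"
  by (auto simp: ecard_def card_mono dest: finite_subset)

lemma ecard_Un_disjoint: "A \<inter> B = {} \<Longrightarrow> ecard (A \<union> B) = ecard A + ecard B"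
  by (auto simp: ecard_def card_Un_disjoint)

lemma ecard_empty [simp]: "ecard {} = 0"
  by (simp add: ecard_def zero_enat_def)

text \<open>An infinite set has finite subsets of every size, which forces \<open>s\<close> to be
  infinite.\<close>

lemma ecard_le_if_finite_subsets:
  assumes "\<And>X. finite X \<Longrightarrow> X \<subseteq> Y \<Longrightarrow> ecard X \<le> s"
  shows "ecard Y \<le> s"
proof (cases "finite Y")
  case False
  have "enat n \<le> s" for n
  proof -
    obtain X where "finite X" "card X = n" "X \<subseteq> Y"
      using infinite_arbitrarily_large[OF False] by blast
    with assms[of X] show ?thesis by (simp add: ecard_def)
  qed
  then have "s = \<infinity>"
    by (metis Suc_ile_eq enat_ord_code(4) not_infinity_eq order_less_irrefl)
  then show ?thesis by simp
qed (use assms in auto)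

text \<open>This turns the infinite sum in \<open>Br\<close> into the cardinality of a set of
  vertices. Finitely many blocks are counted directly, and a finite subset of the union meets only
  finitely many blocks.\<close>

lemma ecard_UN_disjoint:
  assumes "disjoint_family_on B A"
  shows "ecard (\<Union>u\<in>A. B u) = (\<Sum>\<^sub>\<infinity>u\<in>A. ecard (B u))"
proof (rule antisym)
  have fin: "ecard (\<Union>u\<in>F. B u) = (\<Sum>u\<in>F. ecard (B u))" if "finite F" "F \<subseteq> A" for F
    using that
  proof (induction F)
    case (insert u F)
    then have "B u \<inter> (\<Union>u\<in>F. B u) = {}"
      using assms by (fastforce simp: disjoint_family_on_def)
    with insert show ?case by (simp add: ecard_Un_disjoint)
  qed simp
  show "(\<Sum>\<^sub>\<infinity>u\<in>A. ecard (B u)) \<le> ecard (\<Union>u\<in>A. B u)"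
  proof (rule infsum_le_finite_sums)
    fix F assume F: "finite F" "F \<subseteq> A"
    then show "(\<Sum>u\<in>F. ecard (B u)) \<le> ecard (\<Union>u\<in>A. B u)"
      unfolding fin[OF F, symmetric] by (intro ecard_mono) auto
  qed simp
  show "ecard (\<Union>u\<in>A. B u) \<le> (\<Sum>\<^sub>\<infinity>u\<in>A. ecard (B u))"
  proof (rule ecard_le_if_finite_subsets)
    fix X assume "finite X" "X \<subseteq> (\<Union>u\<in>A. B u)"
    then obtain F where F: "F \<subseteq> A" "finite F" "X \<subseteq> (\<Union>u\<in>F. B u)"
      by (rule finite_subset_Union[of X "B ` A"]) (auto dest: finite_subset_image)
    have "ecard X \<le> (\<Sum>u\<in>F. ecard (B u))"
      using ecard_mono[OF F(3)] fin[OF F(2,1)] by simp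
    also have "\<dots> \<le> (\<Sum>\<^sub>\<infinity>u\<in>A. ecard (B u))"
      using F by (subst nonneg_infsum_complete) (auto intro: SUP_upper)
    finally show "ecard X \<le> (\<Sum>\<^sub>\<infinity>u\<in>A. ecard (B u))" .
  qed
qed

text \<open>\<open>copies N\<close> is an initial segment of \<open>nat\<close>, and all of
  \<open>nat\<close> for infinite N; an infinite \<open>A\<close> is matched with it through
  countability.\<close>

lemma bij_betw_copies_ecard:
  assumes "countable A"
  obtains e where "bij_betw e (copies (ecard A)) A"
proof (cases "finite A")
  case True
  then have "copies (ecard A) = {0..<card A}" by (auto simp: copies_def ecard_def)
  then show ?thesis using ex_bij_betw_nat_finite[OF True] that by auto
next
  case False
  then have "copies (ecard A) = UNIV" by (auto simp: copies_def ecard_def)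
  then show ?thesis using bij_betw_from_nat_into[OF assms False] that by auto
qed

section \<open>Ancestors and levels in directed trees\<close>

text \<open>\<open>(u, v) \<in> E ^^ n\<close> is the working form of "u is the n-th ancestor of v".
  Unlike an equation for the iterates of \<open>par E\<close>, it is false rather than unspecified
  if there is no such ancestor.\<close>

lemma Chi_pow_iff: "v \<in> Chi_pow E n u \<longleftrightarrow> (u, v) \<in> E ^^ n"
proof -
  have "Chi_pow E n u = (E ^^ n) `` {u}"
    unfolding Chi_pow_def by (induction n) (auto simp: Chi_def)
  then show ?thesis by auto
qed

locale tree =
  fixes V :: "'a set" and E :: "('a \<times> 'a) set"
  assumes directed_tree: "directed_tree V E"
begin

lemma edge_in: "(u, v) \<in> E \<Longrightarrow> u \<in> V \<and> v \<in> V"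
  using directed_tree by (auto simp: directed_tree_def)

lemma parent_unique: "(u, v) \<in> E \<Longrightarrow> (w, v) \<in> E \<Longrightarrow> u = w"
  using directed_tree unfolding directed_tree_def by metis

lemma par_eq: "(u, v) \<in> E \<Longrightarrow> par E v = u"
  unfolding par_def using parent_unique by (intro the_equality) auto

lemma non_roots_iff: "v \<in> non_roots V E \<longleftrightarrow> (par E v, v) \<in> E"
  using par_eq edge_in by (auto simp: non_roots_def is_root_def)

lemma non_rootsI: "(u, v) \<in> E \<Longrightarrow> v \<in> non_roots V E"
  using par_eq non_roots_iff by metis

lemma non_roots_subset: "non_roots V E \<subseteq> V"
  by (auto simp: non_roots_def)

lemma par_in: "v \<in> non_roots V E \<Longrightarrow> par E v \<in> V"
  using non_roots_iff edge_in by blast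

lemma Chi_eq: "Chi E u = {v \<in> non_roots V E. par E v = u}"
  using par_eq non_roots_iff by (auto simp: Chi_def)

lemma relpow_in: "(u, v) \<in> E ^^ n \<Longrightarrow> u \<in> V \<Longrightarrow> v \<in> V"
  by (cases n) (use edge_in in auto)

lemma relpow_par: "(w, v) \<in> E ^^ n \<Longrightarrow> (par E ^^ n) v = w"
  by (induction n arbitrary: v) (auto simp: par_eq funpow_Suc_right simp del: funpow.simps)

lemma relpow_unique: "(w, v) \<in> E ^^ n \<Longrightarrow> (w', v) \<in> E ^^ n \<Longrightarrow> w = w'"
  using relpow_par by metis

lemma relpow_loop:
  assumes "(v, v) \<in> E ^^ n"
  shows "n = 0"
proof (rule ccontr)
  assume "n \<noteq> 0"
  then have "(v, v) \<in> E\<^sup>+" using assms unfolding trancl_power by auto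
  moreover have "acyclic E" using directed_tree by (simp add: directed_tree_def)
  ultimately show False by (simp add: acyclic_def)
qed

text \<open>The ancestor at distance m is unique, so the last m steps of the longer path also start
  at w. The steps before them form a loop at w, which has length 0 by acyclicity.\<close>

lemma relpow_length_unique_aux:
  assumes "(w, v) \<in> E ^^ m" "(w, v) \<in> E ^^ n" "m \<le> n"
  shows "m = n"
proof -
  have "(w, v) \<in> E ^^ (n - m) O E ^^ m"
    using assms(2,3) relpow_add[of "n - m" m E] by simp
  then obtain x where "(w, x) \<in> E ^^ (n - m)" "(x, v) \<in> E ^^ m" by auto
  then have "n - m = 0" using relpow_unique[OF assms(1)] relpow_loop by blast
  then show ?thesis using assms(3) by simp
qed

lemma relpow_length_unique: "(w, v) \<in> E ^^ m \<Longrightarrow> (w, v) \<in> E ^^ n \<Longrightarrow> m = n"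
  using relpow_length_unique_aux[of w v m n] relpow_length_unique_aux[of w v n m] by linarith

text \<open>Induction along an undirected path starting at u. A step down prolongs the path from the
  ancestor; a step up shortens that path or, if it is empty, replaces the ancestor by its
  parent.\<close>

lemma common_ancestor:
  assumes "u \<in> V" "v \<in> V"
  obtains w m n where "w \<in> V" "(w, u) \<in> E ^^ m" "(w, v) \<in> E ^^ n"
proof -
  have "(u, v) \<in> (E \<union> E\<inverse>)\<^sup>*" using assms directed_tree by (auto simp: directed_tree_def)
  then have "\<exists>w m n. w \<in> V \<and> (w, u) \<in> E ^^ m \<and> (w, v) \<in> E ^^ n"
  proof (induction rule: rtrancl_induct)
    case base
    have "(u, u) \<in> E ^^ 0" by simp
    then show ?case using assms(1) by blast
  next
    case (step y z)
    then obtain w m n where w: "w \<in> V" "(w, u) \<in> E ^^ m" "(w, y) \<in> E ^^ n" by blast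
    show ?case
    proof (cases "(y, z) \<in> E")
      case True
      with w have "(w, z) \<in> E ^^ Suc n" by auto
      with w show ?thesis by blast
    next
      case False
      with step have zy: "(z, y) \<in> E" by auto
      show ?thesis
      proof (cases n)
        case 0
        then have "w = y" using w by simp
        then have "(z, u) \<in> E ^^ Suc m" using zy w by (metis relpow_Suc_I2)
        moreover have "(z, z) \<in> E ^^ 0" by simp
        ultimately show ?thesis using zy edge_in by blast
      next
        case (Suc k)
        then obtain x where "(w, x) \<in> E ^^ k" "(x, y) \<in> E" using w by auto
        then have "(w, z) \<in> E ^^ k" using parent_unique[OF zy] by auto
        with w show ?thesis by blast
      qed
    qed
  qed
  then show ?thesis using that by blast
qed

text \<open>The level of v is n - m for any common ancestor at distance m from a fixed vertex and n
  from v. In a rootless tree, two vertices belong to the same generation iff their levels agree, so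
  \<open>Gen\<close> reduces to an equation of integers.\<close>

lemma level_exists: "\<exists>L :: 'a \<Rightarrow> int. \<forall>(u, v)\<in>E. L v = L u + 1"
proof -
  obtain v0 where v0: "v0 \<in> V" using directed_tree by (auto simp: directed_tree_def)
  define Q where "Q v k \<longleftrightarrow> (\<exists>w m n. (w, v0) \<in> E ^^ m \<and> (w, v) \<in> E ^^ n \<and> k = int n - int m)" for v k
  \<comment> \<open>Of two common ancestors, the one farther from v lies n' - n generations above
    the other, which lengthens both paths equally.\<close>
  have aux: "int n - int m = int n' - int m'"
    if "(w, v0) \<in> E ^^ m" "(w, v) \<in> E ^^ n" "(w', v0) \<in> E ^^ m'" "(w', v) \<in> E ^^ n'" "n \<le> n'"
    for v w w' m n m' n'
  proof -
    have "(w', v) \<in> E ^^ (n' - n) O E ^^ n"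
      using that relpow_add[of "n' - n" n E] by simp
    then have "(w', w) \<in> E ^^ (n' - n)" using relpow_unique[OF that(2)] by auto
    then have "(w', v0) \<in> E ^^ (n' - n + m)" using that(1) unfolding relpow_add by auto
    then have "n' - n + m = m'" using that(3) relpow_length_unique by blast
    then show ?thesis using that(5) by linarith
  qed
  have uniq: "k = k'" if k: "Q v k" and k': "Q v k'" for v k k'
  proof -
    obtain w m n where 1: "(w, v0) \<in> E ^^ m" "(w, v) \<in> E ^^ n" "k = int n - int m"
      using k unfolding Q_def by blast
    obtain w' m' n' where 2: "(w', v0) \<in> E ^^ m'" "(w', v) \<in> E ^^ n'" "k' = int n' - int m'"
      using k' unfolding Q_def by blast
    show ?thesis using aux[OF 1(1,2) 2(1,2)] aux[OF 2(1,2) 1(1,2)] 1(3) 2(3) by linarith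
  qed
  have ex: "\<exists>k. Q v k" if "v \<in> V" for v
    using common_ancestor[OF v0 that] unfolding Q_def by metis
  define L where "L v = (THE k. Q v k)" for v
  have LQ: "L v = k" if "Q v k" for v k
    unfolding L_def using that uniq by (intro the_equality) auto
  have "L v = L u + 1" if e: "(u, v) \<in> E" for u v
  proof -
    obtain k where k: "Q u k" using ex edge_in[OF e] by blast
    then obtain w m n where w: "(w, v0) \<in> E ^^ m" "(w, u) \<in> E ^^ n" "k = int n - int m"
      unfolding Q_def by blast
    then have "(w, v) \<in> E ^^ Suc n" using e by auto
    then have "Q v (k + 1)" unfolding Q_def using w
      by (intro exI[of _ w] exI[of _ m] exI[of _ "Suc n"]) auto
    with k show ?thesis using LQ by metis
  qed
  then show ?thesis by auto
qed

text \<open>Only the increments along edges are used; they determine the level up to an additive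
  constant.\<close>

definition level :: "'a \<Rightarrow> int" where
  "level = (SOME L. \<forall>(u, v)\<in>E. L v = L u + 1)"

lemma level_edge: "(u, v) \<in> E \<Longrightarrow> level v = level u + 1"
  using someI_ex[OF level_exists] unfolding level_def[symmetric] by auto

lemma level_relpow: "(w, v) \<in> E ^^ n \<Longrightarrow> level v = level w + int n"
  by (induction n arbitrary: v) (auto dest: level_edge)

lemma same_level:
  assumes "u \<in> V" "v \<in> V" "level u = level v"
  obtains w n where "w \<in> V" "(w, u) \<in> E ^^ n" "(w, v) \<in> E ^^ n"
proof -
  obtain w m n where w: "w \<in> V" "(w, u) \<in> E ^^ m" "(w, v) \<in> E ^^ n"
    by (rule common_ancestor[OF assms(1,2)])
  then have "m = n" using level_relpow[OF w(2)] level_relpow[OF w(3)] assms(3) by simp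
  with w that show ?thesis by blast
qed

text \<open>Sums over a generation are bounded on finite subsets, and for these a single ancestor at
  a single distance exists.\<close>

lemma same_level_finite:
  assumes "finite F" "F \<subseteq> V" "u \<in> V" "\<And>v. v \<in> F \<Longrightarrow> level v = level u"
  obtains w n where "w \<in> V" "(w, u) \<in> E ^^ n" "\<And>v. v \<in> F \<Longrightarrow> (w, v) \<in> E ^^ n"
proof -
  have "\<exists>w n. w \<in> V \<and> (w, u) \<in> E ^^ n \<and> (\<forall>v\<in>F. (w, v) \<in> E ^^ n)"
    using assms(1,2,4)
  proof (induction F)
    case empty
    have "(u, u) \<in> E ^^ 0" by simp
    then show ?case using assms(3) by blast
  next
    case (insert x F)
    then obtain w n where w: "w \<in> V" "(w, u) \<in> E ^^ n" "\<And>v. v \<in> F \<Longrightarrow> (w, v) \<in> E ^^ n" by auto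
    obtain z m where z: "z \<in> V" "(z, u) \<in> E ^^ m" "(z, x) \<in> E ^^ m"
      using same_level[of u x] insert assms(3) by auto
    obtain y k l where y: "y \<in> V" "(y, w) \<in> E ^^ k" "(y, z) \<in> E ^^ l"
      by (rule common_ancestor[OF w(1) z(1)])
    \<comment> \<open>Both sides are the level of u minus the level of y, so the paths through w and
      through z are equally long.\<close>
    have kl: "k + n = l + m"
      using level_relpow[OF w(2)] level_relpow[OF z(2)] level_relpow[OF y(2)] level_relpow[OF y(3)]
      by linarith
    have "(y, v) \<in> E ^^ (k + n)" if "v \<in> insert u (insert x F)" for v
    proof (cases "v = x")
      case True
      then show ?thesis unfolding kl relpow_add using y z by auto
    next
      case False
      then show ?thesis unfolding relpow_add using y w that by auto
    qed
    then show ?case using y(1) by blast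
  qed
  then show ?thesis using that by blast
qed

lemma rootless_ancestor:
  assumes "\<not> has_root V E" "v \<in> V"
  obtains w where "w \<in> V" "(w, v) \<in> E ^^ n"
proof -
  have "\<exists>w\<in>V. (w, v) \<in> E ^^ n"
  proof (induction n)
    case (Suc n)
    then obtain w where w: "w \<in> V" "(w, v) \<in> E ^^ n" by blast
    then obtain u where "(u, w) \<in> E"
      using assms(1) by (auto simp: has_root_def is_root_def)
    with w show ?case using edge_in by (meson relpow_Suc_I2)
  qed (use assms in auto)
  then show ?thesis using that by blast
qed

lemma root_ancestor:
  assumes "is_root V E r" "v \<in> V"
  obtains n where "(r, v) \<in> E ^^ n"
proof -
  obtain w m n where w: "(w, r) \<in> E ^^ m" "(w, v) \<in> E ^^ n"
    using common_ancestor[of r v] assms by (metis is_root_def)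
  have "w = r" using w(1) assms(1) by (cases m) (auto simp: is_root_def)
  with w that show ?thesis by blast
qed

lemma root_unique:
  assumes "is_root V E r" "is_root V E r'"
  shows "r = r'"
proof -
  obtain n where "(r, r') \<in> E ^^ n" using root_ancestor[OF assms(1)] assms(2) by (auto simp: is_root_def)
  then show ?thesis using assms(2) by (cases n) (auto simp: is_root_def)
qed

text \<open>Without a root, every iterate of \<open>par E\<close> is a true ancestor, and vertices
  of equal level have a common ancestor at equal distance.\<close>

lemma Gen_iff:
  assumes "\<not> has_root V E" "u \<in> V"
  shows "v \<in> Gen E u \<longleftrightarrow> v \<in> V \<and> level v = level u"
proof
  assume "v \<in> Gen E u"
  then obtain n where n: "((par E ^^ n) u, v) \<in> E ^^ n" by (auto simp: Gen_def Chi_pow_iff)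
  obtain w where w: "w \<in> V" "(w, u) \<in> E ^^ n" by (rule rootless_ancestor[OF assms])
  then have "(w, v) \<in> E ^^ n" using n relpow_par by metis
  then show "v \<in> V \<and> level v = level u"
    using w level_relpow relpow_in by fastforce
next
  assume "v \<in> V \<and> level v = level u"
  then obtain w n where "(w, u) \<in> E ^^ n" "(w, v) \<in> E ^^ n"
    using same_level[OF assms(2), of v] by metis
  then have "v \<in> Chi_pow E n ((par E ^^ n) u)" using relpow_par by (metis Chi_pow_iff)
  then show "v \<in> Gen E u" by (auto simp: Gen_def)
qed

text \<open>Every vertex is reached from a fixed one by m steps up and n steps down; the steps up
  leave no choice, the steps down countably many.\<close>

lemma countable_vertices:
  assumes "\<And>u. u \<in> V \<Longrightarrow> countable (Chi E u)"
  shows "countable V"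
proof -
  obtain u where u: "u \<in> V" using directed_tree by (auto simp: directed_tree_def)
  have c: "countable {v. (w, v) \<in> E ^^ n}" if "w \<in> V" for w n
  proof (induction n)
    case (Suc n)
    have "{v. (w, v) \<in> E ^^ Suc n} \<subseteq> (\<Union>x\<in>{x. (w, x) \<in> E ^^ n}. Chi E x)"
      by (auto simp: Chi_def)
    moreover have "countable (\<Union>x\<in>{x. (w, x) \<in> E ^^ n}. Chi E x)"
      using Suc assms relpow_in that by (intro countable_UN) auto
    ultimately show ?case by (rule countable_subset)
  qed simp
  have "V \<subseteq> (\<Union>m. \<Union>n. {v. (par E ^^ m) u \<in> V \<and> ((par E ^^ m) u, v) \<in> E ^^ n})"
  proof
    fix v assume "v \<in> V"
    then obtain w m n where "w \<in> V" "(w, u) \<in> E ^^ m" "(w, v) \<in> E ^^ n"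
      by (rule common_ancestor[OF u])
    then show "v \<in> (\<Union>m. \<Union>n. {v. (par E ^^ m) u \<in> V \<and> ((par E ^^ m) u, v) \<in> E ^^ n})"
      using relpow_par by blast
  qed
  moreover have "countable {v. (par E ^^ m) u \<in> V \<and> ((par E ^^ m) u, v) \<in> E ^^ n}" for m n
    using c[of "(par E ^^ m) u" n] by (cases "(par E ^^ m) u \<in> V") auto
  ultimately show ?thesis by (meson countable_UN countable_subset countableI_type)
qed

section \<open>First children and the branching index\<close>

text \<open>The numbering of V by \<open>to_nat_on\<close> orders the children of each vertex. The
  same order later governs the orthogonalisation, because only finitely many children precede a
  given one.\<close>

definition first_child :: "'a \<Rightarrow> 'a" where
  "first_child u = (ARG_MIN (to_nat_on V) v. v \<in> Chi E u)"

lemma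
  assumes "Chi E u \<noteq> {}"
  shows first_child_in: "first_child u \<in> Chi E u"
    and first_child_le: "v \<in> Chi E u \<Longrightarrow> to_nat_on V (first_child u) \<le> to_nat_on V v"
  using assms arg_min_nat_lemma[of "\<lambda>v. v \<in> Chi E u" _ "to_nat_on V"]
  unfolding first_child_def by blast+

text \<open>Removing one child from Chi(u) leaves |Chi(u)| - 1 vertices, hence none if there is a
  single child; a root is nobody's child and is counted separately. The assumption \<open>ne\<close>
  guarantees that every vertex has a child to remove.\<close>

lemma ecard_non_first_children:
  assumes ne: "\<And>u. u \<in> V \<Longrightarrow> Chi E u \<noteq> {}"
  shows "ecard (V - first_child ` V) = Br V E + (if has_root V E then 1 else 0)"
proof -
  let ?A = "{u \<in> V. 1 < ecard (Chi E u)}" and ?R = "{r. is_root V E r}"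
  let ?B = "\<lambda>u. Chi E u - {first_child u}"
  have card_B: "ecard (?B u) = ecard (Chi E u) - 1" if "u \<in> V" for u
    using first_child_in[OF ne[OF that]]
    by (auto simp: ecard_def one_enat_def card_gt_0_iff)
  have B_empty: "?B u = {}" if u: "u \<in> V" "\<not> 1 < ecard (Chi E u)" for u
  proof -
    have "finite (Chi E u)" "card (Chi E u) \<le> 1"
      using u by (auto simp: ecard_def one_enat_def not_less split: if_splits)
    then show ?thesis
      using first_child_in[OF ne[OF u(1)]] card_le_Suc0_iff_eq[of "Chi E u"] by auto
  qed
  have eq: "V - first_child ` V = (\<Union>u\<in>?A. ?B u) \<union> ?R"
  proof (intro set_eqI iffI)
    fix v assume v: "v \<in> V - first_child ` V"
    show "v \<in> (\<Union>u\<in>?A. ?B u) \<union> ?R"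
    proof (cases "is_root V E v")
      case False
      then obtain u where u: "(u, v) \<in> E" using v by (auto simp: is_root_def)
      then have "v \<in> ?B u" "u \<in> V" using v edge_in[OF u] by (auto simp: Chi_def)
      then show ?thesis using B_empty[of u] by blast
    qed simp
  next
    fix v assume "v \<in> (\<Union>u\<in>?A. ?B u) \<union> ?R"
    then consider u where "u \<in> V" "v \<in> ?B u" | "is_root V E v" by auto
    then show "v \<in> V - first_child ` V"
    proof cases
      case 1
      have "v \<noteq> first_child w" if "w \<in> V" for w
        using 1 first_child_in[OF ne[OF that]] parent_unique by (cases "w = u") (auto simp: Chi_def)
      with 1 show ?thesis using edge_in by (auto simp: Chi_def)
    next
      case 2
      then show ?thesis using first_child_in[OF ne] by (auto simp: is_root_def Chi_def)
    qed
  qed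
  have "disjoint_family_on ?B ?A"
    using parent_unique by (auto simp: disjoint_family_on_def Chi_def)
  then have "ecard (\<Union>u\<in>?A. ?B u) = (\<Sum>\<^sub>\<infinity>u\<in>?A. ecard (?B u))"
    by (rule ecard_UN_disjoint)
  also have "\<dots> = Br V E" unfolding Br_def by (rule infsum_cong) (simp add: card_B)
  finally have "ecard (\<Union>u\<in>?A. ?B u) = Br V E" .
  moreover have "ecard ?R = (if has_root V E then 1 else 0)"
  proof (cases "has_root V E")
    case True
    then obtain r where "is_root V E r" by (auto simp: has_root_def)
    then have "?R = {r}" using root_unique by blast
    then show ?thesis using True by (simp add: ecard_def one_enat_def)
  next
    case False
    then have "?R = {}" by (auto simp: has_root_def)
    then show ?thesis using False by (simp only: ecard_empty if_False)
  qed
  moreover have "(\<Union>u\<in>?A. ?B u) \<inter> ?R = {}" by (auto simp: is_root_def Chi_def)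
  ultimately show ?thesis unfolding eq by (simp add: ecard_Un_disjoint)
qed

end

section \<open>Weighted shifts on directed trees\<close>

lemma summable_on_dominated:
  fixes f g :: "'a \<Rightarrow> real"
  assumes "g summable_on A" "\<And>x. x \<in> A \<Longrightarrow> 0 \<le> f x \<and> f x \<le> g x"
  shows "f summable_on A"
  using assms by (intro summable_on_comparison_test[OF assms(1)]) auto

text \<open>Serves two sets of data: the given tree with the weights \<open>lam\<close>, and the
  subtree T' with the weights \<open>beta\<close>. Contractivity and isometry are therefore added
  only in extensions.\<close>

locale weighted_tree = tree V E for V :: "'a set" and E +
  fixes lam :: "'a \<Rightarrow> real"
  assumes admissible: "admissible_weights V E lam"
begin

lemma lam_pos: "v \<in> non_roots V E \<Longrightarrow> 0 < lam v"
  using admissible by (simp add: admissible_weights_def)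

lemma lam_pos_edge: "(u, v) \<in> E \<Longrightarrow> 0 < lam v"
  using lam_pos non_rootsI by blast

lemma lam_square_summable: "u \<in> V \<Longrightarrow> (\<lambda>v. (lam v)\<^sup>2) summable_on Chi E u"
  using admissible by (auto simp: admissible_weights_def)

definition shift :: "('a \<Rightarrow> complex) \<Rightarrow> ('a \<Rightarrow> complex)" where
  "shift = wpull (non_roots V E) (par E) lam"

lemma shift_bounded_on: "bounded_on V V shift"
proof -
  obtain C where C: "\<And>u. u \<in> V \<Longrightarrow> (\<Sum>\<^sub>\<infinity>v\<in>Chi E u. (lam v)\<^sup>2) \<le> C"
    using admissible unfolding admissible_weights_def by blast
  show ?thesis
    unfolding shift_def
  proof (rule bounded_on_wpull)
    fix u F assume F: "u \<in> V" "finite F" "F \<subseteq> {v \<in> non_roots V E. par E v = u}"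
    then have "(\<Sum>v\<in>F. (lam v)\<^sup>2) \<le> (\<Sum>\<^sub>\<infinity>v\<in>Chi E u. (lam v)\<^sup>2)"
      unfolding Chi_eq[symmetric] by (intro finite_sum_le_infsum lam_square_summable) auto
    also have "\<dots> \<le> C" by (rule C[OF F(1)])
    finally show "(\<Sum>v\<in>F. (lam v)\<^sup>2) \<le> C" .
  qed (use non_roots_subset par_in in auto)
qed

lemmas shift_in = bounded_on_in[OF shift_bounded_on]

lemma shift_edge: "(u, v) \<in> E \<Longrightarrow> shift f v = complex_of_real (lam v) * f u"
  using non_rootsI par_eq by (auto simp: shift_def wpull_def)

lemma shift_not_edge: "v \<notin> non_roots V E \<Longrightarrow> shift f v = 0"
  by (simp add: shift_def wpull_def)

lemma shift_ket: "shift (ket u) = (\<lambda>v. if v \<in> Chi E u then complex_of_real (lam v) else 0)"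
  unfolding shift_def wpull_ket Chi_eq by auto

lemma weighted_shift_eq: "weighted_shift V E lam = restrict shift (ell2 V)"
  unfolding weighted_shift_def
proof (rule op_of_basis_eqI)
  show "restrict shift (ell2 V) \<in> bounded_ops (ell2 V) (ell2 V)"
    by (rule restrict_in_bounded_ops[OF shift_bounded_on])
  fix u assume u: "u \<in> V"
  have "(\<Sum>\<^sub>\<infinity>v\<in>Chi E u. complex_of_real (lam v) * ket v w) =
      (\<Sum>\<^sub>\<infinity>v\<in>Chi E u \<inter> {w}. complex_of_real (lam v) * ket v w)" for w
    by (rule infsum_cong_neutral) (auto simp: ket_def)
  also have "\<dots> w = shift (ket u) w" for w
    by (cases "w \<in> Chi E u") (auto simp: shift_ket ket_apply)
  finally show "restrict shift (ell2 V) (ket u) =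
      (\<lambda>w. \<Sum>\<^sub>\<infinity>v\<in>Chi E u. complex_of_real (lam v) * ket v w)"
    using u by simp
qed

lemma adj_shift:
  "u \<in> V \<Longrightarrow> adj V shift f u = (\<Sum>\<^sub>\<infinity>v\<in>Chi E u. f v * complex_of_real (lam v))"
  unfolding adj_def l2_inner_def shift_ket
  by (simp, rule infsum_cong_neutral) auto

lemmas adj_shift_in = bounded_on_in[OF adj_bounded_on[OF shift_bounded_on]]

lemma funpow_shift_in: "f \<in> ell2 V \<Longrightarrow> (shift ^^ n) f \<in> ell2 V"
  by (induction n) (auto intro: shift_in)

lemma funpow_adj_shift_in: "f \<in> ell2 V \<Longrightarrow> (adj V shift ^^ n) f \<in> ell2 V"
  by (induction n) (auto intro: adj_shift_in)

lemma inner_funpow_shift: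
  "f \<in> ell2 V \<Longrightarrow> g \<in> ell2 V \<Longrightarrow> l2_inner ((shift ^^ n) f) g = l2_inner f ((adj V shift ^^ n) g)"
proof (induction n arbitrary: g)
  case (Suc n)
  have "l2_inner ((shift ^^ Suc n) f) g = l2_inner ((shift ^^ n) f) (adj V shift g)"
    using adj_inner[OF shift_bounded_on Suc.prems(2) funpow_shift_in[OF Suc.prems(1)]] by simp
  also have "\<dots> = l2_inner f ((adj V shift ^^ n) (adj V shift g))"
    by (rule Suc.IH[OF Suc.prems(1) adj_shift_in[OF Suc.prems(2)]])
  finally show ?case by (simp add: funpow_swap1)
qed simp

text \<open>The coefficient with which the n-th power of the shift carries the value at the n-th
  ancestor of v to v.\<close>

definition branch_prod :: "nat \<Rightarrow> 'a \<Rightarrow> real" where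
  "branch_prod n v = (\<Prod>j<n. lam ((par E ^^ j) v))"

lemma branch_prod_Suc: "branch_prod (Suc n) v = lam v * branch_prod n (par E v)"
  by (simp add: branch_prod_def prod.lessThan_Suc_shift funpow_Suc_right del: funpow.simps prod.lessThan_Suc)

lemma funpow_shift_relpow:
  "(w, v) \<in> E ^^ n \<Longrightarrow> (shift ^^ n) f v = complex_of_real (branch_prod n v) * f w"
proof (induction n arbitrary: v)
  case (Suc n)
  then obtain u where u: "(w, u) \<in> E ^^ n" "(u, v) \<in> E" by auto
  then show ?case using Suc.IH[OF u(1)] by (simp add: shift_edge branch_prod_Suc par_eq)
qed (simp add: branch_prod_def)

lemma funpow_shift_no_ancestor:
  "(\<And>w. (w, v) \<notin> E ^^ n) \<Longrightarrow> (shift ^^ n) f v = 0"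
proof (induction n arbitrary: v)
  case (Suc n)
  show ?case
  proof (cases "v \<in> non_roots V E")
    case True
    then have e: "(par E v, v) \<in> E" by (simp add: non_roots_iff)
    then have "(w, par E v) \<notin> E ^^ n" for w using Suc.prems by auto
    then show ?thesis using Suc.IH shift_edge[OF e] by simp
  qed (simp add: shift_not_edge)
next
  case 0
  then show ?case by (metis relpow_0_I)
qed

lemma branch_prod_pos: "(w, v) \<in> E ^^ n \<Longrightarrow> 0 < branch_prod n v"
proof (induction n arbitrary: v)
  case (Suc n)
  then obtain u where "(w, u) \<in> E ^^ n" "(u, v) \<in> E" by auto
  then show ?case using Suc.IH lam_pos_edge by (simp add: branch_prod_Suc par_eq)
qed (simp add: branch_prod_def)

text \<open>A summable family has only countably many nonzero terms, and the weights of all children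
  are positive.\<close>

lemma countable_V: "countable V"
proof (rule countable_vertices)
  fix u assume u: "u \<in> V"
  have "countable {v \<in> Chi E u. (lam v)\<^sup>2 \<noteq> 0}"
    by (rule summable_countable_real[OF lam_square_summable[OF u]])
  also have "{v \<in> Chi E u. (lam v)\<^sup>2 \<noteq> 0} = Chi E u"
    using lam_pos_edge by (force simp: Chi_def)
  finally show "countable (Chi E u)" .
qed

end

section \<open>Isometric weighted shifts\<close>

text \<open>The images of distinct basis vectors have disjoint supports, so unit length of every
  \<open>shift (ket u)\<close> makes the shift isometric. It also excludes leaves, because an empty
  sum is 0.\<close>

locale isometric_tree = weighted_tree +
  assumes unit: "u \<in> V \<Longrightarrow> (\<Sum>\<^sub>\<infinity>v\<in>Chi E u. (lam v)\<^sup>2) = 1"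
begin

lemma Chi_nonempty: "u \<in> V \<Longrightarrow> Chi E u \<noteq> {}"
  using unit[of u] by auto

lemma sum_lam_square_complex:
  assumes "u \<in> V"
  shows "(\<Sum>\<^sub>\<infinity>v\<in>Chi E u. c * (complex_of_real (lam v) * complex_of_real (lam v))) = c"
proof -
  have "((\<lambda>v. (lam v)\<^sup>2) has_sum 1) (Chi E u)"
    using unit[OF assms] lam_square_summable[OF assms] by (simp add: has_sum_iff)
  then have "((\<lambda>v. complex_of_real ((lam v)\<^sup>2)) has_sum complex_of_real 1) (Chi E u)"
    by (rule has_sum_of_real)
  then have "((\<lambda>v. c * complex_of_real ((lam v)\<^sup>2)) has_sum c * complex_of_real 1) (Chi E u)"
    by (rule has_sum_cmult_right)
  then show ?thesis by (simp add: infsumI power2_eq_square)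
qed

text \<open>At u the adjoint pairs \<open>f\<close> with the unit vector
  \<open>shift (ket u)\<close>; if \<open>f\<close> is c times this vector on Chi(u), the result is
  c.\<close>

lemma adj_shift_of_multiple:
  assumes "u \<in> V" "\<And>v. v \<in> Chi E u \<Longrightarrow> f v = complex_of_real (lam v) * c"
  shows "adj V shift f u = c"
proof -
  have "adj V shift f u = (\<Sum>\<^sub>\<infinity>v\<in>Chi E u. c * (complex_of_real (lam v) * complex_of_real (lam v)))"
    unfolding adj_shift[OF assms(1)] by (rule infsum_cong) (simp add: assms(2))
  then show ?thesis by (simp add: sum_lam_square_complex[OF assms(1)])
qed

lemma adj_shift_shift: "f \<in> ell2 V \<Longrightarrow> adj V shift (shift f) = f"
proof
  fix u assume f: "f \<in> ell2 V"
  show "adj V shift (shift f) u = f u"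
  proof (cases "u \<in> V")
    case True
    then show ?thesis
      by (rule adj_shift_of_multiple) (auto simp: Chi_def shift_edge)
  qed (use ell2_zero_outside[OF f] in \<open>auto simp: adj_def\<close>)
qed

lemma inner_shift_shift: "f \<in> ell2 V \<Longrightarrow> g \<in> ell2 V \<Longrightarrow> l2_inner (shift f) (shift g) = l2_inner f g"
  using adj_inner[OF shift_bounded_on shift_in] by (simp add: adj_shift_shift)

lemma norm_shift: "f \<in> ell2 V \<Longrightarrow> l2_norm (shift f) = l2_norm f"
  by (simp add: l2_norm_from_inner inner_shift_shift)

lemma norm_funpow_shift: "f \<in> ell2 V \<Longrightarrow> l2_norm ((shift ^^ n) f) = l2_norm f"
  by (induction n) (auto simp: norm_shift funpow_shift_in)

lemma inner_funpow_shift_shift: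
  "f \<in> ell2 V \<Longrightarrow> g \<in> ell2 V \<Longrightarrow> l2_inner ((shift ^^ n) f) ((shift ^^ n) g) = l2_inner f g"
  by (induction n) (auto simp: inner_shift_shift funpow_shift_in)

lemma lam_le_1: "(u, v) \<in> E \<Longrightarrow> lam v \<le> 1"
proof -
  assume e: "(u, v) \<in> E"
  then have u: "u \<in> V" using edge_in by blast
  have "(\<Sum>v\<in>{v}. (lam v)\<^sup>2) \<le> (\<Sum>\<^sub>\<infinity>v\<in>Chi E u. (lam v)\<^sup>2)"
    using e by (intro finite_sum_le_infsum lam_square_summable u) (auto simp: Chi_def)
  then have "(lam v)\<^sup>2 \<le> 1" by (simp add: unit[OF u])
  then show ?thesis using abs_le_square_iff[of "lam v" 1] by simp
qed

end

section \<open>Wandering vectors of an isometric weighted shift\<close>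

context isometric_tree
begin

text \<open>Meaningful only if c has a parent: at a root \<open>par E c\<close> is unspecified,
  which is why \<open>wandering\<close> treats roots in a clause of their own.\<close>

definition smaller_siblings :: "'a \<Rightarrow> 'a set" where
  "smaller_siblings c = {d \<in> Chi E (par E c). to_nat_on V d < to_nat_on V c}"

definition smaller_mass :: "'a \<Rightarrow> real" where
  "smaller_mass c = (\<Sum>d\<in>smaller_siblings c. (lam d)\<^sup>2)"

text \<open>The norm of the vector with entries \<open>lam d\<close> at the smaller siblings d and
  \<open>- smaller_mass c / lam c\<close> at c. The entry at c is the one that makes the pairing
  with the weights vanish.\<close>

definition wandering_norm :: "'a \<Rightarrow> real" where
  "wandering_norm c = sqrt (smaller_mass c + (smaller_mass c / lam c)\<^sup>2)"

text \<open>For a child \<open>c\<close> that is not the first one, this is the unit vector in the span of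
  \<open>\<Sum>\<^sub>d\<^sub><\<^sub>c \<lambda>\<^sub>d e\<^sub>d\<close> and \<open>e\<^sub>c\<close> orthogonal to \<open>\<Sum>\<^sub>d\<^sub>\<le>\<^sub>c \<lambda>\<^sub>d e\<^sub>d\<close>. Up to scaling it agrees with \<open>S e\<^sub>u\<close> at all \<open>d < c\<close>,
  so it is orthogonal to the vectors of the smaller siblings.\<close>

definition wandering :: "'a \<Rightarrow> 'a \<Rightarrow> complex" where
  "wandering c v =
     (if is_root V E c then ket c v
      else if v \<in> smaller_siblings c then complex_of_real (lam v / wandering_norm c)
      else if v = c then complex_of_real (- (smaller_mass c / lam c) / wandering_norm c)
      else 0)"

abbreviation wandering_index :: "'a set" where
  "wandering_index \<equiv> V - first_child ` V"

lemma inj_to_nat_on_V: "inj_on (to_nat_on V) V"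
  by (rule inj_on_to_nat_on[OF countable_V])

text \<open>Initial segments of a numbering are finite, so the wandering vectors have finite support
  even below a vertex with infinitely many children.\<close>

lemma finite_smaller_siblings: "finite (smaller_siblings c)"
proof (rule finite_imageD)
  show "finite (to_nat_on V ` smaller_siblings c)"
    by (rule finite_subset[of _ "{..<to_nat_on V c}"]) (auto simp: smaller_siblings_def)
  show "inj_on (to_nat_on V) (smaller_siblings c)"
    by (rule inj_on_subset[OF inj_to_nat_on_V]) (use edge_in in \<open>auto simp: smaller_siblings_def Chi_def\<close>)
qed

lemma not_in_smaller_siblings: "c \<notin> smaller_siblings c"
  by (simp add: smaller_siblings_def)

lemma non_first_smaller:
  assumes "c \<in> wandering_index" "(u, c) \<in> E"
  shows "first_child u \<in> smaller_siblings c"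
proof -
  have u: "u \<in> V" "c \<in> V" using edge_in[OF assms(2)] by auto
  note ne = Chi_nonempty[OF u(1)]
  have c: "c \<in> Chi E u" using assms(2) by (simp add: Chi_def)
  have "first_child u \<in> V" using first_child_in[OF ne] edge_in by (auto simp: Chi_def)
  moreover have "first_child u \<noteq> c" using assms(1) u by auto
  ultimately have "to_nat_on V (first_child u) \<noteq> to_nat_on V c"
    using inj_to_nat_on_V u(2) by (auto simp: inj_on_def)
  then show ?thesis
    using first_child_le[OF ne c] first_child_in[OF ne] par_eq[OF assms(2)]
    by (simp add: smaller_siblings_def)
qed

text \<open>The first child of the parent is a smaller sibling of c, so the sum is not empty. This
  permits the normalisation and, later, cancelling the mass.\<close>

lemma smaller_mass_pos:
  assumes "c \<in> wandering_index" "(u, c) \<in> E"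
  shows "0 < smaller_mass c"
  unfolding smaller_mass_def
proof (rule sum_pos)
  show "smaller_siblings c \<noteq> {}" using non_first_smaller[OF assms] by auto
  fix d assume "d \<in> smaller_siblings c"
  then have "0 < lam d" using lam_pos_edge by (auto simp: smaller_siblings_def Chi_def)
  then show "0 < (lam d)\<^sup>2" by simp
qed (rule finite_smaller_siblings)

lemma wandering_norm_sq:
  assumes "c \<in> wandering_index" "(u, c) \<in> E"
  shows "0 < wandering_norm c"
    "(wandering_norm c)\<^sup>2 = smaller_mass c + (smaller_mass c / lam c)\<^sup>2"
  using smaller_mass_pos[OF assms] by (auto simp: wandering_norm_def add_pos_nonneg)

lemma wandering_in:
  assumes "c \<in> V"
  shows "wandering c \<in> ell2 V"
proof (rule ell2_finite_support[of "insert c (smaller_siblings c)"])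
  show "insert c (smaller_siblings c) \<subseteq> V"
    using assms edge_in by (auto simp: smaller_siblings_def Chi_def)
qed (auto simp: finite_smaller_siblings wandering_def ket_def)

lemma wandering_root: "is_root V E c \<Longrightarrow> wandering c = ket c"
  by (simp add: wandering_def fun_eq_iff)

lemma inner_wandering:
  assumes "(u, c) \<in> E"
  shows "l2_inner f (wandering c) =
    ((\<Sum>d\<in>smaller_siblings c. f d * complex_of_real (lam d)) -
      f c * complex_of_real (smaller_mass c / lam c)) / complex_of_real (wandering_norm c)"
proof -
  have nr: "\<not> is_root V E c" using assms by (auto simp: is_root_def)
  have "l2_inner f (wandering c) = (\<Sum>d\<in>insert c (smaller_siblings c). f d * cnj (wandering c d))"
    by (rule l2_inner_finite) (auto simp: finite_smaller_siblings wandering_def nr)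
  also have "\<dots> = f c * cnj (wandering c c) + (\<Sum>d\<in>smaller_siblings c. f d * cnj (wandering c d))"
    by (simp add: finite_smaller_siblings not_in_smaller_siblings)
  also have "(\<Sum>d\<in>smaller_siblings c. f d * cnj (wandering c d)) =
      (\<Sum>d\<in>smaller_siblings c. f d * complex_of_real (lam d) / complex_of_real (wandering_norm c))"
    by (intro sum.cong) (auto simp: wandering_def nr)
  also have "cnj (wandering c c) =
      - complex_of_real (smaller_mass c / lam c) / complex_of_real (wandering_norm c)"
    by (simp add: wandering_def nr not_in_smaller_siblings)
  finally show ?thesis by (simp add: sum_divide_distrib[symmetric] diff_divide_distrib)
qed

text \<open>The smaller siblings contribute k times \<open>smaller_mass c\<close>, and the entry at
  c takes the same amount away. Orthogonality of wandering vectors to each other and to the range of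
  the shift rests on this.\<close>

lemma inner_wandering_multiple:
  assumes "(u, c) \<in> E" "\<And>d. d \<in> insert c (smaller_siblings c) \<Longrightarrow> f d = complex_of_real (lam d) * k"
  shows "l2_inner f (wandering c) = 0"
proof -
  have "(\<Sum>d\<in>smaller_siblings c. f d * complex_of_real (lam d)) =
      (\<Sum>d\<in>smaller_siblings c. k * complex_of_real ((lam d)\<^sup>2))"
    by (intro sum.cong) (auto simp: assms(2) power2_eq_square)
  also have "\<dots> = k * complex_of_real (smaller_mass c)"
    by (simp add: sum_distrib_left smaller_mass_def)
  finally show ?thesis
    unfolding inner_wandering[OF assms(1)] using lam_pos_edge[OF assms(1)] assms(2)[of c] by simp
qed

lemma inner_wandering_self:
  assumes "c \<in> wandering_index"
  shows "l2_inner (wandering c) (wandering c) = 1"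
proof (cases "is_root V E c")
  case False
  then obtain u where u: "(u, c) \<in> E" using assms by (auto simp: is_root_def)
  note n = wandering_norm_sq[OF assms u]
  let ?n = "complex_of_real (wandering_norm c)"
  have "(\<Sum>d\<in>smaller_siblings c. wandering c d * complex_of_real (lam d)) =
      (\<Sum>d\<in>smaller_siblings c. complex_of_real ((lam d)\<^sup>2) / ?n)"
    by (intro sum.cong) (auto simp: wandering_def False power2_eq_square)
  also have "\<dots> = complex_of_real (smaller_mass c) / ?n"
    by (simp add: sum_divide_distrib smaller_mass_def)
  finally have "l2_inner (wandering c) (wandering c) =
      (complex_of_real (smaller_mass c) / ?n +
        complex_of_real ((smaller_mass c / lam c)\<^sup>2) / ?n) / ?n"
    unfolding inner_wandering[OF u]
    by (simp add: wandering_def False not_in_smaller_siblings power2_eq_square)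
  also have "\<dots> = complex_of_real (smaller_mass c + (smaller_mass c / lam c)\<^sup>2) / ?n\<^sup>2"
    by (simp add: add_divide_distrib power2_eq_square)
  also have "\<dots> = 1" unfolding n(2)[symmetric] using n(1) by simp
  finally show ?thesis .
qed (simp add: wandering_root, simp add: ket_def)

text \<open>The vector of the later sibling d is proportional to the weights at all siblings before
  d, in particular at c and everything before c.\<close>

lemma inner_wandering_less:
  assumes "c \<in> wandering_index" "d \<in> wandering_index"
    and "(u, c) \<in> E" "(u, d) \<in> E" "to_nat_on V c < to_nat_on V d"
  shows "l2_inner (wandering d) (wandering c) = 0"
proof (rule inner_wandering_multiple[OF assms(3)])
  fix v assume "v \<in> insert c (smaller_siblings c)"
  then have "v \<in> smaller_siblings d"
    using assms(3-5) par_eq[OF assms(3)] par_eq[OF assms(4)] by (auto simp: smaller_siblings_def Chi_def)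
  moreover have "\<not> is_root V E d" using assms(4) by (auto simp: is_root_def)
  ultimately show "wandering d v = complex_of_real (lam v) * (1 / complex_of_real (wandering_norm d))"
    by (simp add: wandering_def)
qed

lemma inner_wandering_parents_differ:
  assumes "(u, c) \<in> E" "\<And>v. (u, v) \<in> E \<Longrightarrow> wandering d v = 0"
  shows "l2_inner (wandering d) (wandering c) = 0"
proof (rule inner_wandering_multiple[OF assms(1), where k=0])
  fix v assume "v \<in> insert c (smaller_siblings c)"
  then have "(u, v) \<in> E" using assms(1) par_eq[OF assms(1)] by (auto simp: smaller_siblings_def Chi_def)
  then show "wandering d v = complex_of_real (lam v) * 0" by (simp add: assms(2))
qed

lemma inner_wandering_distinct:
  assumes c: "c \<in> wandering_index" and d: "d \<in> wandering_index" and ne: "c \<noteq> d"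
  shows "l2_inner (wandering d) (wandering c) = 0"
proof -
  have aux: "l2_inner (wandering b) (wandering a) = 0"
    if "(u, a) \<in> E" "is_root V E b \<or> (w, b) \<in> E \<and> w \<noteq> u" for a b u w
  proof (rule inner_wandering_parents_differ[OF that(1)])
    fix v assume v: "(u, v) \<in> E"
    show "wandering b v = 0"
    proof (cases "is_root V E b")
      case True
      then show ?thesis using v by (auto simp: wandering_root ket_def is_root_def)
    next
      case False
      with that have "(w, b) \<in> E" "w \<noteq> u" by auto
      then have "v \<notin> smaller_siblings b" "v \<noteq> b"
        using parent_unique[OF v, of w] par_eq[of w b] by (auto simp: smaller_siblings_def Chi_def)
      then show ?thesis by (simp add: wandering_def False)
    qed
  qed
  show ?thesis
  proof (cases "is_root V E c")
    case True
    then have "\<not> is_root V E d" using root_unique ne by blast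
    then obtain w where "(w, d) \<in> E" using d by (auto simp: is_root_def)
    then have "l2_inner (wandering c) (wandering d) = 0" using aux True by blast
    then show ?thesis using l2_inner_commute[of "wandering d" "wandering c"] by simp
  next
    case False
    then obtain u where u: "(u, c) \<in> E" using c by (auto simp: is_root_def)
    show ?thesis
    proof (cases "is_root V E d")
      case True
      then show ?thesis using aux u by blast
    next
      case False
      then obtain w where w: "(w, d) \<in> E" using d by (auto simp: is_root_def)
      show ?thesis
      proof (cases "w = u")
        case True
        have "to_nat_on V c \<noteq> to_nat_on V d"
          using c d ne inj_to_nat_on_V by (auto simp: inj_on_def)
        then consider "to_nat_on V c < to_nat_on V d" | "to_nat_on V d < to_nat_on V c" by linarith
        then show ?thesis
        proof cases
          case 1
          then show ?thesis using inner_wandering_less[OF c d u] w True by blast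
        next
          case 2
          then have "l2_inner (wandering c) (wandering d) = 0"
            using inner_wandering_less[OF d c w] u True by blast
          then show ?thesis using l2_inner_commute[of "wandering d" "wandering c"] by simp
        qed
      qed (use aux[OF u, of d w] w in blast)
    qed
  qed
qed

lemma inner_shift_wandering:
  assumes "f \<in> ell2 V" "c \<in> wandering_index"
  shows "l2_inner (shift f) (wandering c) = 0"
proof (cases "is_root V E c")
  case True
  then have "c \<notin> non_roots V E" by (auto simp: non_roots_def)
  then show ?thesis by (simp add: wandering_root[OF True] shift_not_edge)
next
  case False
  then obtain u where u: "(u, c) \<in> E" using assms by (auto simp: is_root_def)
  show ?thesis
  proof (rule inner_wandering_multiple[OF u])
    fix d assume "d \<in> insert c (smaller_siblings c)"
    then have "(u, d) \<in> E" using u par_eq[OF u] by (auto simp: smaller_siblings_def Chi_def)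
    then show "shift f d = complex_of_real (lam d) * f u" by (rule shift_edge)
  qed
qed

text \<open>A vector is in the range iff it vanishes at a root and is proportional to the weights on
  each set of children. Orthogonality to the vector of a child w determines \<open>f w\<close> from
  the values at the smaller siblings, so proportionality spreads along the numbering from the first
  child, also through infinitely many children.\<close>

lemma orthogonal_wandering_imp_range:
  assumes f: "f \<in> ell2 V" and perp: "\<And>c. c \<in> wandering_index \<Longrightarrow> l2_inner f (wandering c) = 0"
  shows "f = shift (adj V shift f)"
proof
  fix v
  show "f v = shift (adj V shift f) v"
  proof (cases "v \<in> non_roots V E")
    case False
    have "f v = 0"
    proof (cases "v \<in> V")
      case True
      then have r: "is_root V E v" using False by (simp add: non_roots_def)
      then have "v \<in> wandering_index"
        using True first_child_in[OF Chi_nonempty] by (auto simp: Chi_def is_root_def)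
      then show ?thesis using perp wandering_root[OF r] by force
    qed (rule ell2_zero_outside[OF f])
    then show ?thesis by (simp add: shift_not_edge[OF False])
  next
    case True
    define u where "u = par E v"
    have e: "(u, v) \<in> E" using True by (simp add: u_def non_roots_iff)
    have u: "u \<in> V" using edge_in[OF e] by blast
    \<comment> \<open>The proportionality factor is read off at the one child of u that carries no
      wandering vector.\<close>
    define k where "k = f (first_child u) / complex_of_real (lam (first_child u))"
    have first_edge: "(u, first_child u) \<in> E"
      using first_child_in[OF Chi_nonempty[OF u]] by (simp add: Chi_def)
    have mult: "(u, w) \<in> E \<Longrightarrow> f w = complex_of_real (lam w) * k" for w
    proof (induction "to_nat_on V w" arbitrary: w rule: less_induct)
      case less
      note w = less.prems
      show ?case
      proof (cases "w = first_child u")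
        case True
        then show ?thesis using lam_pos_edge[OF first_edge] by (simp add: k_def)
      next
        case False
        have "w \<noteq> first_child x" if "x \<in> V" for x
          using False parent_unique[OF w] first_child_in[OF Chi_nonempty[OF that]]
          by (cases "x = u") (auto simp: Chi_def)
        then have wi: "w \<in> wandering_index" using edge_in[OF w] by blast
        have "(\<Sum>d\<in>smaller_siblings w. f d * complex_of_real (lam d)) =
            (\<Sum>d\<in>smaller_siblings w. k * complex_of_real ((lam d)\<^sup>2))"
        proof (rule sum.cong)
          fix d assume "d \<in> smaller_siblings w"
          then have "(u, d) \<in> E" "to_nat_on V d < to_nat_on V w"
            using par_eq[OF w] by (auto simp: smaller_siblings_def Chi_def)
          then have "f d = complex_of_real (lam d) * k" using less.hyps by blast
          then show "f d * complex_of_real (lam d) = k * complex_of_real ((lam d)\<^sup>2)"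
            by (simp add: power2_eq_square)
        qed simp
        also have "\<dots> = k * complex_of_real (smaller_mass w)"
          unfolding smaller_mass_def of_real_sum sum_distrib_left ..
        finally have "k * complex_of_real (smaller_mass w) =
            f w * complex_of_real (smaller_mass w / lam w)"
          using perp[OF wi] wandering_norm_sq(1)[OF wi w] by (simp add: inner_wandering[OF w])
        then have "f w * complex_of_real (smaller_mass w) =
            (complex_of_real (lam w) * k) * complex_of_real (smaller_mass w)"
          using lam_pos_edge[OF w] by (auto simp: field_simps)
        then show ?thesis using smaller_mass_pos[OF wi w] by (auto simp: mult.commute)
      qed
    qed
    have "adj V shift f u = k"
      by (rule adj_shift_of_multiple[OF u]) (use mult in \<open>simp add: Chi_def\<close>)
    then show ?thesis using shift_edge[OF e] mult[OF e] by simp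
  qed
qed

definition shifted_wandering :: "'a \<times> nat \<Rightarrow> 'a \<Rightarrow> complex" where
  "shifted_wandering = (\<lambda>(c, n). (shift ^^ n) (wandering c))"

lemma shifted_wandering_in: "c \<in> V \<Longrightarrow> shifted_wandering (c, n) \<in> ell2 V"
  by (simp add: shifted_wandering_def funpow_shift_in wandering_in)

text \<open>By isometry n of the m shifts cancel. At least one is left, and the range of the shift
  is orthogonal to the wandering vectors.\<close>

lemma inner_funpow_shift_wandering:
  assumes "f \<in> ell2 V" "c \<in> wandering_index" "n < m"
  shows "l2_inner ((shift ^^ m) f) (shifted_wandering (c, n)) = 0"
proof -
  have "(shift ^^ (n + Suc (m - Suc n))) f = (shift ^^ n) (shift ((shift ^^ (m - Suc n)) f))"
    by (simp only: funpow_add funpow.simps(2) o_apply)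
  then have "(shift ^^ m) f = (shift ^^ n) (shift ((shift ^^ (m - Suc n)) f))"
    using assms(3) by simp
  then show ?thesis
    using assms by (simp add: shifted_wandering_def inner_funpow_shift_shift shift_in funpow_shift_in
        wandering_in inner_shift_wandering)
qed

lemma shifted_wandering_orthonormal:
  assumes "c \<in> wandering_index" "d \<in> wandering_index"
  shows "l2_inner (shifted_wandering (c, m)) (shifted_wandering (d, n)) =
    (if (c, m) = (d, n) then 1 else 0)"
proof -
  have ge: "l2_inner (shifted_wandering (a, m)) (shifted_wandering (b, n)) = 0"
    if "n < m" "a \<in> wandering_index" "b \<in> wandering_index" for a b m n
    using inner_funpow_shift_wandering[OF wandering_in that(3,1), of a] that(2)
    by (simp add: shifted_wandering_def)
  consider "n < m" | "m < n" | "m = n" by linarith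
  then show ?thesis
  proof cases
    case 1
    then show ?thesis using ge assms by auto
  next
    case 2
    then show ?thesis
      using ge[OF 2 assms(2,1)] l2_inner_commute[of "shifted_wandering (c, m)"] by auto
  next
    case 3
    have "l2_inner (shifted_wandering (c, n)) (shifted_wandering (d, n)) = l2_inner (wandering c) (wandering d)"
      using assms by (simp add: shifted_wandering_def inner_funpow_shift_shift wandering_in)
    then show ?thesis
      using 3 inner_wandering_self[OF assms(1)] inner_wandering_distinct[OF assms(2,1)] by auto
  qed
qed

lemma orthogonal_shifted_wandering_imp_range:
  assumes f: "f \<in> ell2 V"
    and perp: "\<And>c n. c \<in> wandering_index \<Longrightarrow> l2_inner f (shifted_wandering (c, n)) = 0"
  shows "f = (shift ^^ n) ((adj V shift ^^ n) f)"
proof (induction n)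
  case (Suc n)
  let ?g = "(adj V shift ^^ n) f"
  have g: "?g \<in> ell2 V" by (rule funpow_adj_shift_in[OF f])
  have "?g = shift (adj V shift ?g)"
  proof (rule orthogonal_wandering_imp_range[OF g])
    fix c assume c: "c \<in> wandering_index"
    then have "l2_inner ((shift ^^ n) (wandering c)) f = l2_inner (wandering c) ?g"
      by (intro inner_funpow_shift wandering_in f) auto
    then show "l2_inner ?g (wandering c) = 0"
      using perp[OF c, of n] l2_inner_commute[of f] l2_inner_commute[of ?g]
      by (simp add: shifted_wandering_def)
  qed
  then have "(shift ^^ n) ?g = (shift ^^ n) (shift (adj V shift ?g))" by (rule arg_cong)
  also have "\<dots> = (shift ^^ Suc n) ((adj V shift ^^ Suc n) f)"
    by (simp add: funpow_swap1[of shift])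
  finally show ?case using Suc by (rule trans[rotated])
qed simp

end

section \<open>Unitary equivalence\<close>

context isometric_tree
begin

text \<open>In the Wold decomposition the unitary part is the intersection of the ranges of all
  powers; here it is required to be trivial.\<close>

definition pure :: bool where
  "pure \<longleftrightarrow> (\<forall>f\<in>ell2 V. (\<forall>n. \<exists>g\<in>ell2 V. f = (shift ^^ n) g) \<longrightarrow> f = (\<lambda>_. 0))"

lemma pureD: "pure \<Longrightarrow> f \<in> ell2 V \<Longrightarrow> (\<And>n. \<exists>g\<in>ell2 V. f = (shift ^^ n) g) \<Longrightarrow> f = (\<lambda>_. 0)"
  by (auto simp: pure_def)

lemma wandering_enumeration:
  obtains e where "bij_betw e (copies (ecard wandering_index)) wandering_index"
proof (rule bij_betw_copies_ecard)
  show "countable wandering_index" using countable_V by (rule countable_subset[rotated]) blast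
qed

text \<open>\<open>pure\<close> supplies totality: a vector orthogonal to all shifted wandering
  vectors lies in the range of every power.\<close>

lemma unitarily_equivalent_shift_sum:
  assumes pure
  shows "unitarily_equivalent (ell2 V) (restrict shift (ell2 V))
    (ell2 (copies (ecard wandering_index) \<times> UNIV)) (shift_sum (ecard wandering_index))"
proof -
  let ?N = "ecard wandering_index"
  obtain e where e: "bij_betw e (copies ?N) wandering_index" by (rule wandering_enumeration)
  have e_in: "j \<in> copies ?N \<Longrightarrow> e j \<in> wandering_index" for j
    using e by (auto simp: bij_betw_def)
  have e_inj: "i \<in> copies ?N \<Longrightarrow> j \<in> copies ?N \<Longrightarrow> e i = e j \<longleftrightarrow> i = j" for i j
    using e by (auto simp: bij_betw_def inj_on_def)
  define x where "x = (\<lambda>(j, n). shifted_wandering (e j, n))"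
  show ?thesis
  proof (rule unitarily_equivalent_orthonormal_basis[where x=x and s="\<lambda>(j, n). (j, n + 1)"])
    fix i assume "i \<in> copies ?N \<times> (UNIV :: nat set)"
    then obtain j n where i: "i = (j, n)" "j \<in> copies ?N" by auto
    show x_in: "x i \<in> ell2 V"
      using e_in[OF i(2)] by (simp add: i x_def shifted_wandering_in)
    show "restrict shift (ell2 V) (x i) = x (case i of (j, n) \<Rightarrow> (j, n + 1))"
      using x_in by (simp add: i x_def shifted_wandering_def)
    show "shift_sum ?N (ket i) = ket (case i of (j, n) \<Rightarrow> (j, n + 1))"
      using shift_sum_ket i by simp
    show "(case i of (j, n) \<Rightarrow> (j, n + 1)) \<in> copies ?N \<times> UNIV" using i by simp
    fix i' assume "i' \<in> copies ?N \<times> (UNIV :: nat set)"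
    then obtain j' n' where i': "i' = (j', n')" "j' \<in> copies ?N" by auto
    show "l2_inner (x i) (x i') = (if i = i' then 1 else 0)"
      using shifted_wandering_orthonormal[OF e_in[OF i(2)] e_in[OF i'(2)]] e_inj[OF i(2) i'(2)]
      by (simp add: x_def i(1) i'(1))
  next
    fix f assume f: "f \<in> ell2 V" and perp: "\<And>i. i \<in> copies ?N \<times> UNIV \<Longrightarrow> l2_inner f (x i) = 0"
    have "l2_inner f (shifted_wandering (c, n)) = 0" if "c \<in> wandering_index" for c n
    proof -
      have "c \<in> e ` copies ?N" using that unfolding bij_betw_imp_surj_on[OF e] .
      then obtain j where "c = e j" "j \<in> copies ?N" by (rule imageE)
      then show ?thesis using perp[of "(j, n)"] by (simp add: x_def)
    qed
    then have "\<exists>g\<in>ell2 V. f = (shift ^^ n) g" for n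
      using orthogonal_shifted_wandering_imp_range[OF f] funpow_adj_shift_in[OF f] by blast
    then show "f = (\<lambda>_. 0)" using pureD[OF assms f] by blast
  qed (simp_all add: shift_bounded_on bounded_on_shift_sum)
qed

text \<open>A vertex at depth n has no ancestor at distance n + 1, so the range of the power n + 1
  consists of vectors vanishing there.\<close>

lemma pure_if_root:
  assumes "has_root V E"
  shows pure
  unfolding pure_def
proof (intro ballI impI ext)
  fix f v assume f: "f \<in> ell2 V" and range: "\<forall>n. \<exists>g\<in>ell2 V. f = (shift ^^ n) g"
  obtain r where r: "is_root V E r" using assms by (auto simp: has_root_def)
  show "f v = 0"
  proof (cases "v \<in> V")
    case True
    then obtain n where n: "(r, v) \<in> E ^^ n" by (rule root_ancestor[OF r])
    have "(w, v) \<notin> E ^^ Suc n" for w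
    proof
      assume "(w, v) \<in> E ^^ Suc n"
      then obtain x where "(w, x) \<in> E" "(x, v) \<in> E ^^ n" by (meson relpow_Suc_E2)
      then show False using relpow_unique[OF n] r by (auto simp: is_root_def)
    qed
    moreover obtain g where "f = (shift ^^ Suc n) g" using range by blast
    ultimately show ?thesis using funpow_shift_no_ancestor by metis
  qed (rule ell2_zero_outside[OF f])
qed

text \<open>A subspace which the shift maps onto itself lies in the range of every power.\<close>

lemma pure_imp_cnu:
  assumes pure
  shows "completely_nonunitary (ell2 V) (restrict shift (ell2 V))"
  unfolding completely_nonunitary_def
proof (intro allI impI)
  fix L assume L: "reducing_subspace (ell2 V) (restrict shift (ell2 V)) L \<and>
    restrict shift (ell2 V) ` L = L \<and> (\<forall>f\<in>L. l2_norm (restrict shift (ell2 V) f) = l2_norm f)"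
  then have sub: "L \<subseteq> ell2 V" and zero: "(\<lambda>_. 0) \<in> L"
    by (auto simp: reducing_subspace_def closed_subspace_def)
  have surj: "\<exists>g\<in>L. f = shift g" if "f \<in> L" for f
  proof -
    have "f \<in> restrict shift (ell2 V) ` L" using that L by simp
    then show ?thesis using sub by auto
  qed
  have "\<exists>g\<in>L. f = (shift ^^ n) g" if "f \<in> L" for f n
  proof (induction n)
    case (Suc n)
    then obtain g where "g \<in> L" "f = (shift ^^ n) g" by blast
    moreover obtain g' where "g' \<in> L" "g = shift g'" using surj[OF \<open>g \<in> L\<close>] by blast
    ultimately have "f = (shift ^^ Suc n) g'" by (simp add: funpow_swap1)
    then show ?case using \<open>g' \<in> L\<close> by blast
  qed (use that in auto)
  then have "f = (\<lambda>_. 0)" if "f \<in> L" for f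
    using pureD[OF assms, of f] that sub by blast
  then show "L = {\<lambda>_. 0}" using zero by blast
qed

end

section \<open>Rootless trees and infinite products along branches\<close>

locale rootless_isometric_tree = isometric_tree +
  assumes rootless: "\<not> has_root V E"
begin

lemma non_roots_eq: "non_roots V E = V"
  using rootless by (auto simp: non_roots_def has_root_def)

lemma par_edge: "v \<in> V \<Longrightarrow> (par E v, v) \<in> E"
  using non_roots_iff non_roots_eq by blast

lemma funpow_par_relpow: "v \<in> V \<Longrightarrow> ((par E ^^ n) v, v) \<in> E ^^ n"
  using rootless_ancestor[OF rootless] relpow_par by metis

lemma branch_prod_nonneg: "v \<in> V \<Longrightarrow> 0 \<le> branch_prod n v"
  using branch_prod_pos[OF funpow_par_relpow] less_imp_le by blast

lemma branch_prod_decseq: "v \<in> V \<Longrightarrow> decseq (\<lambda>n. branch_prod n v)"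
proof (rule decseq_SucI)
  fix n assume v: "v \<in> V"
  have "((par E ^^ Suc n) v, v) \<in> E ^^ Suc n" by (rule funpow_par_relpow[OF v])
  then obtain x where x: "((par E ^^ Suc n) v, x) \<in> E" "(x, v) \<in> E ^^ n" by (meson relpow_Suc_E2)
  then have "lam ((par E ^^ n) v) \<le> 1" using lam_le_1 relpow_par by metis
  then have "branch_prod n v * lam ((par E ^^ n) v) \<le> branch_prod n v * 1"
    by (intro mult_left_mono branch_prod_nonneg v) auto
  then show "branch_prod (Suc n) v \<le> branch_prod n v" by (simp add: branch_prod_def)
qed

text \<open>The function \<open>h\<close> of the overview. The limit exists because all weights are
  at most 1, so the partial products decrease.\<close>

definition branch_lim :: "'a \<Rightarrow> real" where
  "branch_lim v = lim (\<lambda>n. branch_prod n v)"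

lemma branch_prod_tendsto:
  assumes "v \<in> V"
  shows "(\<lambda>n. branch_prod n v) \<longlonglongrightarrow> branch_lim v"
proof -
  have "convergent (\<lambda>n. branch_prod n v)"
    using decseq_bounded[OF branch_prod_decseq[OF assms], of 0] branch_prod_nonneg[OF assms]
      branch_prod_decseq[OF assms] Bseq_monoseq_convergent decseq_imp_monoseq
    by blast
  then show ?thesis unfolding branch_lim_def by (simp add: convergent_LIMSEQ_iff)
qed

lemma branch_lim_le: "v \<in> V \<Longrightarrow> branch_lim v \<le> branch_prod n v"
  by (rule decseq_ge[OF branch_prod_decseq branch_prod_tendsto])

lemma branch_lim_nonneg: "v \<in> V \<Longrightarrow> 0 \<le> branch_lim v"
  by (rule LIMSEQ_le_const[OF branch_prod_tendsto]) (use branch_prod_nonneg in auto)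

lemma branch_lim_edge:
  assumes "(u, v) \<in> E"
  shows "branch_lim v = lam v * branch_lim u"
proof (rule LIMSEQ_unique)
  have uv: "u \<in> V" "v \<in> V" using edge_in[OF assms] by auto
  show "(\<lambda>n. branch_prod (Suc n) v) \<longlonglongrightarrow> branch_lim v"
    using branch_prod_tendsto[OF uv(2)] by (rule LIMSEQ_Suc)
  show "(\<lambda>n. branch_prod (Suc n) v) \<longlonglongrightarrow> lam v * branch_lim u"
    unfolding branch_prod_Suc par_eq[OF assms] by (intro tendsto_mult tendsto_const branch_prod_tendsto uv)
qed

lemma branch_lim_relpow: "(w, v) \<in> E ^^ n \<Longrightarrow> branch_lim v = branch_prod n v * branch_lim w"
proof (induction n arbitrary: v)
  case (Suc n)
  then obtain u where "(w, u) \<in> E ^^ n" "(u, v) \<in> E" by auto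
  then show ?case using Suc.IH branch_lim_edge by (simp add: branch_prod_Suc par_eq)
qed (simp add: branch_prod_def)

text \<open>Both values are positive multiples of the value at a common ancestor.\<close>

lemma branch_lim_zero_iff:
  assumes "u \<in> V" "v \<in> V"
  shows "branch_lim u = 0 \<longleftrightarrow> branch_lim v = 0"
proof -
  obtain w m n where w: "(w, u) \<in> E ^^ m" "(w, v) \<in> E ^^ n"
    by (rule common_ancestor[OF assms])
  show ?thesis
    using branch_lim_relpow[OF w(1)] branch_lim_relpow[OF w(2)] branch_prod_pos[OF w(1)]
      branch_prod_pos[OF w(2)] by simp
qed

text \<open>The terms are the squares of \<open>branch_lim\<close>, which vanish all together or not
  at all; the single term at u already bounds the sum from below.\<close>

lemma gen_sum_zero_iff:
  assumes "u \<in> V"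
  shows "gen_sum E lam u = 0 \<longleftrightarrow> branch_lim u = 0"
proof -
  have lim_eq: "lim (\<lambda>n. \<Prod>j<n. (lam ((par E ^^ j) v))\<^sup>2) = (branch_lim v)\<^sup>2" if "v \<in> V" for v
    using tendsto_power[OF branch_prod_tendsto[OF that], of 2]
    by (intro limI) (simp add: branch_prod_def prod_power_distrib)
  have gen: "gen_sum E lam u = (\<Sum>\<^sub>\<infinity>v\<in>Gen E u. ennreal ((branch_lim v)\<^sup>2))"
    unfolding gen_sum_def by (rule infsum_cong) (simp add: Gen_iff[OF rootless assms] lim_eq)
  show ?thesis
  proof
    assume "branch_lim u = 0"
    then have "\<And>v. v \<in> Gen E u \<Longrightarrow> branch_lim v = 0"
      using branch_lim_zero_iff[OF assms] Gen_iff[OF rootless assms] by blast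
    then show "gen_sum E lam u = 0" unfolding gen by (intro infsum_0) auto
  next
    assume zero: "gen_sum E lam u = 0"
    have "(\<Sum>v\<in>{u}. ennreal ((branch_lim v)\<^sup>2)) \<le> (\<Sum>\<^sub>\<infinity>v\<in>Gen E u. ennreal ((branch_lim v)\<^sup>2))"
      using assms Gen_iff[OF rootless assms]
      by (subst nonneg_infsum_complete) (auto intro!: SUP_upper2[of "{u}"])
    then show "branch_lim u = 0" using zero gen by simp
  qed
qed

text \<open>If f is the n-th shift of g, then ||g|| = ||f|| by isometry, so |f v| is at most
  \<open>branch_prod n v\<close> times ||f||, uniformly in n.\<close>

lemma pure_if_branch_lim_zero:
  assumes "\<And>v. v \<in> V \<Longrightarrow> branch_lim v = 0"
  shows pure
  unfolding pure_def
proof (intro ballI impI ext)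
  fix f v assume f: "f \<in> ell2 V" and range: "\<forall>n. \<exists>g\<in>ell2 V. f = (shift ^^ n) g"
  show "f v = 0"
  proof (cases "v \<in> V")
    case True
    have "cmod (f v) \<le> branch_prod n v * l2_norm f" for n
    proof -
      obtain g where g: "g \<in> ell2 V" "f = (shift ^^ n) g" using range by blast
      have "cmod (f v) = branch_prod n v * cmod (g ((par E ^^ n) v))"
        unfolding g(2) funpow_shift_relpow[OF funpow_par_relpow[OF True]]
        by (simp add: norm_mult branch_prod_nonneg[OF True])
      also have "\<dots> \<le> branch_prod n v * l2_norm g"
        by (intro mult_left_mono cmod_le_l2_norm[OF g(1)] branch_prod_nonneg True)
      also have "l2_norm g = l2_norm f" unfolding g(2) by (simp add: norm_funpow_shift g(1))
      finally show ?thesis .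
    qed
    moreover have "(\<lambda>n. branch_prod n v * l2_norm f) \<longlonglongrightarrow> 0 * l2_norm f"
      using branch_prod_tendsto[OF True] assms[OF True] by (intro tendsto_mult) auto
    ultimately have "cmod (f v) \<le> 0 * l2_norm f" by (intro LIMSEQ_le_const) auto
    then show ?thesis by simp
  qed (rule ell2_zero_outside[OF f])
qed

text \<open>With n the distance to a common ancestor w, both \<open>f\<close> and
  \<open>branch_lim\<close> arise at u and v from their data at w by the same factors
  \<open>branch_prod n\<close>. The cross-multiplied form stays valid where
  \<open>branch_lim\<close> vanishes.\<close>

lemma proportional_on_levels:
  assumes range: "\<And>n. \<exists>g. f = (shift ^^ n) g" and uv: "u \<in> V" "v \<in> V" "level u = level v"
  shows "f u * complex_of_real (branch_lim v) = f v * complex_of_real (branch_lim u)"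
proof -
  obtain w n where w: "(w, u) \<in> E ^^ n" "(w, v) \<in> E ^^ n" using same_level[OF uv] by metis
  obtain g where g: "f = (shift ^^ n) g" using range by blast
  show ?thesis
    unfolding g funpow_shift_relpow[OF w(1)] funpow_shift_relpow[OF w(2)]
      branch_lim_relpow[OF w(1)] branch_lim_relpow[OF w(2)] by simp
qed

definition level_vector :: "int \<Rightarrow> 'a \<Rightarrow> complex" where
  "level_vector k v = (if v \<in> V \<and> level v = k then complex_of_real (branch_lim v) else 0)"

text \<open>Finitely many vertices of level k lie n generations below one vertex w. There
  \<open>branch_lim\<close> is at most \<open>branch_prod n\<close>, the entry of the n-th shift of
  \<open>ket w\<close>, which is a unit vector; this gives the bound 1.\<close>

lemma level_vector_in: "level_vector k \<in> ell2 V"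
proof (rule ell2_I_bound[where C=1])
  fix F assume F: "finite F" "F \<subseteq> V"
  let ?F = "{v \<in> F. level v = k}"
  have "(\<Sum>v\<in>F. (cmod (level_vector k v))\<^sup>2) = (\<Sum>v\<in>?F. (branch_lim v)\<^sup>2)"
    using F by (intro sum.mono_neutral_cong_right) (auto simp: level_vector_def)
  also have "\<dots> \<le> 1"
  proof (cases "?F = {}")
    case False
    then obtain u where u: "u \<in> V" "level u = k" using F by blast
    obtain w n where w: "w \<in> V" "\<And>v. v \<in> ?F \<Longrightarrow> (w, v) \<in> E ^^ n"
    proof (rule same_level_finite[of ?F u])
      show "finite ?F" "?F \<subseteq> V" using F by auto
    qed (use u in auto)
    have "(\<Sum>v\<in>?F. (branch_lim v)\<^sup>2) \<le> (\<Sum>v\<in>?F. (cmod ((shift ^^ n) (ket w) v))\<^sup>2)"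
    proof (rule sum_mono)
      fix v assume v: "v \<in> ?F"
      then have "v \<in> V" using F by blast
      then show "(branch_lim v)\<^sup>2 \<le> (cmod ((shift ^^ n) (ket w) v))\<^sup>2"
        unfolding funpow_shift_relpow[OF w(2)[OF v]]
        using branch_lim_le[of v n] branch_lim_nonneg[of v] branch_prod_nonneg[of v n]
        by (intro power_mono) (auto simp: ket_def)
    qed
    also have "\<dots> \<le> (l2_norm ((shift ^^ n) (ket w)))\<^sup>2"
      using F w(1) by (intro finite_sum_le_l2_norm[of _ V] funpow_shift_in[of _ n]) auto
    also have "\<dots> = 1" using w(1) by (simp add: norm_funpow_shift)
    finally show ?thesis .
  qed (simp only: sum.empty)
  finally show "(\<Sum>v\<in>F. (cmod (level_vector k v))\<^sup>2) \<le> 1" .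
qed (simp add: level_vector_def)

lemma shift_level_vector: "shift (level_vector k) = level_vector (k + 1)"
proof
  fix v show "shift (level_vector k) v = level_vector (k + 1) v"
  proof (cases "v \<in> V")
    case True
    then show ?thesis
      using par_edge[OF True] edge_in[OF par_edge[OF True]] level_edge[OF par_edge[OF True]]
        branch_lim_edge[OF par_edge[OF True]] shift_edge[OF par_edge[OF True]]
      by (simp add: level_vector_def)
  qed (simp add: shift_not_edge non_roots_eq level_vector_def)
qed

lemma funpow_shift_level_vector: "(shift ^^ n) (level_vector k) = level_vector (k + int n)"
  by (induction n) (simp_all add: shift_level_vector ac_simps)

text \<open>A power of the isometric shift leads from the smaller of the levels 0 and k to the
  larger one.\<close>

lemma norm_level_vector_eq: "l2_norm (level_vector k) = l2_norm (level_vector 0)"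
proof (cases "0 \<le> k")
  case True
  then have "(shift ^^ nat k) (level_vector 0) = level_vector k"
    by (simp add: funpow_shift_level_vector)
  then show ?thesis using norm_funpow_shift[OF level_vector_in] by metis
next
  case False
  then have "(shift ^^ nat (- k)) (level_vector k) = level_vector 0"
    by (simp add: funpow_shift_level_vector)
  then show ?thesis using norm_funpow_shift[OF level_vector_in] by metis
qed

lemma norm_level_vector_pos:
  assumes "v \<in> V" "branch_lim v \<noteq> 0"
  shows "0 < l2_norm (level_vector k)"
proof -
  have "0 < cmod (level_vector (level v) v)" using assms by (simp add: level_vector_def)
  also have "\<dots> \<le> l2_norm (level_vector (level v))" by (rule cmod_le_l2_norm[OF level_vector_in])
  finally show ?thesis by (metis norm_level_vector_eq)
qed

lemma inner_level_vector_distinct: "k \<noteq> l \<Longrightarrow> l2_inner (level_vector k) (level_vector l) = 0"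
  by (subst l2_inner_finite[of "{}"]) (auto simp: level_vector_def)

text \<open>The level vector is the (n + 1)-st shift of the one at level k - (n + 1), which is one
  shift more than the wandering vector has undergone.\<close>

lemma inner_level_vector_shifted_wandering:
  assumes "c \<in> wandering_index"
  shows "l2_inner (level_vector k) (shifted_wandering (c, n)) = 0"
  using inner_funpow_shift_wandering[OF level_vector_in[of "k - int (Suc n)"] assms lessI[of n]]
  unfolding funpow_shift_level_vector by simp

text \<open>If \<open>branch_lim\<close> does not vanish, this is the intersection of the ranges of
  all powers. Equations between coordinates make closedness and invariance easy to check.\<close>

definition bilateral_part :: "('a \<Rightarrow> complex) set" where
  "bilateral_part = {f \<in> ell2 V. \<forall>u\<in>V. \<forall>v\<in>V. level u = level v \<longrightarrow>
     f u * complex_of_real (branch_lim v) = f v * complex_of_real (branch_lim u)}"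

lemma bilateral_partD:
  "f \<in> bilateral_part \<Longrightarrow> u \<in> V \<Longrightarrow> v \<in> V \<Longrightarrow> level u = level v \<Longrightarrow>
    f u * complex_of_real (branch_lim v) = f v * complex_of_real (branch_lim u)"
  by (simp add: bilateral_part_def)

lemma bilateral_part_subset: "bilateral_part \<subseteq> ell2 V"
  by (auto simp: bilateral_part_def)

lemma level_vector_in_bilateral_part: "level_vector k \<in> bilateral_part"
  using level_vector_in by (auto simp: bilateral_part_def level_vector_def)

text \<open>On the level of v, \<open>f\<close> is a multiple of the level vector, so its inner
  product with that vector is the factor times a positive number.\<close>

lemma bilateral_part_orthogonal_zero:
  assumes v0: "v0 \<in> V" "branch_lim v0 \<noteq> 0"
    and f: "f \<in> bilateral_part" and perp: "\<And>k. l2_inner f (level_vector k) = 0"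
  shows "f = (\<lambda>_. 0)"
proof
  fix v show "f v = 0"
  proof (cases "v \<in> V")
    case True
    have nz: "branch_lim v \<noteq> 0" using branch_lim_zero_iff[OF v0(1) True] v0(2) by blast
    let ?k = "f v / complex_of_real (branch_lim v)" and ?h = "level_vector (level v)"
    have eq: "f u * cnj (?h u) = ?k * (?h u * cnj (?h u))" for u
      using bilateral_partD[OF f True, of u] nz
      by (auto simp: level_vector_def field_simps)
    have "l2_inner f ?h = ?k * l2_inner ?h ?h"
      unfolding l2_inner_def eq by (rule infsum_cmult_right')
    then have "?k * complex_of_real ((l2_norm ?h)\<^sup>2) = 0" by (simp only: perp l2_inner_same)
    then show ?thesis using norm_level_vector_pos[OF v0, of "level v"] nz by simp
  next
    case False
    show ?thesis by (rule ell2_zero_outside[OF subsetD[OF bilateral_part_subset f] False])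
  qed
qed

lemma unitarily_equivalent_bilateral_sum:
  assumes v0: "v0 \<in> V" "branch_lim v0 \<noteq> 0"
  shows "unitarily_equivalent (ell2 V) (restrict shift (ell2 V))
    (ell2 (UNIV <+> copies (ecard wandering_index) \<times> UNIV)) (bilateral_sum (ecard wandering_index))"
proof -
  let ?N = "ecard wandering_index" and ?s = "map_sum (\<lambda>k::int. k + 1) (\<lambda>(j, n). (j, n + 1))"
  let ?I = "(UNIV :: int set) <+> copies ?N \<times> (UNIV :: nat set)"
  obtain e where e: "bij_betw e (copies ?N) wandering_index" by (rule wandering_enumeration)
  have e_in: "j \<in> copies ?N \<Longrightarrow> e j \<in> wandering_index" for j
    using e by (auto simp: bij_betw_def)
  have e_inj: "i \<in> copies ?N \<Longrightarrow> j \<in> copies ?N \<Longrightarrow> e i = e j \<longleftrightarrow> i = j" for i j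
    using e by (auto simp: bij_betw_def inj_on_def)
  \<comment> \<open>All level vectors have the same norm, so one common factor normalises them and
    the shift still maps each to the next.\<close>
  define r where "r = l2_norm (level_vector 0)"
  have r: "0 < r" "\<And>k. l2_norm (level_vector k) = r"
    using norm_level_vector_pos[OF v0] norm_level_vector_eq by (auto simp: r_def)
  define s where "s = complex_of_real (1 / r)"
  have s: "s * (cnj s * complex_of_real (r\<^sup>2)) = 1" "s \<noteq> 0"
    using r(1) by (simp_all add: s_def power2_eq_square)
  define y where "y k = (\<lambda>v. s * level_vector k v)" for k
  define x where "x = case_sum y (\<lambda>(j, n). shifted_wandering (e j, n))"
  have y_in: "y k \<in> ell2 V" for k unfolding y_def by (rule ell2_scale[OF level_vector_in])
  have yy: "l2_inner (y k) (y l) = (if k = l then 1 else 0)" for k l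
    using s inner_level_vector_distinct[of k l]
    by (simp add: y_def l2_inner_scale_left l2_inner_scale_right l2_inner_same r(2))
  have yw: "l2_inner (y k) (shifted_wandering (c, n)) = 0"
    "l2_inner (shifted_wandering (c, n)) (y k) = 0" if "c \<in> wandering_index" for k c n
    using inner_level_vector_shifted_wandering[OF that, of k n]
      l2_inner_commute[of "shifted_wandering (c, n)" "y k"]
    by (simp_all add: y_def l2_inner_scale_left)
  have shift_y: "shift (y k) = y (k + 1)" for k
  proof -
    have "shift (\<lambda>v. s * level_vector k v + 0) =
        (\<lambda>v. s * shift (level_vector k) v + shift (\<lambda>_. 0) v)"
      by (rule bounded_on_lincomb[OF shift_bounded_on level_vector_in zero_in_ell2])
    also have "shift (\<lambda>_. 0) = (\<lambda>_. 0)" by (simp add: shift_def wpull_def fun_eq_iff)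
    finally show ?thesis by (simp add: y_def shift_level_vector)
  qed
  show ?thesis
  proof (rule unitarily_equivalent_orthonormal_basis[where x=x and s="?s"])
    fix i assume i: "i \<in> ?I"
    show x_in: "x i \<in> ell2 V"
      using i e_in by (auto simp: x_def y_in shifted_wandering_in)
    show "restrict shift (ell2 V) (x i) = x (?s i)"
      using i x_in by (auto simp: x_def shifted_wandering_def shift_y)
    show "bilateral_sum ?N (ket i) = ket (?s i)"
      using i bilateral_sum_ket_Inl bilateral_sum_ket_Inr by auto
    show "?s i \<in> ?I" using i by auto
    fix i' assume i': "i' \<in> ?I"
    have "l2_inner (shifted_wandering (e j, n)) (shifted_wandering (e j', n')) =
        (if (j, n) = (j', n') then 1 else 0)"
      if "j \<in> copies ?N" "j' \<in> copies ?N" for j j' n n'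
      using shifted_wandering_orthonormal[OF e_in[OF that(1)] e_in[OF that(2)]] e_inj[OF that] by simp
    then show "l2_inner (x i) (x i') = (if i = i' then 1 else 0)"
      using i i' e_in by (elim PlusE) (auto simp: x_def yy yw split: if_splits)
  next
    fix f assume f: "f \<in> ell2 V" and perp: "\<And>i. i \<in> ?I \<Longrightarrow> l2_inner f (x i) = 0"
    have "l2_inner f (shifted_wandering (c, n)) = 0" if "c \<in> wandering_index" for c n
    proof -
      have "c \<in> e ` copies ?N" using that unfolding bij_betw_imp_surj_on[OF e] .
      then obtain j where "c = e j" "j \<in> copies ?N" by (rule imageE)
      then show ?thesis using perp[of "Inr (j, n)"] by (simp add: x_def InrI)
    qed
    then have "\<exists>g. f = (shift ^^ n) g" for n
      using orthogonal_shifted_wandering_imp_range[OF f] by blast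
    then have fb: "f \<in> bilateral_part"
      using f proportional_on_levels by (auto simp: bilateral_part_def)
    have "l2_inner f (level_vector k) = 0" for k
      using perp[of "Inl k"] s(2) by (simp add: x_def InlI y_def l2_inner_scale_right)
    then show "f = (\<lambda>_. 0)" by (rule bilateral_part_orthogonal_zero[OF v0 fb])
  next
    show "bounded_on ?I ?I (bilateral_sum ?N)" by (rule bounded_on_bilateral_sum)
  qed (simp add: shift_bounded_on)
qed

lemma bilateral_part_shift: "f \<in> bilateral_part \<Longrightarrow> shift f \<in> bilateral_part"
proof -
  assume f: "f \<in> bilateral_part"
  have "shift f u * complex_of_real (branch_lim v) = shift f v * complex_of_real (branch_lim u)"
    if uv: "u \<in> V" "v \<in> V" "level u = level v" for u v
  proof -
    note e = par_edge[OF uv(1)] par_edge[OF uv(2)]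
    have "f (par E u) * complex_of_real (branch_lim (par E v)) =
        f (par E v) * complex_of_real (branch_lim (par E u))"
      using bilateral_partD[OF f, of "par E u" "par E v"] edge_in[OF e(1)] edge_in[OF e(2)]
        level_edge[OF e(1)] level_edge[OF e(2)] uv(3) by simp
    then show ?thesis
      unfolding shift_edge[OF e(1)] shift_edge[OF e(2)] branch_lim_edge[OF e(1)] branch_lim_edge[OF e(2)]
      by (simp add: algebra_simps)
  qed
  then show ?thesis using f by (auto simp: bilateral_part_def shift_in)
qed

text \<open>The values of \<open>branch_lim\<close> at the children of u are their weights times the
  nonzero value at u, so \<open>f\<close> is proportional to the weights on Chi(u). The adjoint then
  divides by the weight of any child, and the shift restores \<open>f\<close>.\<close>

lemma bilateral_part_adj:
  assumes v0: "v0 \<in> V" "branch_lim v0 \<noteq> 0" and f: "f \<in> bilateral_part"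
  shows "adj V shift f \<in> bilateral_part" and "shift (adj V shift f) = f"
proof -
  have fV: "f \<in> ell2 V" using f bilateral_part_subset by blast
  have adj_eq: "adj V shift f u = f v / complex_of_real (lam v)" if e: "(u, v) \<in> E" for u v
  proof (rule adj_shift_of_multiple)
    show "u \<in> V" using edge_in[OF e] by blast
    fix w assume "w \<in> Chi E u"
    then have w: "(u, w) \<in> E" by (simp add: Chi_def)
    have nz: "branch_lim u \<noteq> 0" using branch_lim_zero_iff[OF v0(1)] v0(2) edge_in[OF e] by blast
    have "f w * complex_of_real (branch_lim v) = f v * complex_of_real (branch_lim w)"
      using edge_in[OF e] edge_in[OF w] level_edge[OF e] level_edge[OF w]
      by (intro bilateral_partD[OF f]) auto
    then have "f w * complex_of_real (lam v) = f v * complex_of_real (lam w)"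
      unfolding branch_lim_edge[OF e] branch_lim_edge[OF w] using nz by simp
    then show "f w = complex_of_real (lam w) * (f v / complex_of_real (lam v))"
      using lam_pos_edge[OF e] by (simp add: field_simps)
  qed
  have "adj V shift f u * complex_of_real (branch_lim v) = adj V shift f v * complex_of_real (branch_lim u)"
    if uv: "u \<in> V" "v \<in> V" "level u = level v" for u v
  proof -
    obtain u' v' where e: "(u, u') \<in> E" "(v, v') \<in> E"
      using Chi_nonempty[OF uv(1)] Chi_nonempty[OF uv(2)] by (auto simp: Chi_def)
    have "f u' * complex_of_real (branch_lim v') = f v' * complex_of_real (branch_lim u')"
      using edge_in[OF e(1)] edge_in[OF e(2)] level_edge[OF e(1)] level_edge[OF e(2)] uv(3)
      by (intro bilateral_partD[OF f]) auto
    then show ?thesis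
      unfolding adj_eq[OF e(1)] adj_eq[OF e(2)] branch_lim_edge[OF e(1)] branch_lim_edge[OF e(2)]
      using lam_pos_edge[OF e(1)] lam_pos_edge[OF e(2)] by (simp add: field_simps)
  qed
  then show "adj V shift f \<in> bilateral_part"
    using adj_shift_in[OF fV] by (simp add: bilateral_part_def)
  show "shift (adj V shift f) = f"
  proof
    fix v show "shift (adj V shift f) v = f v"
    proof (cases "v \<in> V")
      case True
      show ?thesis
        unfolding shift_edge[OF par_edge[OF True]] adj_eq[OF par_edge[OF True]]
        using lam_pos_edge[OF par_edge[OF True]] by simp
    qed (use ell2_zero_outside[OF fV] in \<open>simp add: shift_not_edge non_roots_eq\<close>)
  qed
qed

lemma closed_subspace_bilateral_part: "closed_subspace bilateral_part"
  unfolding closed_subspace_def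
proof (intro conjI ballI allI)
  show sub: "bilateral_part \<subseteq> ell2 UNIV" using bilateral_part_subset ell2_UNIV_I by blast
  show "(\<lambda>_. 0) \<in> bilateral_part" by (simp add: bilateral_part_def)
  show "(\<lambda>x. c * f x + g x) \<in> bilateral_part" if "f \<in> bilateral_part" "g \<in> bilateral_part" for f g c
  proof -
    have "(c * f u + g u) * complex_of_real (branch_lim v) = (c * f v + g v) * complex_of_real (branch_lim u)"
      if "u \<in> V" "v \<in> V" "level u = level v" for u v
      using bilateral_partD[OF \<open>f \<in> bilateral_part\<close> that] bilateral_partD[OF \<open>g \<in> bilateral_part\<close> that]
      by (simp add: distrib_right mult.assoc)
    then show ?thesis using that by (simp add: bilateral_part_def ell2_lincomb)
  qed
  show "l2_closure bilateral_part = bilateral_part"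
  proof
    show "l2_closure bilateral_part \<subseteq> bilateral_part"
    proof
      fix h assume h: "h \<in> l2_closure bilateral_part"
      obtain g where g: "\<And>n. g n \<in> bilateral_part" "\<And>x. (\<lambda>n::nat. g n x) \<longlonglongrightarrow> h x"
        using l2_closure_pointwise[OF h sub] by metis
      have "h x = 0" if "x \<notin> V" for x
        using g(2)[of x] ell2_zero_outside[OF _ that] g(1) bilateral_part_subset
          LIMSEQ_unique[of "\<lambda>_. 0"] by (metis (no_types, lifting) LIMSEQ_const_iff ext subsetD)
      then have "h \<in> ell2 V" using h ell2_iff[of h V] by (auto simp: l2_closure_def)
      moreover have "h u * complex_of_real (branch_lim v) = h v * complex_of_real (branch_lim u)"
        if "u \<in> V" "v \<in> V" "level u = level v" for u v
      proof (rule LIMSEQ_unique)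
        show "(\<lambda>n. g n u * complex_of_real (branch_lim v)) \<longlonglongrightarrow> h u * complex_of_real (branch_lim v)"
          by (intro tendsto_mult g tendsto_const)
        show "(\<lambda>n. g n u * complex_of_real (branch_lim v)) \<longlonglongrightarrow> h v * complex_of_real (branch_lim u)"
          unfolding bilateral_partD[OF g(1) that] by (intro tendsto_mult g tendsto_const)
      qed
      ultimately show "h \<in> bilateral_part" by (simp add: bilateral_part_def)
    qed
  qed (rule l2_closure_superset[OF sub])
qed

text \<open>\<open>bilateral_part\<close> is the witness: it reduces the shift, is mapped onto
  itself, and contains the nonzero level vectors.\<close>

lemma not_cnu:
  assumes v0: "v0 \<in> V" "branch_lim v0 \<noteq> 0"
  shows "\<not> completely_nonunitary (ell2 V) (restrict shift (ell2 V))"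
proof
  assume cnu: "completely_nonunitary (ell2 V) (restrict shift (ell2 V))"
  let ?U = "restrict shift (ell2 V)"
  have U_eq: "?U f = shift f" if "f \<in> bilateral_part" for f
    using that bilateral_part_subset by auto
  have "?U ` bilateral_part = bilateral_part"
  proof
    show "?U ` bilateral_part \<subseteq> bilateral_part" using bilateral_part_shift U_eq by auto
    show "bilateral_part \<subseteq> ?U ` bilateral_part"
    proof
      fix f assume f: "f \<in> bilateral_part"
      show "f \<in> ?U ` bilateral_part"
        using bilateral_part_adj[OF v0 f] U_eq by (metis image_eqI)
    qed
  qed
  moreover have "reducing_subspace (ell2 V) ?U bilateral_part"
    unfolding reducing_subspace_def
  proof (intro conjI ballI impI)
    fix h g assume h: "h \<in> ell2 V" "\<forall>g\<in>bilateral_part. l2_inner h g = 0" and g: "g \<in> bilateral_part"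
    \<comment> \<open>Invariance of the orthogonal complement: g is the shift of \<open>?g\<close>,
      which again lies in the part, and the shift preserves inner products.\<close>
    let ?g = "adj V shift g"
    have g': "?g \<in> bilateral_part" "shift ?g = g" using bilateral_part_adj[OF v0 g] by auto
    then have "l2_inner (shift h) (shift ?g) = l2_inner h ?g"
      using h bilateral_part_subset by (intro inner_shift_shift) auto
    then show "l2_inner (?U h) g = 0" using h g' by simp
  qed (use closed_subspace_bilateral_part bilateral_part_subset bilateral_part_shift U_eq in auto)
  moreover have "\<forall>f\<in>bilateral_part. l2_norm (?U f) = l2_norm f"
    using bilateral_part_subset norm_shift by auto
  ultimately have "bilateral_part = {\<lambda>_. 0}"
    using cnu unfolding completely_nonunitary_def by blast
  then have "level_vector 0 = (\<lambda>_. 0)" using level_vector_in_bilateral_part by blast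
  then show False using norm_level_vector_pos[OF v0, of 0] by simp
qed

end

section \<open>Models of isometric weighted shifts\<close>

theorem (in isometric_tree) rooted_model:
  assumes "has_root V E"
  shows "unitarily_equivalent (ell2 V) (restrict shift (ell2 V))
    (ell2 (copies (Br V E + 1) \<times> UNIV)) (shift_sum (Br V E + 1))"
  using unitarily_equivalent_shift_sum[OF pure_if_root[OF assms]]
    ecard_non_first_children[OF Chi_nonempty] assms by simp

theorem (in rootless_isometric_tree) rootless_model:
  fixes U defines "U \<equiv> restrict shift (ell2 V)"
  shows "completely_nonunitary (ell2 V) U \<longleftrightarrow> (\<exists>u\<in>V. gen_sum E lam u = 0)"
    and "completely_nonunitary (ell2 V) U \<Longrightarrow>
      unitarily_equivalent (ell2 V) U (ell2 (copies (Br V E) \<times> UNIV)) (shift_sum (Br V E))"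
    and "\<not> completely_nonunitary (ell2 V) U \<Longrightarrow>
      unitarily_equivalent (ell2 V) U (ell2 (UNIV <+> copies (Br V E) \<times> UNIV))
        (orth_sum2 UNIV bilateral_shift (copies (Br V E) \<times> UNIV) (shift_sum (Br V E)))"
proof -
  have N: "ecard wandering_index = Br V E"
    using ecard_non_first_children[OF Chi_nonempty] rootless by simp
  \<comment> \<open>Any one vertex decides the case, since \<open>branch_lim\<close> vanishes
    everywhere or nowhere.\<close>
  obtain v0 where v0: "v0 \<in> V" using directed_tree by (auto simp: directed_tree_def)
  have iff: "branch_lim v0 = 0 \<longleftrightarrow> (\<exists>u\<in>V. gen_sum E lam u = 0)"
    using gen_sum_zero_iff branch_lim_zero_iff v0 by blast
  have pure: pure if "branch_lim v0 = 0"
    using pure_if_branch_lim_zero branch_lim_zero_iff[OF v0] that by blast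
  have cnu: "completely_nonunitary (ell2 V) U \<longleftrightarrow> branch_lim v0 = 0"
    unfolding U_def using pure_imp_cnu[OF pure] not_cnu[OF v0] by blast
  then show "completely_nonunitary (ell2 V) U \<longleftrightarrow> (\<exists>u\<in>V. gen_sum E lam u = 0)"
    using iff by blast
  show "unitarily_equivalent (ell2 V) U (ell2 (copies (Br V E) \<times> UNIV)) (shift_sum (Br V E))"
    if "completely_nonunitary (ell2 V) U"
    using unitarily_equivalent_shift_sum[OF pure] that cnu unfolding U_def N by blast
  show "unitarily_equivalent (ell2 V) U (ell2 (UNIV <+> copies (Br V E) \<times> UNIV))
        (orth_sum2 UNIV bilateral_shift (copies (Br V E) \<times> UNIV) (shift_sum (Br V E)))"
    if "\<not> completely_nonunitary (ell2 V) U"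
    using unitarily_equivalent_bilateral_sum[OF v0] that cnu unfolding U_def N bilateral_sum_def by blast
qed

section \<open>Asymptotic limits\<close>

text \<open>The sums are integrals for the counting measure on A; domination by G makes all of them
  absolutely convergent.\<close>

lemma infsum_dominated_convergence:
  fixes f :: "nat \<Rightarrow> 'a \<Rightarrow> real"
  assumes G: "G summable_on A" and le: "\<And>n x. x \<in> A \<Longrightarrow> \<bar>f n x\<bar> \<le> G x"
    and lim: "\<And>x. x \<in> A \<Longrightarrow> (\<lambda>n. f n x) \<longlonglongrightarrow> g x"
  shows "(\<lambda>n. infsum (f n) A) \<longlonglongrightarrow> infsum g A"
proof -
  have g_le: "\<bar>g x\<bar> \<le> G x" if "x \<in> A" for x
    using LIMSEQ_le_const2[OF tendsto_rabs[OF lim[OF that]]] le[OF that] by blast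
  have abs: "Infinite_Set_Sum.abs_summable_on h A" if "\<And>x. x \<in> A \<Longrightarrow> \<bar>h x\<bar> \<le> G x" for h :: "'a \<Rightarrow> real"
    unfolding abs_summable_equivalent[symmetric]
    by (rule summable_on_comparison_test[OF G]) (use that in auto)
  have "(\<lambda>n. integral\<^sup>L (count_space A) (f n)) \<longlonglongrightarrow> integral\<^sup>L (count_space A) g"
  proof (rule integral_dominated_convergence[where w=G])
    have "0 \<le> G x" if "x \<in> A" for x using le[OF that, of 0] by linarith
    then show "integrable (count_space A) G"
      using abs[of G] by (simp add: Infinite_Set_Sum.abs_summable_on_def)
  qed (use le lim in auto)
  moreover have "integral\<^sup>L (count_space A) (f n) = infsum (f n) A" for n
    using infsetsum_infsum[OF abs[OF le]] by (simp add: infsetsum_def)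
  moreover have "integral\<^sup>L (count_space A) g = infsum g A"
    using infsetsum_infsum[OF abs[OF g_le]] by (simp add: infsetsum_def)
  ultimately show ?thesis by simp
qed

section \<open>Diagonal operators and their positive square roots\<close>

definition diag :: "('a \<Rightarrow> real) \<Rightarrow> ('a \<Rightarrow> complex) \<Rightarrow> 'a \<Rightarrow> complex" where
  "diag m f u = complex_of_real (m u) * f u"

lemma diag_in: "f \<in> ell2 V \<Longrightarrow> (\<And>u. u \<in> V \<Longrightarrow> \<bar>m u\<bar> \<le> C) \<Longrightarrow> diag m f \<in> ell2 V"
  unfolding diag_def[abs_def] by (rule ell2_mult_bounded[where C=C]) auto

lemma bounded_on_diag:
  assumes "\<And>u. u \<in> V \<Longrightarrow> \<bar>m u\<bar> \<le> 1"
  shows "bounded_on V V (diag m)"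
proof (rule bounded_onI[where c=1])
  fix f assume f: "f \<in> ell2 V"
  show in_ell2: "diag m f \<in> ell2 V" by (rule diag_in[OF f assms])
  show "l2_norm (diag m f) \<le> 1 * l2_norm f"
  proof (simp, rule l2_norm_le[OF in_ell2])
    fix F assume F: "finite F" "F \<subseteq> V"
    have "(\<Sum>x\<in>F. (cmod (diag m f x))\<^sup>2) \<le> (\<Sum>x\<in>F. (cmod (f x))\<^sup>2)"
    proof (intro sum_mono power_mono)
      fix x assume "x \<in> F"
      then have "\<bar>m x\<bar> * cmod (f x) \<le> 1 * cmod (f x)"
        using assms F by (intro mult_right_mono) auto
      then show "cmod (diag m f x) \<le> cmod (f x)" by (simp add: diag_def norm_mult)
    qed simp
    also have "\<dots> \<le> (l2_norm f)\<^sup>2" by (rule finite_sum_le_l2_norm[OF f F(1)])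
    finally show "(\<Sum>x\<in>F. (cmod (diag m f x))\<^sup>2) \<le> (l2_norm f)\<^sup>2" .
  qed simp
qed (simp add: diag_def fun_eq_iff algebra_simps)

lemma diag_ket: "diag m (ket u) = (\<lambda>x. complex_of_real (m u) * ket u x)"
  by (auto simp: diag_def ket_def fun_eq_iff)

text \<open>A positive square root \<open>R\<close> must map each eigenvector \<open>e\<^sub>u\<close> of the diagonal operator to
  \<open>s e\<^sub>u\<close> with \<open>s = \<surd>m\<^sub>u\<close>: for \<open>g = R e\<^sub>u - s e\<^sub>u\<close> one has \<open>R g = - s g\<close>, so positivity forces
  \<open>g = 0\<close> if \<open>s > 0\<close>; if \<open>s = 0\<close> then \<open>R g = 0\<close>, and positivity at \<open>e\<^sub>u + c g\<close> for all \<open>c\<close>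
  forces \<open>g = 0\<close>.\<close>

lemma pos_sqrt_diag:
  assumes m: "\<And>u. u \<in> V \<Longrightarrow> 0 \<le> m u \<and> m u \<le> 1"
  shows "pos_sqrt (ell2 V) (restrict (diag m) (ell2 V)) = restrict (diag (\<lambda>u. sqrt (m u))) (ell2 V)"
    (is "_ = ?R")
  unfolding pos_sqrt_def
proof (rule the_equality)
  have sq: "\<bar>sqrt (m u)\<bar> \<le> 1" if "u \<in> V" for u using m[OF that] by simp
  have R: "?R \<in> bounded_ops (ell2 V) (ell2 V)"
    by (intro restrict_in_bounded_ops bounded_on_diag sq)
  have pos: "l2_inner (?R f) f \<in> \<real>\<^sub>\<ge>\<^sub>0" if f: "f \<in> ell2 V" for f
  proof -
    \<comment> \<open>With the fourth root, <R f, f> becomes the squared norm of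
      \<open>?q\<close>.\<close>
    let ?q = "diag (\<lambda>u. sqrt (sqrt (m u))) f"
    have "diag (\<lambda>u. sqrt (m u)) f x * cnj (f x) = ?q x * cnj (?q x)" for x
    proof (cases "x \<in> V")
      case True
      have "complex_of_real (sqrt (m x)) =
          complex_of_real (sqrt (sqrt (m x))) * complex_of_real (sqrt (sqrt (m x)))"
        using m[OF True] by (simp flip: of_real_mult)
      then show ?thesis by (simp add: diag_def)
    qed (use ell2_zero_outside[OF f] in \<open>simp add: diag_def\<close>)
    then have "l2_inner (?R f) f = l2_inner ?q ?q" using f by (simp add: l2_inner_def)
    then show ?thesis by (simp add: l2_inner_same del: of_real_power)
  qed
  have square: "?R (?R f) = restrict (diag m) (ell2 V) f" if f: "f \<in> ell2 V" for f
  proof -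
    have "diag (\<lambda>u. sqrt (m u)) f \<in> ell2 V" by (rule diag_in[OF f sq])
    moreover have "diag (\<lambda>u. sqrt (m u)) (diag (\<lambda>u. sqrt (m u)) f) = diag m f"
    proof
      fix x show "diag (\<lambda>u. sqrt (m u)) (diag (\<lambda>u. sqrt (m u)) f) x = diag m f x"
      proof (cases "x \<in> V")
        case True
        then have "complex_of_real (m x) = complex_of_real (sqrt (m x)) * complex_of_real (sqrt (m x))"
          using m by (simp flip: of_real_mult)
        then show ?thesis by (simp add: diag_def)
      qed (use ell2_zero_outside[OF f] in \<open>simp add: diag_def\<close>)
    qed
    ultimately show ?thesis using f by simp
  qed
  show "?R \<in> bounded_ops (ell2 V) (ell2 V) \<and> (\<forall>f\<in>ell2 V. l2_inner (?R f) f \<in> \<real>\<^sub>\<ge>\<^sub>0) \<and>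
      (\<forall>f\<in>ell2 V. ?R (?R f) = restrict (diag m) (ell2 V) f)"
    using R pos square by blast
  fix Q assume Q: "Q \<in> bounded_ops (ell2 V) (ell2 V) \<and> (\<forall>f\<in>ell2 V. l2_inner (Q f) f \<in> \<real>\<^sub>\<ge>\<^sub>0) \<and>
      (\<forall>f\<in>ell2 V. Q (Q f) = restrict (diag m) (ell2 V) f)"
  then have Qb: "bounded_on V V Q" by (simp add: bounded_ops_iff)
  have Qpos: "0 \<le> Re (l2_inner (Q f) f)" if "f \<in> ell2 V" for f
    using Q that by (auto simp: complex_nonneg_Reals_iff)
  have "Q (ket u) = ?R (ket u)" if u: "u \<in> V" for u
  proof -
    define s where "s = sqrt (m u)"
    have s: "0 \<le> s" "m u = s * s" using m[OF u] by (auto simp: s_def)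
    let ?k = "ket u"
    have k: "?k \<in> ell2 V" using u by simp
    have Qk: "Q ?k \<in> ell2 V" by (rule bounded_on_in[OF Qb k])
    have QQ: "Q (Q ?k) = (\<lambda>x. complex_of_real (s * s) * ?k x)"
      using Q k by (simp add: diag_ket s(2))
    define g where "g = (\<lambda>x. - complex_of_real s * ?k x + Q ?k x)"
    have g: "g \<in> ell2 V" unfolding g_def by (rule ell2_lincomb[OF k Qk])
    have Qg: "Q g = (\<lambda>x. - complex_of_real s * g x)"
      unfolding g_def bounded_on_lincomb[OF Qb k Qk] QQ by (auto simp: fun_eq_iff algebra_simps)
    have "g = (\<lambda>_. 0)"
    proof (cases "s = 0")
      case False
      have "l2_inner (Q g) g = - complex_of_real s * complex_of_real ((l2_norm g)\<^sup>2)"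
        unfolding Qg by (simp only: l2_inner_scale_left l2_inner_same)
      then have "Re (l2_inner (Q g) g) = - (s * (l2_norm g)\<^sup>2)" by simp
      then have "s * (l2_norm g)\<^sup>2 \<le> 0" using Qpos[OF g] by linarith
      then have "(l2_norm g)\<^sup>2 \<le> 0" using False s(1) by (simp add: mult_le_0_iff)
      then show ?thesis using l2_norm_eq_0[OF g] by simp
    next
      case True
      show ?thesis
      proof (rule ccontr)
        assume "g \<noteq> (\<lambda>_. 0)"
        then have n: "0 < (l2_norm g)\<^sup>2" using l2_norm_eq_0[OF g] by auto
        have Qk_eq: "Q ?k = g" by (simp add: g_def True)
        \<comment> \<open>Chosen so that -t ||g||^2 + Re <g, e_u> equals -1.\<close>
        define t where "t = (Re (l2_inner g ?k) + 1) / (l2_norm g)\<^sup>2"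
        let ?f = "\<lambda>x. - complex_of_real t * g x + ?k x"
        have f: "?f \<in> ell2 V" by (rule ell2_lincomb[OF g k])
        have "Q ?f = g"
          unfolding bounded_on_lincomb[OF Qb g k] Qg Qk_eq by (simp add: True)
        then have "l2_inner (Q ?f) ?f = - complex_of_real t * l2_inner g g + l2_inner g ?k"
          by (simp only: l2_inner_lincomb_right[OF g k g]) simp
        then have "Re (l2_inner (Q ?f) ?f) = - t * (l2_norm g)\<^sup>2 + Re (l2_inner g ?k)"
          by (simp add: l2_inner_same del: of_real_power)
        also have "\<dots> = -1" using n by (simp add: t_def)
        finally show False using Qpos[OF f] by simp
      qed
    qed
    then have "Q ?k x = complex_of_real s * ?k x" for x
      unfolding g_def by (metis add.commute add_uminus_conv_diff eq_iff_diff_eq_0 mult_minus_left)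
    then show ?thesis using k by (auto simp: diag_ket s_def fun_eq_iff)
  qed
  then show "Q = ?R" using Q R by (intro bounded_ops_eqI[of Q V V ?R V]) auto
qed

section \<open>The asymptotic limit of a contractive weighted shift\<close>

locale contractive_tree = weighted_tree +
  assumes contraction: "f \<in> ell2 V \<Longrightarrow> l2_norm (shift f) \<le> l2_norm f"
begin

text \<open>The n-th term of the sequence defining \<alpha>_u, written as a norm so that
  contractivity makes it decreasing.\<close>

definition mass :: "nat \<Rightarrow> 'a \<Rightarrow> real" where
  "mass n u = (l2_norm ((shift ^^ n) (ket u)))\<^sup>2"

lemma mass_0: "mass 0 u = 1"
  by (simp add: mass_def)

lemma mass_nonneg: "0 \<le> mass n u"
  by (simp add: mass_def)

lemma mass_decseq: "u \<in> V \<Longrightarrow> decseq (\<lambda>n. mass n u)"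
  by (rule decseq_SucI) (auto simp: mass_def intro!: power_mono contraction funpow_shift_in)

lemma mass_le_1: "u \<in> V \<Longrightarrow> mass n u \<le> 1"
  using decseqD[OF mass_decseq, of u 0 n] by (simp add: mass_0)

lemma mass_eq:
  assumes u: "u \<in> V"
  shows "(\<Sum>\<^sub>\<infinity>v\<in>Chi_pow E n u. \<Prod>j<n. (lam ((par E ^^ j) v))\<^sup>2) = mass n u"
  unfolding mass_def l2_norm_sq
proof (rule infsum_cong_neutral)
  fix v assume v: "v \<in> UNIV - Chi_pow E n u"
  show "(cmod ((shift ^^ n) (ket u) v))\<^sup>2 = 0"
  proof (cases "\<exists>w. (w, v) \<in> E ^^ n")
    case True
    then obtain w where w: "(w, v) \<in> E ^^ n" by blast
    with v have "w \<noteq> u" by (auto simp: Chi_pow_iff)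
    then show ?thesis by (simp add: funpow_shift_relpow[OF w] ket_def)
  qed (simp add: funpow_shift_no_ancestor)
next
  fix v assume "v \<in> Chi_pow E n u \<inter> UNIV"
  then have "(u, v) \<in> E ^^ n" by (simp add: Chi_pow_iff)
  then show "(\<Prod>j<n. (lam ((par E ^^ j) v))\<^sup>2) = (cmod ((shift ^^ n) (ket u) v))\<^sup>2"
    by (simp add: funpow_shift_relpow ket_def norm_mult branch_prod_def prod_power_distrib del: of_real_prod)
qed simp

lemma mass_tendsto:
  assumes u: "u \<in> V"
  shows "(\<lambda>n. mass n u) \<longlonglongrightarrow> alpha E lam u"
proof -
  have "convergent (\<lambda>n. mass n u)"
    using decseq_bounded[OF mass_decseq[OF u], of 0] mass_nonneg
      mass_decseq[OF u] Bseq_monoseq_convergent decseq_imp_monoseq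
    by blast
  then show ?thesis
    unfolding alpha_def mass_eq[OF u] by (simp add: convergent_LIMSEQ_iff)
qed

lemma alpha_bounds: "u \<in> V \<Longrightarrow> 0 \<le> alpha E lam u \<and> alpha E lam u \<le> 1"
  using LIMSEQ_le_const[OF mass_tendsto, of u 0] LIMSEQ_le_const2[OF mass_tendsto, of u 1]
    mass_nonneg mass_le_1 by blast

lemma mass_as_inner:
  assumes u: "u \<in> V"
  shows "complex_of_real (mass n u) = (adj V shift ^^ n) ((shift ^^ n) (ket u)) u"
proof -
  have "complex_of_real (mass n u) = l2_inner ((shift ^^ n) (ket u)) ((shift ^^ n) (ket u))"
    by (simp only: mass_def l2_inner_same)
  also have "\<dots> = l2_inner (ket u) ((adj V shift ^^ n) ((shift ^^ n) (ket u)))"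
    using u by (intro inner_funpow_shift funpow_shift_in) auto
  finally show ?thesis by (metis complex_cnj_complex_of_real complex_cnj_cnj l2_inner_ket_left)
qed

text \<open>On Chi(u) the entries of \<open>shift g\<close> are \<open>g u\<close> times the
  weights, so S* D S is diagonal for the diagonal operator D of \<open>mass n\<close>.\<close>

lemma funpow_adj_funpow_shift:
  "f \<in> ell2 V \<Longrightarrow> (adj V shift ^^ n) ((shift ^^ n) f) = diag (mass n) f"
proof (induction n arbitrary: f)
  case 0
  then show ?case by (simp add: diag_def mass_0 fun_eq_iff)
next
  case (Suc n)
  \<comment> \<open>The new diagonal entry. Evaluation at \<open>ket u\<close> identifies it with
    \<open>mass (Suc n) u\<close>.\<close>
  define K where "K u = (\<Sum>\<^sub>\<infinity>v\<in>Chi E u. complex_of_real (mass n v * (lam v)\<^sup>2))" for u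
  have step: "(adj V shift ^^ Suc n) ((shift ^^ Suc n) g) u = g u * K u"
    if g: "g \<in> ell2 V" and u: "u \<in> V" for g u
  proof -
    have "(adj V shift ^^ Suc n) ((shift ^^ Suc n) g) u =
        adj V shift ((adj V shift ^^ n) ((shift ^^ n) (shift g))) u"
      by (simp add: funpow_swap1)
    also have "\<dots> = adj V shift (diag (mass n) (shift g)) u"
      by (simp only: Suc.IH[OF shift_in[OF g]])
    also have "\<dots> = (\<Sum>\<^sub>\<infinity>v\<in>Chi E u. g u * complex_of_real (mass n v * (lam v)\<^sup>2))"
      unfolding adj_shift[OF u]
      by (rule infsum_cong) (simp add: Chi_def diag_def shift_edge power2_eq_square)
    also have "\<dots> = g u * K u" unfolding K_def by (rule infsum_cmult_right')
    finally show ?thesis .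
  qed
  have K: "K u = complex_of_real (mass (Suc n) u)" if "u \<in> V" for u
    using step[OF ket_in_ell2[OF that] that] mass_as_inner[OF that, of "Suc n"]
    by (simp add: ket_apply del: funpow.simps)
  show ?case
  proof
    fix u show "(adj V shift ^^ Suc n) ((shift ^^ Suc n) f) u = diag (mass (Suc n)) f u"
    proof (cases "u \<in> V")
      case True
      then show ?thesis using step[OF Suc.prems True] K by (simp add: diag_def)
    next
      case False
      then show ?thesis
        using ell2_zero_outside[OF Suc.prems False] by (simp add: diag_def adj_def)
    qed
  qed
qed

lemma mass_Suc:
  assumes u: "u \<in> V"
  shows "mass (Suc n) u = (\<Sum>\<^sub>\<infinity>v\<in>Chi E u. (lam v)\<^sup>2 * mass n v)"
proof -
  have "(\<lambda>v. (lam v)\<^sup>2 * mass n v) summable_on Chi E u"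
  proof (rule summable_on_dominated[OF lam_square_summable[OF u]])
    fix v assume "v \<in> Chi E u"
    then have "v \<in> V" using edge_in by (auto simp: Chi_def)
    then show "0 \<le> (lam v)\<^sup>2 * mass n v \<and> (lam v)\<^sup>2 * mass n v \<le> (lam v)\<^sup>2"
      using mass_nonneg mass_le_1 by (auto simp: mult_left_le)
  qed
  then have "((\<lambda>v. complex_of_real ((lam v)\<^sup>2 * mass n v)) has_sum
      complex_of_real (\<Sum>\<^sub>\<infinity>v\<in>Chi E u. (lam v)\<^sup>2 * mass n v)) (Chi E u)"
    by (intro has_sum_of_real has_sum_infsum)
  then have "complex_of_real (\<Sum>\<^sub>\<infinity>v\<in>Chi E u. (lam v)\<^sup>2 * mass n v) =
      (\<Sum>\<^sub>\<infinity>v\<in>Chi E u. complex_of_real ((lam v)\<^sup>2 * mass n v))"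
    by (rule infsumI[symmetric])
  also have "\<dots> = (\<Sum>\<^sub>\<infinity>v\<in>Chi E u. diag (mass n) (shift (ket u)) v * complex_of_real (lam v))"
    by (rule infsum_cong) (simp add: Chi_def diag_def shift_edge power2_eq_square ket_def)
  also have "\<dots> = (adj V shift ^^ Suc n) ((shift ^^ Suc n) (ket u)) u"
    using u by (simp add: funpow_swap1 funpow_adj_funpow_shift[OF shift_in] adj_shift[OF u, symmetric])
  also have "\<dots> = complex_of_real (mass (Suc n) u)" by (rule mass_as_inner[OF u, symmetric])
  finally show ?thesis by (simp only: of_real_eq_iff)
qed

lemma alpha_summable:
  assumes u: "u \<in> V"
  shows "(\<lambda>v. (lam v)\<^sup>2 * alpha E lam v) summable_on Chi E u"
proof (rule summable_on_dominated[OF lam_square_summable[OF u]])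
  fix v assume "v \<in> Chi E u"
  then have "v \<in> V" using edge_in by (auto simp: Chi_def)
  then show "0 \<le> (lam v)\<^sup>2 * alpha E lam v \<and> (lam v)\<^sup>2 * alpha E lam v \<le> (lam v)\<^sup>2"
    using alpha_bounds by (auto simp: mult_left_le)
qed

text \<open>The limit of the recursion \<open>mass_Suc\<close>; limit and sum may be exchanged
  because \<open>mass\<close> is at most 1 and the squared weights are summable.\<close>

lemma alpha_eq:
  assumes u: "u \<in> V"
  shows "alpha E lam u = (\<Sum>\<^sub>\<infinity>v\<in>Chi E u. (lam v)\<^sup>2 * alpha E lam v)"
proof (rule LIMSEQ_unique)
  have Chi_V: "v \<in> V" if "v \<in> Chi E u" for v using that edge_in by (auto simp: Chi_def)
  show "(\<lambda>n. mass (Suc n) u) \<longlonglongrightarrow> alpha E lam u"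
    using mass_tendsto[OF u] by (rule LIMSEQ_Suc)
  show "(\<lambda>n. mass (Suc n) u) \<longlonglongrightarrow> (\<Sum>\<^sub>\<infinity>v\<in>Chi E u. (lam v)\<^sup>2 * alpha E lam v)"
    unfolding mass_Suc[OF u]
  proof (rule infsum_dominated_convergence[OF lam_square_summable[OF u]])
    fix n v assume "v \<in> Chi E u"
    then show "\<bar>(lam v)\<^sup>2 * mass n v\<bar> \<le> (lam v)\<^sup>2"
      using mass_nonneg mass_le_1[OF Chi_V] by (simp add: abs_mult mult_left_le)
  next
    fix v assume "v \<in> Chi E u"
    then show "(\<lambda>n. (lam v)\<^sup>2 * mass n v) \<longlonglongrightarrow> (lam v)\<^sup>2 * alpha E lam v"
      by (intro tendsto_mult tendsto_const mass_tendsto Chi_V)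
  qed
qed

text \<open>The difference of the diagonal entries is at most 1 in modulus and tends to 0, so the
  squares of the coordinates are dominated by |f|^2.\<close>

lemma diag_mass_tendsto:
  assumes f: "f \<in> ell2 V"
  shows "(\<lambda>n. l2_norm (\<lambda>x. diag (mass n) f x - diag (alpha E lam) f x)) \<longlonglongrightarrow> 0"
proof -
  let ?d = "\<lambda>n x. diag (mass n) f x - diag (alpha E lam) f x"
  have d: "?d n x = diag (\<lambda>x. mass n x - alpha E lam x) f x" for n x
    by (simp add: diag_def algebra_simps)
  have bound: "\<bar>mass n x - alpha E lam x\<bar> \<le> 1" if "x \<in> V" for n x
    using mass_nonneg[of n x] mass_le_1[OF that, of n] alpha_bounds[OF that] by linarith
  have "(\<lambda>n. (l2_norm (?d n))\<^sup>2) \<longlonglongrightarrow> (\<Sum>\<^sub>\<infinity>x\<in>V. 0)"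
  proof -
    have "(l2_norm (?d n))\<^sup>2 = (\<Sum>\<^sub>\<infinity>x\<in>V. (mass n x - alpha E lam x)\<^sup>2 * (cmod (f x))\<^sup>2)" for n
      unfolding d by (subst l2_norm_sq_on[OF diag_in[OF f bound]])
        (auto simp: diag_def norm_mult power_mult_distrib simp flip: of_real_diff)
    moreover have "(\<lambda>n. \<Sum>\<^sub>\<infinity>x\<in>V. (mass n x - alpha E lam x)\<^sup>2 * (cmod (f x))\<^sup>2) \<longlonglongrightarrow> (\<Sum>\<^sub>\<infinity>x\<in>V. 0)"
    proof (rule infsum_dominated_convergence[OF ell2_summable[OF f]])
      fix n x assume "x \<in> V"
      then have "(mass n x - alpha E lam x)\<^sup>2 \<le> 1"
        using bound[of x n] abs_le_square_iff[of _ 1] by auto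
      then show "\<bar>(mass n x - alpha E lam x)\<^sup>2 * (cmod (f x))\<^sup>2\<bar> \<le> (cmod (f x))\<^sup>2"
        by (simp add: abs_mult mult_left_le_one_le)
    next
      fix x assume x: "x \<in> V"
      have "(\<lambda>n. (mass n x - alpha E lam x)\<^sup>2 * (cmod (f x))\<^sup>2) \<longlonglongrightarrow>
          (alpha E lam x - alpha E lam x)\<^sup>2 * (cmod (f x))\<^sup>2"
        by (intro tendsto_intros mass_tendsto x)
      then show "(\<lambda>n. (mass n x - alpha E lam x)\<^sup>2 * (cmod (f x))\<^sup>2) \<longlonglongrightarrow> 0" by simp
    qed
    ultimately show ?thesis by simp
  qed
  then have "(\<lambda>n. sqrt ((l2_norm (?d n))\<^sup>2)) \<longlonglongrightarrow> sqrt 0"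
    by (intro tendsto_real_sqrt) simp
  then show ?thesis by simp
qed

definition shift_op :: "('a \<Rightarrow> complex) \<Rightarrow> ('a \<Rightarrow> complex)" where
  "shift_op = restrict shift (ell2 V)"

lemma shift_op_eq: "f \<in> ell2 V \<Longrightarrow> shift_op f = shift f"
  by (simp add: shift_op_def)

lemma funpow_shift_op: "f \<in> ell2 V \<Longrightarrow> (shift_op ^^ n) f = (shift ^^ n) f"
  by (induction n) (simp_all add: shift_op_eq funpow_shift_in)

text \<open>\<open>adj\<close> evaluates its operator only at basis vectors of
  \<open>ell2 V\<close>, so the restriction leaves it unchanged.\<close>

lemma l2_adjoint_shift_op: "f \<in> ell2 V \<Longrightarrow> l2_adjoint (ell2 V) shift_op f = adj V shift f"
  using l2_adjoint_eq[of V shift_op f] shift_bounded_on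
  by (simp add: shift_op_def) (auto simp: adj_def fun_eq_iff)

lemma funpow_l2_adjoint:
  "f \<in> ell2 V \<Longrightarrow> (l2_adjoint (ell2 V) shift_op ^^ n) f = (adj V shift ^^ n) f"
  by (induction n) (simp_all add: l2_adjoint_shift_op funpow_adj_shift_in)

lemma asymptotic_limit_eq:
  "asymptotic_limit (ell2 V) shift_op = restrict (diag (alpha E lam)) (ell2 V)"
  unfolding asymptotic_limit_def
proof (rule restrict_ext)
  fix f assume f: "f \<in> ell2 V"
  have it: "(l2_adjoint (ell2 V) shift_op ^^ n) ((shift_op ^^ n) f) = diag (mass n) f" for n
    by (simp add: funpow_shift_op f funpow_l2_adjoint funpow_shift_in funpow_adj_funpow_shift)
  have A: "diag (alpha E lam) f \<in> ell2 V"
    by (rule diag_in[OF f, where C=1]) (use alpha_bounds in auto)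
  have M: "diag (mass n) f \<in> ell2 V" for n
    by (rule diag_in[OF f, where C=1]) (use mass_nonneg mass_le_1 in auto)
  have pointwise: "(\<lambda>n. diag (mass n) f x) \<longlonglongrightarrow> h x"
    if h: "h \<in> ell2 V" "(\<lambda>n. l2_norm (\<lambda>x. diag (mass n) f x - h x)) \<longlonglongrightarrow> 0" for h x
  proof (rule LIM_zero_cancel, rule Lim_null_comparison[OF _ h(2)])
    show "\<forall>\<^sub>F n in sequentially. cmod (diag (mass n) f x - h x)
        \<le> l2_norm (\<lambda>x. diag (mass n) f x - h x)"
      using cmod_le_l2_norm[OF ell2_diff[OF M h(1)]] by auto
  qed
  show "(THE h. h \<in> ell2 V \<and> (\<lambda>n. l2_norm (\<lambda>x. (l2_adjoint (ell2 V) shift_op ^^ n)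
      ((shift_op ^^ n) f) x - h x)) \<longlonglongrightarrow> 0) = diag (alpha E lam) f"
    unfolding it
  proof (rule the_equality)
    fix h assume h: "h \<in> ell2 V \<and> (\<lambda>n. l2_norm (\<lambda>x. diag (mass n) f x - h x)) \<longlonglongrightarrow> 0"
    show "h = diag (alpha E lam) f"
    proof
      fix x show "h x = diag (alpha E lam) f x"
        using LIMSEQ_unique[OF pointwise pointwise] h A diag_mass_tendsto[OF f] by blast
    qed
  qed (use A diag_mass_tendsto[OF f] in auto)
qed

section \<open>The subtree T' and the weights \<beta>\<close>

abbreviation V' :: "'a set" where
  "V' \<equiv> supp_V V E lam"

abbreviation E' :: "('a \<times> 'a) set" where
  "E' \<equiv> supp_E V E lam"

abbreviation \<beta> :: "'a \<Rightarrow> real" where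
  "\<beta> \<equiv> beta E lam"

lemma V'_subset: "V' \<subseteq> V"
  by (auto simp: supp_V_def)

lemma alpha_zero: "u \<in> V \<Longrightarrow> u \<notin> V' \<Longrightarrow> alpha E lam u = 0"
  using alpha_bounds by (force simp: supp_V_def)

lemma diag_supp_in:
  assumes f: "f \<in> ell2 V" and m: "\<And>u. u \<in> V \<Longrightarrow> \<bar>m u\<bar> \<le> 1" "\<And>u. u \<in> V \<Longrightarrow> u \<notin> V' \<Longrightarrow> m u = 0"
  shows "diag m f \<in> ell2 V'"
proof -
  have "diag m f \<in> ell2 V" by (rule diag_in[OF f m(1)])
  moreover have "diag m f x = 0" if "x \<notin> V'" for x
    using m(2)[OF _ that] ell2_zero_outside[OF f, of x] by (cases "x \<in> V") (auto simp: diag_def)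
  ultimately show ?thesis
    using ell2_iff[of "diag m f" V] ell2_iff[of "diag m f" V'] by simp
qed

text \<open>With D the diagonal operator of \<open>mass n\<close>, ||S^n f||^2 = <f, D f> is at most
  ||f|| ||D f||, and D f tends to A f = 0. The contrapositive provides a vertex of T'.\<close>

lemma C0_dot_if_V'_empty:
  assumes "V' = {}"
  shows "C0_dot (ell2 V) shift_op"
proof -
  have "(\<lambda>n. l2_norm ((shift_op ^^ n) f)) \<longlonglongrightarrow> 0" if f: "f \<in> ell2 V" for f
  proof -
    have zero: "diag (alpha E lam) f = (\<lambda>_. 0)"
    proof
      fix x show "diag (alpha E lam) f x = 0"
        using alpha_zero[of x] assms ell2_zero_outside[OF f, of x] by (cases "x \<in> V") (auto simp: diag_def)
    qed
    have le: "(l2_norm ((shift_op ^^ n) f))\<^sup>2 \<le> l2_norm f * l2_norm (diag (mass n) f)" for n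
    proof -
      have "complex_of_real ((l2_norm ((shift ^^ n) f))\<^sup>2) = l2_inner f (diag (mass n) f)"
        unfolding l2_inner_same[symmetric] inner_funpow_shift[OF f funpow_shift_in[OF f]]
          funpow_adj_funpow_shift[OF f] ..
      then have "(l2_norm ((shift ^^ n) f))\<^sup>2 = cmod (l2_inner f (diag (mass n) f))"
        by (metis norm_of_real abs_of_nonneg zero_le_power2)
      also have "\<dots> \<le> l2_norm f * l2_norm (diag (mass n) f)"
        by (rule cauchy_schwarz[OF f diag_in[OF f, where C=1]]) (use mass_nonneg mass_le_1 in auto)
      finally show ?thesis by (simp add: funpow_shift_op f)
    qed
    have "(\<lambda>n. l2_norm f * l2_norm (diag (mass n) f)) \<longlonglongrightarrow> 0"
      using tendsto_mult_right_zero[OF diag_mass_tendsto[OF f]] by (simp add: zero)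
    then have "(\<lambda>n. (l2_norm ((shift_op ^^ n) f))\<^sup>2) \<longlonglongrightarrow> 0"
      by (rule Lim_null_comparison[rotated]) (use le in auto)
    then have "(\<lambda>n. sqrt ((l2_norm ((shift_op ^^ n) f))\<^sup>2)) \<longlonglongrightarrow> sqrt 0"
      by (rule tendsto_real_sqrt)
    then show ?thesis by simp
  qed
  then show ?thesis by (auto simp: C0_dot_def stable_subspace_def)
qed

lemma asymptote_space_eq: "asymptote_space (ell2 V) shift_op = ell2 V'"
  unfolding asymptote_space_def asymptotic_limit_eq
proof
  let ?A = "restrict (diag (alpha E lam)) (ell2 V)"
  have A: "?A f \<in> ell2 V'" if f: "f \<in> ell2 V" for f
    using diag_supp_in[OF f, of "alpha E lam"] f alpha_bounds alpha_zero by auto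
  show "l2_closure (?A ` ell2 V) \<subseteq> ell2 V'"
  proof
    fix h assume h: "h \<in> l2_closure (?A ` ell2 V)"
    have sub: "?A ` ell2 V \<subseteq> ell2 UNIV" using A ell2_UNIV_I by blast
    obtain g where g: "\<And>n. g n \<in> ?A ` ell2 V" "\<And>x. (\<lambda>n::nat. g n x) \<longlonglongrightarrow> h x"
      using l2_closure_pointwise[OF h sub] by metis
    have "h x = 0" if x: "x \<notin> V'" for x
    proof -
      have "g n x = 0" for n
      proof -
        obtain f where "f \<in> ell2 V" "g n = ?A f" using g(1)[of n] by (rule imageE)
        then show ?thesis using ell2_zero_outside[OF A x] by simp
      qed
      then show ?thesis using g(2)[of x] by (simp add: LIMSEQ_const_iff)
    qed
    then show "h \<in> ell2 V'" using h ell2_iff[of h V'] by (auto simp: l2_closure_def)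
  qed
  show "ell2 V' \<subseteq> l2_closure (?A ` ell2 V)"
  proof
    fix h assume h: "h \<in> ell2 V'"
    have "\<exists>g\<in>?A ` ell2 V. l2_norm (\<lambda>x. h x - g x) < \<epsilon>" if "\<epsilon> > 0" for \<epsilon>
    proof -
      have "\<forall>\<^sub>F F in finite_subsets_at_top V'. l2_norm (\<lambda>x. h x - truncate F h x) < \<epsilon>"
        using order_tendstoD(2)[OF truncate_tendsto[OF h] that] .
      then obtain F where F: "finite F" "F \<subseteq> V'" "l2_norm (\<lambda>x. h x - truncate F h x) < \<epsilon>"
        unfolding eventually_finite_subsets_at_top by blast
      \<comment> \<open>\<alpha> may come arbitrarily close to 0, so the division by it is performed
        only on a finite set.\<close>
      let ?f = "truncate F (\<lambda>x. h x / complex_of_real (alpha E lam x))"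
      have f: "?f \<in> ell2 V"
        by (rule ell2_finite_support[of F]) (use F V'_subset in \<open>auto simp: truncate_def\<close>)
      have "?A ?f = truncate F h"
        using f F(2) by (auto simp: diag_def truncate_def fun_eq_iff supp_V_def)
      then show ?thesis using F(3) f by (metis imageI)
    qed
    then show "h \<in> l2_closure (?A ` ell2 V)"
      using h ell2_UNIV_I by (auto simp: l2_closure_def)
  qed
qed

text \<open>By the recursion, \<alpha>_u is at least \<lambda>_v^2 \<alpha>_v for a child v of u. So
  V' contains the parents of its vertices, and an edge belongs to T' as soon as its lower end
  does.\<close>

lemma supp_edge: "(u, v) \<in> E' \<longleftrightarrow> (u, v) \<in> E \<and> v \<in> V'"
proof -
  have "u \<in> V'" if e: "(u, v) \<in> E" and v: "v \<in> V'" for u v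
  proof -
    have u: "u \<in> V" using edge_in[OF e] by blast
    have "0 < (lam v)\<^sup>2 * alpha E lam v" using lam_pos_edge[OF e] v by (simp add: supp_V_def)
    also have "\<dots> = (\<Sum>v\<in>{v}. (lam v)\<^sup>2 * alpha E lam v)" by simp
    also have "\<dots> \<le> (\<Sum>\<^sub>\<infinity>v\<in>Chi E u. (lam v)\<^sup>2 * alpha E lam v)"
    proof (rule finite_sum_le_infsum[OF alpha_summable[OF u]])
      show "{v} \<subseteq> Chi E u" using e by (simp add: Chi_def)
      fix w assume "w \<in> Chi E u - {v}"
      then show "0 \<le> (lam w)\<^sup>2 * alpha E lam w"
        using alpha_bounds edge_in by (auto simp: Chi_def)
    qed simp
    also have "\<dots> = alpha E lam u" by (rule alpha_eq[OF u, symmetric])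
    finally show ?thesis using u by (simp add: supp_V_def)
  qed
  then show ?thesis by (auto simp: supp_E_def)
qed

lemma supp_relpow: "(w, v) \<in> E ^^ n \<Longrightarrow> v \<in> V' \<Longrightarrow> (w, v) \<in> E' ^^ n \<and> w \<in> V'"
proof (induction n arbitrary: v)
  case (Suc n)
  then obtain u where u: "(w, u) \<in> E ^^ n" "(u, v) \<in> E" by auto
  then have e: "(u, v) \<in> E'" using Suc.prems supp_edge by blast
  then have "u \<in> V'" by (simp add: supp_E_def)
  with Suc.IH[OF u(1)] e show ?case by auto
qed simp

text \<open>Connectedness is the point: paths from a common ancestor down to vertices of V' stay
  inside V'.\<close>

lemma supp_tree:
  assumes "V' \<noteq> {}"
  shows "directed_tree V' E'"
  unfolding directed_tree_def
proof (intro conjI ballI)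
  show "E' \<subseteq> V' \<times> V' - {(v, v) |v. v \<in> V'}"
    using relpow_loop[of _ 1] by (auto simp: supp_E_def)
  show "acyclic E'"
    using directed_tree acyclic_subset[of E E'] by (auto simp: directed_tree_def supp_E_def)
  show "\<forall>v u w. (u, v) \<in> E' \<and> (w, v) \<in> E' \<longrightarrow> u = w"
    using parent_unique by (auto simp: supp_E_def)
  fix u v assume u: "u \<in> V'" and v: "v \<in> V'"
  then obtain w m n where w: "(w, u) \<in> E ^^ m" "(w, v) \<in> E ^^ n"
    using common_ancestor[of u v] V'_subset by (metis subsetD)
  have "(w, u) \<in> E'\<^sup>*" "(w, v) \<in> E'\<^sup>*"
    using supp_relpow[OF w(1) u] supp_relpow[OF w(2) v] relpow_imp_rtrancl by blast+
  then have "(u, w) \<in> (E'\<inverse>)\<^sup>*" "(w, v) \<in> E'\<^sup>*" by (auto simp: rtrancl_converse)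
  then have "(u, w) \<in> (E' \<union> E'\<inverse>)\<^sup>*" "(w, v) \<in> (E' \<union> E'\<inverse>)\<^sup>*"
    using rtrancl_mono[of "E'\<inverse>" "E' \<union> E'\<inverse>"] rtrancl_mono[of E' "E' \<union> E'\<inverse>"] by auto
  then show "(u, v) \<in> (E' \<union> E'\<inverse>)\<^sup>*" by (rule rtrancl_trans)
qed (rule assms)

lemma supp_Chi: "Chi E' u = Chi E u \<inter> V'"
  by (auto simp: Chi_def supp_edge)

lemma supp_root: "is_root V' E' r \<longleftrightarrow> r \<in> V' \<and> is_root V E r"
  using V'_subset by (auto simp: is_root_def supp_edge)

lemma supp_non_roots: "v \<in> non_roots V' E' \<longleftrightarrow> v \<in> V' \<and> (par E v, v) \<in> E"
  using non_roots_iff[of v] V'_subset by (auto simp: non_roots_def supp_root)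

lemma supp_has_root:
  assumes "V' \<noteq> {}"
  shows "has_root V' E' \<longleftrightarrow> has_root V E"
proof
  assume "has_root V E"
  then obtain r where r: "is_root V E r" by (auto simp: has_root_def)
  obtain v where v: "v \<in> V'" using assms by blast
  then obtain n where "(r, v) \<in> E ^^ n" using root_ancestor[OF r] V'_subset by blast
  then have "r \<in> V'" using supp_relpow v by blast
  then show "has_root V' E'" using r supp_root by (auto simp: has_root_def)
qed (auto simp: has_root_def supp_root)

lemma supp_edge_pos:
  assumes "(u, v) \<in> E'"
  shows "0 < alpha E lam u" "0 < alpha E lam v" "(u, v) \<in> E" "u \<in> V" "v \<in> V"
  using assms by (auto simp: supp_E_def supp_V_def)

lemma beta_square:
  assumes "(u, v) \<in> E'"
  shows "(\<beta> v)\<^sup>2 = (lam v)\<^sup>2 * alpha E lam v / alpha E lam u"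
  using supp_edge_pos[OF assms] par_eq
  by (simp add: beta_def power_mult_distrib power_divide)

text \<open>This is the recursion for \<alpha>_u divided by \<alpha>_u; children outside V'
  contribute 0.\<close>

lemma beta_has_sum:
  assumes u: "u \<in> V'"
  shows "((\<lambda>v. (\<beta> v)\<^sup>2) has_sum 1) (Chi E' u)"
proof -
  have uV: "u \<in> V" and pos: "0 < alpha E lam u" using u by (auto simp: supp_V_def)
  have "((\<lambda>v. (lam v)\<^sup>2 * alpha E lam v) has_sum alpha E lam u) (Chi E u)"
    using alpha_eq[OF uV] alpha_summable[OF uV] by (metis has_sum_infsum)
  then have "((\<lambda>v. (lam v)\<^sup>2 * alpha E lam v / alpha E lam u) has_sum
      alpha E lam u / alpha E lam u) (Chi E u)"
    by (rule has_sum_divide_const)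
  then have "((\<lambda>v. (lam v)\<^sup>2 * alpha E lam v / alpha E lam u) has_sum 1) (Chi E u)"
    using pos by simp
  then show ?thesis
  proof (rule has_sum_cong_neutral[THEN iffD1, rotated 3])
    fix v assume "v \<in> Chi E u - Chi E' u"
    then show "(lam v)\<^sup>2 * alpha E lam v / alpha E lam u = 0"
      using alpha_zero[of v] edge_in[of u v] supp_edge[of u v] by (auto simp: Chi_def)
  next
    fix v assume "v \<in> Chi E' u - Chi E u"
    then show "(\<beta> v)\<^sup>2 = 0" by (auto simp: supp_Chi)
  next
    fix v assume "v \<in> Chi E u \<inter> Chi E' u"
    then show "(lam v)\<^sup>2 * alpha E lam v / alpha E lam u = (\<beta> v)\<^sup>2"
      using beta_square[of u v] by (auto simp: Chi_def)
  qed
qed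

lemma supp_isometric_tree:
  assumes ne: "V' \<noteq> {}"
  shows "isometric_tree V' E' \<beta>"
proof (unfold_locales)
  show "directed_tree V' E'" by (rule supp_tree[OF ne])
  have "0 < \<beta> v" if "v \<in> non_roots V' E'" for v
  proof -
    have "(par E v, v) \<in> E'" using that by (simp add: supp_non_roots supp_edge)
    from supp_edge_pos[OF this] show ?thesis
      using lam_pos_edge by (auto simp: beta_def)
  qed
  then show "admissible_weights V' E' \<beta>"
    using beta_has_sum by (auto simp: admissible_weights_def has_sum_iff intro!: exI[of _ 1])
  show "(\<Sum>\<^sub>\<infinity>v\<in>Chi E' u. (\<beta> v)\<^sup>2) = 1" if "u \<in> V'" for u
    using beta_has_sum[OF that] by (rule infsumI)
qed

section \<open>The isometric asymptote and the final theorem\<close>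

text \<open>The candidate satisfies the intertwining relation coordinate by coordinate. It is the
  only one because every basis vector of \<open>ell2 V'\<close> is in the range of the square root
  of A, so the relation fixes U on the basis.\<close>

lemma isometric_asymptote_eq:
  assumes ne: "V' \<noteq> {}"
  shows "isometric_asymptote (ell2 V) shift_op =
    restrict (weighted_tree.shift V' E' \<beta>) (ell2 V')"
proof -
  interpret T: isometric_tree V' E' \<beta> by (rule supp_isometric_tree[OF ne])
  let ?R = "restrict (diag (\<lambda>u. sqrt (alpha E lam u))) (ell2 V)"
  let ?U = "restrict T.shift (ell2 V')"
  have R_in: "?R h \<in> ell2 V'" if h: "h \<in> ell2 V" for h
    using diag_supp_in[OF h, of "\<lambda>u. sqrt (alpha E lam u)"] h alpha_bounds alpha_zero by auto
  have sqrt_eq: "pos_sqrt (ell2 V) (asymptotic_limit (ell2 V) shift_op) = ?R"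
    unfolding asymptotic_limit_eq by (rule pos_sqrt_diag[OF alpha_bounds])
  have inter: "?R (shift_op h) = ?U (?R h)" if h: "h \<in> ell2 V" for h
  proof
    fix v
    have U_eq: "?U (?R h) v = T.shift (diag (\<lambda>u. sqrt (alpha E lam u)) h) v"
      using R_in[OF h] h by simp
    have R_eq: "?R (shift_op h) v = complex_of_real (sqrt (alpha E lam v)) * shift h v"
      using h by (simp add: shift_op_eq shift_in diag_def)
    show "?R (shift_op h) v = ?U (?R h) v"
    proof (cases "v \<in> non_roots V' E'")
      case True
      then have e: "(par E v, v) \<in> E'" by (simp add: supp_non_roots supp_edge)
      note pos = supp_edge_pos[OF e]
      \<comment> \<open>The origin of the weights \<beta>: these are the coefficients at v on the
        two sides of the intertwining relation.\<close>
      have "complex_of_real (sqrt (alpha E lam v)) * complex_of_real (lam v) =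
          complex_of_real (\<beta> v) * complex_of_real (sqrt (alpha E lam (par E v)))"
        using pos by (simp add: beta_def)
      then show ?thesis
        unfolding U_eq R_eq T.shift_edge[OF e] shift_edge[OF pos(3)] by (simp add: diag_def)
    next
      case False
      \<comment> \<open>Outside V' the square root of A annihilates the coordinate, and at a root
        the shift does.\<close>
      then have "v \<notin> V' \<or> v \<notin> non_roots V E" by (auto simp: supp_non_roots non_roots_iff)
      then have "?R (shift_op h) v = 0"
        unfolding R_eq using alpha_zero[of v] ell2_zero_outside[OF shift_in[OF h], of v]
        by (cases "v \<in> V") (auto simp: shift_not_edge)
      then show ?thesis unfolding U_eq T.shift_not_edge[OF False] .
    qed
  qed
  show ?thesis
    unfolding isometric_asymptote_def asymptote_space_eq sqrt_eq
  proof (rule the_equality)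
    show "isometry_on (ell2 V') ?U \<and> (\<forall>h\<in>ell2 V. ?R (shift_op h) = ?U (?R h))"
      using inter T.shift_bounded_on bounded_on_restrict[of V' V' T.shift] T.norm_shift
      by (auto simp: isometry_on_def bounded_on_def)
    fix U assume U: "isometry_on (ell2 V') U \<and> (\<forall>h\<in>ell2 V. ?R (shift_op h) = U (?R h))"
    then have "U \<in> bounded_ops (ell2 V') (ell2 V')"
      by (auto simp: isometry_on_def bounded_ops_def intro!: exI[of _ 1])
    moreover have "?U \<in> bounded_ops (ell2 V') (ell2 V')"
      by (rule restrict_in_bounded_ops[OF T.shift_bounded_on])
    moreover have "U (ket u) = ?U (ket u)" if u: "u \<in> V'" for u
    proof -
      \<comment> \<open>The preimage of e_u under the square root of A.\<close>
      let ?h = "\<lambda>x. complex_of_real (1 / sqrt (alpha E lam u)) * ket u x"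
      have h: "?h \<in> ell2 V" using u V'_subset by (intro ell2_scale ket_in_ell2) auto
      have "?R ?h = ket u"
        using u h by (auto simp: diag_def ket_def fun_eq_iff supp_V_def)
      then show ?thesis using U inter[OF h] h by metis
    qed
    ultimately show "U = ?U" by (rule bounded_ops_eqI)
  qed
qed

end

text \<open>\<open>op_norm\<close> is a supremum over the unit ball, finite because T is bounded. A
  nonzero vector is rescaled to norm 1; norm 0 is settled by boundedness.\<close>

lemma l2_norm_le_if_op_norm_le_1:
  assumes T: "bounded_on V W T" and le: "op_norm (ell2 V) T \<le> 1" and f: "f \<in> ell2 V"
  shows "l2_norm (T f) \<le> l2_norm f"
proof (cases "l2_norm f = 0")
  case True
  obtain C where "\<And>f. f \<in> ell2 V \<Longrightarrow> l2_norm (T f) \<le> C * l2_norm f"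
    using bounded_on_bound[OF T] by blast
  from this[OF f] True show ?thesis by simp
next
  case False
  then have pos: "0 < l2_norm f" using l2_norm_nonneg[of f] by linarith
  obtain C where C: "0 \<le> C" "\<And>f. f \<in> ell2 V \<Longrightarrow> l2_norm (T f) \<le> C * l2_norm f"
    using bounded_on_bound[OF T] by blast
  let ?c = "complex_of_real (1 / l2_norm f)"
  let ?g = "\<lambda>x. ?c * f x"
  have g: "?g \<in> ell2 V" "l2_norm ?g = 1"
    using pos ell2_scale[OF f, of ?c] l2_norm_scale[of ?c f] by (auto simp: norm_divide)
  have "l2_norm (T ?g) \<le> op_norm (ell2 V) T"
    unfolding op_norm_def
  proof (rule cSUP_upper)
    show "bdd_above ((\<lambda>f. l2_norm (T f)) ` {f \<in> ell2 V. l2_norm f \<le> 1})"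
    proof (rule bdd_aboveI2)
      fix h assume "h \<in> {f \<in> ell2 V. l2_norm f \<le> 1}"
      then have "l2_norm (T h) \<le> C * l2_norm h" "C * l2_norm h \<le> C * 1"
        using C(2)[of h] C(1) by (auto intro!: mult_left_mono simp del: mult_1_right)
      then show "l2_norm (T h) \<le> C" by simp
    qed
  qed (use g in auto)
  moreover have "T ?g = (\<lambda>x. ?c * T f x)"
  proof -
    have z: "T (\<lambda>_. 0) = (\<lambda>_. 0)"
      using C(2)[of "\<lambda>_. 0"] l2_norm_eq_0[OF bounded_on_in[OF T zero_in_ell2]]
      by (simp add: order_antisym)
    show ?thesis using bounded_on_lincomb[OF T f zero_in_ell2, of ?c] by (simp add: z)
  qed
  ultimately have "cmod ?c * l2_norm (T f) \<le> 1"
    using le l2_norm_scale[of ?c "T f"] by simp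
  then show ?thesis using pos by (simp add: norm_divide field_simps)
qed

theorem theorem4p1:
  fixes V :: "'a set" and E :: "('a \<times> 'a) set" and lam :: "'a \<Rightarrow> real"
    and S U :: "('a \<Rightarrow> complex) \<Rightarrow> ('a \<Rightarrow> complex)"
    and V' :: "'a set" and E' :: "('a \<times> 'a) set" and b :: "'a \<Rightarrow> real"
  assumes tree: "directed_tree V E"
    and weights: "admissible_weights V E lam"
    and S_eq: "S = weighted_shift V E lam"
    and contractive: "op_norm (ell2 V) S \<le> 1"
    and not_C0: "\<not> C0_dot (ell2 V) S"
    and U_eq: "U = isometric_asymptote (ell2 V) S"
    and V'_eq: "V' = supp_V V E lam"
    and E'_eq: "E' = supp_E V E lam"
    and b_eq: "b = beta E lam"
  shows
    "asymptote_space (ell2 V) S = ell2 V' \<and>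
     directed_tree V' E' \<and> admissible_weights V' E' b \<and>
     U = weighted_shift V' E' b \<and> U \<in> bounded_ops (ell2 V') (ell2 V') \<and>
     (has_root V E \<longrightarrow>
        unitarily_equivalent (ell2 V') U
          (ell2 (copies (Br V' E' + 1) \<times> UNIV)) (shift_sum (Br V' E' + 1))) \<and>
     (\<not> has_root V E \<longrightarrow>
        (completely_nonunitary (ell2 V') U \<longleftrightarrow> (\<exists>u'\<in>V'. gen_sum E' b u' = 0)) \<and>
        (completely_nonunitary (ell2 V') U \<longrightarrow>
           unitarily_equivalent (ell2 V') U
             (ell2 (copies (Br V' E') \<times> UNIV)) (shift_sum (Br V' E'))) \<and>
        (\<not> completely_nonunitary (ell2 V') U \<longrightarrow>
           unitarily_equivalent (ell2 V') U
             (ell2 (UNIV <+> (copies (Br V' E') \<times> UNIV)))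
             (orth_sum2 UNIV bilateral_shift
                (copies (Br V' E') \<times> UNIV) (shift_sum (Br V' E')))))"
proof -
  interpret weighted_tree V E lam by unfold_locales (fact tree weights)+
  have S_shift: "S = restrict shift (ell2 V)" by (simp only: S_eq weighted_shift_eq)
  interpret contractive_tree V E lam
  proof unfold_locales
    fix f assume f: "f \<in> ell2 V"
    have "l2_norm (S f) \<le> l2_norm f"
      by (rule l2_norm_le_if_op_norm_le_1[OF _ contractive f, of V]) (simp add: S_shift shift_bounded_on)
    then show "l2_norm (shift f) \<le> l2_norm f" using f by (simp add: S_shift)
  qed
  have S: "S = shift_op" by (simp only: S_shift shift_op_def)
  \<comment> \<open>Here the hypothesis on the class of S enters: it makes T' a nonempty
    tree.\<close>
  have ne: "supp_V V E lam \<noteq> {}" using C0_dot_if_V'_empty not_C0 S by blast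
  have roots: "has_root V' E' \<longleftrightarrow> has_root V E" unfolding V'_eq E'_eq by (rule supp_has_root[OF ne])
  interpret T: isometric_tree V' E' b
    unfolding V'_eq E'_eq b_eq by (rule supp_isometric_tree[OF ne])
  have U: "U = restrict T.shift (ell2 V')"
    unfolding U_eq S isometric_asymptote_eq[OF ne] V'_eq E'_eq b_eq ..
  have U_ops: "U \<in> bounded_ops (ell2 V') (ell2 V')"
    unfolding U by (rule restrict_in_bounded_ops[OF T.shift_bounded_on])
  have U_weighted: "U = weighted_shift V' E' b" by (simp only: U T.weighted_shift_eq)
  have space: "asymptote_space (ell2 V) S = ell2 V'" unfolding S V'_eq by (rule asymptote_space_eq)
  show ?thesis
  proof (cases "has_root V E")
    case True
    then have "unitarily_equivalent (ell2 V') U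
        (ell2 (copies (Br V' E' + 1) \<times> UNIV)) (shift_sum (Br V' E' + 1))"
      unfolding U using roots by (intro T.rooted_model) simp
    with True show ?thesis
      by (intro conjI impI space T.directed_tree T.admissible U_weighted U_ops) simp_all
  next
    case False
    interpret R: rootless_isometric_tree V' E' b
      by unfold_locales (use roots False in blast)
    from False show ?thesis
      by (intro conjI impI space T.directed_tree T.admissible U_weighted U_ops
          R.rootless_model[folded U]) simp_all
  qed
qed

end
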